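(* Let $\mathbf w=(\omega_k)_{k\ge 0}$ be a weight sequence (of any type I, II or III), let $\mathcal{T}_n$ be the associated simply generated tree with $n$ vertices, and let $\hat{\mathcal{T}}$ be the corresponding local limit of $\mathcal{T}_n$ around the root. As $n\to\infty$ along those $n$ for which $\mathcal{T}_n$ is defined, \[ \partial(\mathcal{T}_n)\xrightarrow{d}\partial(\hat{\mathcal{T}}),\qquad \mathbf{E}\bigl[\partial(\mathcal{T}_n)^p\bigr]\to\mathbf{E}\bigl[\partial(\hat{\mathcal{T}})^p\bigr]\quad\text{for every } p\ge 1. \]
   Context: **Simply generated trees.** A weight sequence is a sequence $\mathbf w=(\omega_k)_{k\ge0}$ of non-negative reals with $\omega_0>0$ and $\omega_k>0$ for at least one $k\ge2$. For $n\ge 1$, $\mathcal{T}_n$ is the random rooted plane tree with $n$ vertices such that $\mathbf P(\mathcal{T}_n=T)$ is proportional to $\prod_{v\in T}\omega_{d_T^+(v)}$ for each $n$-vertex rooted plane tree $T$, where $d_T^+(v)$ is the outdegree (number of children) of $v$. Only those $n$ are considered for which some $n$-vertex tree has positive weight ("$\mathcal{T}_n$ is defined"). **Types and offspring law $\xi$.** Let $\Phi(z)=\sum_{k\ge0}\omega_kz^k$ with radius of convergence $R\in[0,\infty]$. Type I: there is a (finite) $\tau\in(0,R]$ with $\Phi(\tau)<\infty$ and $\tau\Phi'(\tau)/\Phi(\tau)=1$; then $\mathbf P(\xi=k)=\omega_k\tau^k/\Phi(\tau)$. Type II: $R>0$, $\Phi(R)<\infty$ and $R\Phi'(R)/\Phi(R)<1$;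 then $\mathbf P(\xi=k)=\omega_kR^k/\Phi(R)$. Type III: $R=0$; then $\xi=0$ almost surely. Put $p_k=\mathbf P(\xi=k)$ and $m=\mathbf E[\xi]\le1$. Let $\hat\xi$ have law $\mathbf P(\hat\xi=k)=kp_k$ for $k\in\{0,1,2,\dots\}$ and $\mathbf P(\hat\xi=\infty)=1-m$. **The root limit tree $\hat{\mathcal{T}}$.** It is a random infinite tree with normal and special vertices; the root is special. Normal vertices have offspring numbers given by independent copies of $\xi$, special vertices by independent copies of $\hat\xi$. All children of a normal vertex are normal. If a special vertex has infinitely many children, all of them are normal; if it has $k<\infty$ children, exactly one of them, chosen uniformly at random, is special and the other $k-1$ are normal. **Distance to the border.** A leaf is a vertex with no children. For a rooted tree $T$, $\partial(T)$ is the minimal graph distance from the root to a leaf of $T$ ($\partial(T)=\infty$ if $T$ has no leaf). *)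

theory Defs
  imports "HOL-Probability.Probability"
begin

section \<open>Rooted plane trees\<close>

text \<open>
  A rooted plane tree is represented by its set of vertices in Ulam--Harris notation: a vertex is
  the word of (0-based) child indices read from the root, so that the root is the empty word and
  \<^term>\<open>u @ [i]\<close> is the child number \<^term>\<open>i\<close> of \<^term>\<open>u\<close>. Infinite trees, and vertices
  with infinitely many children, are allowed.
\<close>

definition plane_tree :: "nat list set \<Rightarrow> bool" where
  "plane_tree T \<longleftrightarrow>
     [] \<in> T \<and>
     (\<forall>u i. u @ [i] \<in> T \<longrightarrow> u \<in> T) \<and>
     (\<forall>u i j. u @ [i] \<in> T \<longrightarrow> j < i \<longrightarrow> u @ [j] \<in> T)"

definition children :: "nat list set \<Rightarrow> nat list \<Rightarrow> nat list set" where
  "children T u = {u @ [i] | i. u @ [i] \<in> T}"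

definition leaves :: "nat list set \<Rightarrow> nat list set" where
  "leaves T = {u \<in> T. children T u = {}}"

text \<open>
  The graph distance between the root and a vertex is the length of the corresponding word. The
  infimum over the empty set is \<^term>\<open>\<infinity> :: enat\<close>.
\<close>

definition border_dist :: "nat list set \<Rightarrow> enat" where
  "border_dist T = (INF u\<in>leaves T. enat (length u))"

definition plane_trees :: "nat \<Rightarrow> nat list set set" where
  "plane_trees n = {T. plane_tree T \<and> finite T \<and> card T = n}"


section \<open>Simply generated trees\<close>

definition weight_sequence :: "(nat \<Rightarrow> real) \<Rightarrow> bool" where
  "weight_sequence w \<longleftrightarrow> (\<forall>k. w k \<ge> 0) \<and> w 0 > 0 \<and> (\<exists>k\<ge>2. w k > 0)"

definition tree_weight :: "(nat \<Rightarrow> real) \<Rightarrow> nat list set \<Rightarrow> real" where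
  "tree_weight w T = (\<Prod>v\<in>T. w (card (children T v)))"

definition sgt_defined :: "(nat \<Rightarrow> real) \<Rightarrow> nat \<Rightarrow> bool" where
  "sgt_defined w n \<longleftrightarrow> (\<exists>T\<in>plane_trees n. tree_weight w T > 0)"

text \<open>Only meaningful if \<^term>\<open>sgt_defined w n\<close>; see \<open>pmf_simply_generated_tree\<close> below.\<close>

definition simply_generated_tree :: "(nat \<Rightarrow> real) \<Rightarrow> nat \<Rightarrow> nat list set pmf" where
  "simply_generated_tree w n =
     embed_pmf (\<lambda>T. if T \<in> plane_trees n
                    then tree_weight w T / (\<Sum>T'\<in>plane_trees n. tree_weight w T') else 0)"


section \<open>Types and the offspring law\<close>

text \<open>
  The generating function and its (termwise) derivative take values in \<^typ>\<open>ennreal\<close>, so that they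
  make sense on the boundary of the disc of convergence and may be infinite there.
\<close>

definition gen_fun :: "(nat \<Rightarrow> real) \<Rightarrow> real \<Rightarrow> ennreal" where
  "gen_fun w z = (\<Sum>k. ennreal (w k * z ^ k))"

definition gen_fun_deriv :: "(nat \<Rightarrow> real) \<Rightarrow> real \<Rightarrow> ennreal" where
  "gen_fun_deriv w z = (\<Sum>k. ennreal (real k * w k * z ^ (k - 1)))"

definition type_I_at :: "(nat \<Rightarrow> real) \<Rightarrow> real \<Rightarrow> bool" where
  "type_I_at w t \<longleftrightarrow>
     0 < t \<and> ereal t \<le> conv_radius w \<and> gen_fun w t < \<infinity> \<and>
     ennreal t * gen_fun_deriv w t / gen_fun w t = 1"

text \<open>
  An infinite radius of convergence is excluded here because the series then diverges to infinity
  at infinity, some \<^term>\<open>w k\<close> with \<^term>\<open>k \<ge> 2\<close> being positive.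
\<close>

definition type_II_at :: "(nat \<Rightarrow> real) \<Rightarrow> real \<Rightarrow> bool" where
  "type_II_at w r \<longleftrightarrow>
     conv_radius w = ereal r \<and> 0 < r \<and> gen_fun w r < \<infinity> \<and>
     ennreal r * gen_fun_deriv w r / gen_fun w r < 1"

definition type_III :: "(nat \<Rightarrow> real) \<Rightarrow> bool" where
  "type_III w \<longleftrightarrow> conv_radius w = 0"

definition tilted_pmf :: "(nat \<Rightarrow> real) \<Rightarrow> real \<Rightarrow> nat pmf" where
  "tilted_pmf w t = embed_pmf (\<lambda>k. w k * t ^ k / enn2real (gen_fun w t))"

text \<open>
  The last case is exactly type III, and the numbers chosen in the first two cases are unique: see
  \<open>weight_sequence_types\<close>, \<open>type_I_at_unique\<close> and \<open>offspring_pmf_type_I\<close> to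
  \<open>offspring_pmf_type_III\<close> below.
\<close>

definition offspring_pmf :: "(nat \<Rightarrow> real) \<Rightarrow> nat pmf" where
  "offspring_pmf w =
     (if \<exists>t. type_I_at w t then tilted_pmf w (THE t. type_I_at w t)
      else if \<exists>r. type_II_at w r then tilted_pmf w (THE r. type_II_at w r)
      else return_pmf 0)"

definition size_biased_pmf :: "nat pmf \<Rightarrow> enat pmf" where
  "size_biased_pmf p =
     embed_pmf (\<lambda>k. case k of
         enat j \<Rightarrow> real j * pmf p j
       | \<infinity> \<Rightarrow> 1 - measure_pmf.expectation p real)"


section \<open>The local limit around the root\<close>

text \<open>
  Every word \<^term>\<open>u\<close> independently receives a triple of labels: the number of children
  \<^term>\<open>u\<close> has if it is a normal vertex; the number of children it has if it is a special vertex;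
  and the index of its special child in the latter case, uniformly distributed given the number of
  children. The third label is irrelevant (and set to 0) if the second one is infinite.
\<close>

type_synonym labelling = "nat list \<Rightarrow> nat \<times> enat \<times> nat"

definition special_label_pmf :: "nat pmf \<Rightarrow> (enat \<times> nat) pmf" where
  "special_label_pmf p =
     bind_pmf (size_biased_pmf p) (\<lambda>k.
       map_pmf (Pair k) (case k of enat j \<Rightarrow> pmf_of_set {..<j} | \<infinity> \<Rightarrow> return_pmf 0))"

definition label_pmf :: "nat pmf \<Rightarrow> (nat \<times> enat \<times> nat) pmf" where
  "label_pmf p = pair_pmf p (special_label_pmf p)"

definition labelling_space :: "nat pmf \<Rightarrow> labelling measure" where
  "labelling_space p = Pi\<^sub>M UNIV (\<lambda>_. measure_pmf (label_pmf p))"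

inductive special :: "labelling \<Rightarrow> nat list \<Rightarrow> bool" for l :: labelling where
  root: "special l []"
| child: "special l u \<Longrightarrow> l u = (a, enat k, j) \<Longrightarrow> special l (u @ [j])"

definition offspring_number :: "labelling \<Rightarrow> nat list \<Rightarrow> enat" where
  "offspring_number l u = (case l u of (a, b, j) \<Rightarrow> if special l u then b else enat a)"

inductive_set limit_tree :: "labelling \<Rightarrow> nat list set" for l :: labelling where
  root: "[] \<in> limit_tree l"
| child: "u \<in> limit_tree l \<Longrightarrow> enat i < offspring_number l u \<Longrightarrow> u @ [i] \<in> limit_tree l"


section \<open>Convergence\<close>

text \<open>
  Weak convergence along an arbitrary filter. It is used below on \<^typ>\<open>enat\<close>, whose library
  topology is the order topology: every finite number is isolated, and the sets containing
  \<^term>\<open>{enat k..}\<close> for some \<^term>\<open>k\<close> are the neighbourhoods of infinity.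
\<close>

definition conv_in_distribution ::
    "('i \<Rightarrow> 'a::topological_space measure) \<Rightarrow> 'a measure \<Rightarrow> 'i filter \<Rightarrow> bool" where
  "conv_in_distribution M N F \<longleftrightarrow>
     (\<forall>f :: 'a \<Rightarrow> real. continuous_on UNIV f \<longrightarrow> bounded (range f) \<longrightarrow>
        ((\<lambda>i. \<integral>x. f x \<partial>M i) \<longlongrightarrow> (\<integral>x. f x \<partial>N)) F)"

definition enat_powr :: "enat \<Rightarrow> real \<Rightarrow> ennreal" where
  "enat_powr x p = (case x of enat k \<Rightarrow> ennreal (real k powr p) | \<infinity> \<Rightarrow> \<infinity>)"

definition sgt_border_law :: "(nat \<Rightarrow> real) \<Rightarrow> nat \<Rightarrow> enat measure" where
  "sgt_border_law w n = distr (measure_pmf (simply_generated_tree w n)) borel border_dist"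

definition limit_border_law :: "(nat \<Rightarrow> real) \<Rightarrow> enat measure" where
  "limit_border_law w =
     distr (labelling_space (offspring_pmf w)) borel (\<lambda>l. border_dist (limit_tree l))"

definition sgt_filter :: "(nat \<Rightarrow> real) \<Rightarrow> nat filter" where
  "sgt_filter w = inf sequentially (principal {n. sgt_defined w n})"


section \<open>Well-definedness\<close>


lemma plane_tree_take:
  assumes "plane_tree T" "u \<in> T" shows "take i u \<in> T"
  using assms(2)
proof (induction u rule: rev_induct)
  case (snoc x xs)
  show ?case
  proof (cases "i \<le> length xs")
    case True
    have "xs \<in> T" using assms(1) snoc.prems unfolding plane_tree_def by blast
    with True snoc.IH show ?thesis by simp
  qed (use snoc.prems in simp)
qed simp

lemma plane_tree_bounds:
  assumes T: "plane_tree T" "finite T" and u: "u \<in> T"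
  shows "length u < card T" "set u \<subseteq> {..<card T}"
proof -
  have "inj_on (\<lambda>i. take i u) {..length u}"
    by (rule inj_onI) (metis atMost_iff length_take min.absorb2)
  hence "card ((\<lambda>i. take i u) ` {..length u}) = Suc (length u)" by (simp add: card_image)
  moreover have "card ((\<lambda>i. take i u) ` {..length u}) \<le> card T"
    using plane_tree_take[OF T(1) u] by (intro card_mono T(2)) auto
  ultimately show "length u < card T" by simp
  show "set u \<subseteq> {..<card T}"
  proof
    fix i assume "i \<in> set u"
    then obtain a b where ab: "u = a @ i # b" by (meson split_list)
    have ai: "a @ [i] \<in> T" using plane_tree_take[OF T(1) u, of "Suc (length a)"] ab by simp
    have "a @ [j] \<in> T" if "j \<le> i" for j
      using T(1) ai that le_neq_implies_less unfolding plane_tree_def by blast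
    hence "(\<lambda>j. a @ [j]) ` {..i} \<subseteq> T" by auto
    from card_mono[OF T(2) this] show "i \<in> {..<card T}"
      by (subst (asm) card_image) (auto simp: inj_on_def)
  qed
qed

lemma finite_plane_trees: "finite (plane_trees n)"
proof (rule finite_subset)
  show "plane_trees n \<subseteq> Pow {u. set u \<subseteq> {..<n} \<and> length u \<le> n}"
    using plane_tree_bounds unfolding plane_trees_def by (fastforce intro: less_imp_le)
  show "finite (Pow {u. set u \<subseteq> {..<n} \<and> length u \<le> n})"
    by (simp add: finite_lists_length_le)
qed

lemma pmf_simply_generated_tree:
  assumes w: "weight_sequence w" and n: "sgt_defined w n"
  shows "pmf (simply_generated_tree w n) T =
    (if T \<in> plane_trees n
     then tree_weight w T / (\<Sum>T'\<in>plane_trees n. tree_weight w T') else 0)"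
proof -
  have nn: "tree_weight w T \<ge> 0" for T
    using w unfolding tree_weight_def weight_sequence_def by (auto intro: prod_nonneg)
  have pos: "(\<Sum>T\<in>plane_trees n. tree_weight w T) > 0"
    using n nn unfolding sgt_defined_def
    by (meson finite_plane_trees sum_pos2)
  show ?thesis
    unfolding simply_generated_tree_def
  proof (rule pmf_embed_pmf)
    show "0 \<le> (if T \<in> plane_trees n
      then tree_weight w T / (\<Sum>T'\<in>plane_trees n. tree_weight w T') else 0)" for T
      using nn pos by auto
    show "(\<integral>\<^sup>+T. ennreal (if T \<in> plane_trees n
      then tree_weight w T / (\<Sum>T'\<in>plane_trees n. tree_weight w T') else 0) \<partial>count_space UNIV) = 1"
      using nn pos
      by (subst nn_integral_count_space'[OF finite_plane_trees[of n]])
         (auto simp: sum_ennreal sum_divide_distrib[symmetric])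
  qed
qed

lemma gen_fun_real:
  assumes w: "weight_sequence w" and t: "0 < t" and fin: "gen_fun w t < \<infinity>"
  shows "summable (\<lambda>k. w k * t ^ k)" "gen_fun w t = ennreal (\<Sum>k. w k * t ^ k)"
    "(\<Sum>k. w k * t ^ k) > 0"
proof -
  have nn: "w k * t ^ k \<ge> 0" for k using w t unfolding weight_sequence_def by auto
  show s: "summable (\<lambda>k. w k * t ^ k)"
    using fin nn unfolding gen_fun_def by (intro summable_suminf_not_top) auto
  show "gen_fun w t = ennreal (\<Sum>k. w k * t ^ k)"
    unfolding gen_fun_def by (rule suminf_ennreal2[OF nn s])
  have "w 0 > 0" using w by (simp add: weight_sequence_def)
  then show "(\<Sum>k. w k * t ^ k) > 0"
    using nn by (intro suminf_pos2[OF s, of 0]) auto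
qed

lemma pmf_tilted_pmf:
  assumes w: "weight_sequence w" and t: "0 < t" and fin: "gen_fun w t < \<infinity>"
  shows "pmf (tilted_pmf w t) k = w k * t ^ k / enn2real (gen_fun w t)"
  unfolding tilted_pmf_def
proof (rule pmf_embed_pmf)
  note g = gen_fun_real[OF w t fin]
  have nn: "w k * t ^ k \<ge> 0" for k using w t unfolding weight_sequence_def by auto
  have e: "enn2real (gen_fun w t) = (\<Sum>k. w k * t ^ k)" using g(2,3) by simp
  show nn': "0 \<le> w k * t ^ k / enn2real (gen_fun w t)" for k using nn by simp
  have "(\<lambda>k. w k * t ^ k / enn2real (gen_fun w t)) sums 1"
    using sums_divide[OF summable_sums[OF g(1)], of "enn2real (gen_fun w t)"] g(3) e by simp
  thus "(\<integral>\<^sup>+ k. ennreal (w k * t ^ k / enn2real (gen_fun w t)) \<partial>count_space UNIV) = 1"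
    by (simp add: nn_integral_count_space_nat suminf_ennreal_eq nn' sums_iff)
qed

text \<open>
  Types I and II are both governed by the increasing function
  \<open>z \<mapsto> \<Sum>k\<ge>1. (k - 1) w\<^sub>k z^k\<close>, whose value is to be compared with \<^term>\<open>w 0\<close>
  (the truncated subtraction makes the summand for \<open>k = 0\<close> vanish).
\<close>

definition type_fun :: "(nat \<Rightarrow> real) \<Rightarrow> real \<Rightarrow> ennreal" where
  "type_fun w z = (\<Sum>k. ennreal (real (k - 1) * w k * z ^ k))"

lemma type_fun_identity:
  assumes w: "weight_sequence w" and t: "0 < t"
  shows "ennreal t * gen_fun_deriv w t + ennreal (w 0) = gen_fun w t + type_fun w t"
proof -
  have nn: "w k \<ge> 0" for k using w unfolding weight_sequence_def by auto
  have a: "(\<Sum>k. ennreal (if k = 0 then w 0 else 0)) = ennreal (w 0)"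
    by (subst suminf_finite[of "{0}"]) auto
  have "ennreal t * gen_fun_deriv w t = (\<Sum>k. ennreal (real k * w k * t ^ k))"
    unfolding gen_fun_deriv_def ennreal_suminf_cmult[symmetric]
  proof (intro suminf_cong)
    fix k show "ennreal t * ennreal (real k * w k * t ^ (k - 1)) = ennreal (real k * w k * t ^ k)"
      using t nn[of k] by (cases k) (auto simp: ennreal_mult[symmetric] algebra_simps)
  qed
  hence "ennreal t * gen_fun_deriv w t + ennreal (w 0) =
     (\<Sum>k. ennreal (real k * w k * t ^ k) + ennreal (if k = 0 then w 0 else 0))"
    by (simp add: a[symmetric] suminf_add)
  also have "\<dots> = (\<Sum>k. ennreal (w k * t ^ k) + ennreal (real (k - 1) * w k * t ^ k))"
  proof (intro suminf_cong)
    fix k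
    show "ennreal (real k * w k * t ^ k) + ennreal (if k = 0 then w 0 else 0) =
      ennreal (w k * t ^ k) + ennreal (real (k - 1) * w k * t ^ k)"
      using t nn[of k] by (cases k) (auto simp flip: ennreal_plus simp: algebra_simps)
  qed
  also have "\<dots> = gen_fun w t + type_fun w t"
    unfolding gen_fun_def type_fun_def by (simp add: suminf_add)
  finally show ?thesis .
qed

lemma gen_fun_le:
  assumes w: "weight_sequence w" and t: "0 < t"
  shows "gen_fun w t \<le> type_fun w t + ennreal (w 0 + w 1 * t)"
proof -
  have nn: "w k \<ge> 0" for k using w unfolding weight_sequence_def by auto
  let ?f = "\<lambda>k. ennreal (if k = 0 then w 0 else if k = 1 then w 1 * t else 0)"
  have a: "(\<Sum>k. ?f k) = ennreal (w 0 + w 1 * t)"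
    using t nn by (subst suminf_finite[of "{0,1}"]) (auto simp flip: ennreal_plus)
  have "gen_fun w t \<le> (\<Sum>k. ennreal (real (k - 1) * w k * t ^ k) + ?f k)"
    unfolding gen_fun_def
  proof (intro suminf_le)
    fix k :: nat
    consider "k = 0" | "k = 1" | "k \<ge> 2" by linarith
    thus "ennreal (w k * t ^ k) \<le> ennreal (real (k - 1) * w k * t ^ k) + ?f k"
    proof cases
      case 3
      have "1 * (w k * t ^ k) \<le> real (k - 1) * (w k * t ^ k)"
        using 3 nn[of k] t by (intro mult_right_mono) auto
      thus ?thesis using 3 by (simp add: ennreal_leI mult.assoc)
    qed auto
  qed auto
  also have "\<dots> = type_fun w t + ennreal (w 0 + w 1 * t)"
    unfolding type_fun_def a[symmetric] by (simp add: suminf_add)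
  finally show ?thesis .
qed

lemma gen_fun_pos: assumes w: "weight_sequence w" and t: "0 < t" shows "gen_fun w t > 0"
proof -
  have "ennreal (w 0) \<le> gen_fun w t"
    unfolding gen_fun_def using sum_le_suminf[of "\<lambda>k. ennreal (w k * t ^ k)" "{0}"] by simp
  thus ?thesis using w unfolding weight_sequence_def
    by (metis ennreal_less_zero_iff order_less_le_trans)
qed

lemma le_conv_radius:
  assumes w: "weight_sequence w" and t: "0 < t" and fin: "gen_fun w t < \<infinity>"
  shows "ereal t \<le> conv_radius w"
  using conv_radius_geI[OF gen_fun_real(1)[OF w t fin]] t by simp

lemma ennreal_divide_cmp_1:
  assumes "g > 0"
  shows "a / ennreal g = 1 \<longleftrightarrow> a = ennreal g" "a / ennreal g < 1 \<longleftrightarrow> a < ennreal g"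
proof -
  have "(a / ennreal g = 1 \<longleftrightarrow> a = ennreal g) \<and> (a / ennreal g < 1 \<longleftrightarrow> a < ennreal g)"
  proof (cases a)
    case (real r)
    thus ?thesis using assms
      by (auto simp add: divide_ennreal ennreal_less_iff simp flip: ennreal_1)
  qed (use assms in \<open>simp add: ennreal_top_divide\<close>)
  thus "a / ennreal g = 1 \<longleftrightarrow> a = ennreal g" "a / ennreal g < 1 \<longleftrightarrow> a < ennreal g" by auto
qed

lemma ennreal_cmp_shift:
  assumes "a + ennreal c = ennreal g + h" "c \<ge> 0" "g \<ge> 0"
  shows "a = ennreal g \<longleftrightarrow> h = ennreal c" "a < ennreal g \<longleftrightarrow> h < ennreal c"
proof -
  have "(a = ennreal g \<longleftrightarrow> h = ennreal c) \<and> (a < ennreal g \<longleftrightarrow> h < ennreal c)"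
  proof (cases a)
    case (real r)
    show ?thesis
    proof (cases h)
      case h: (real s)
      have "r + c = g + s" using assms real h by (simp flip: ennreal_plus)
      thus ?thesis using assms real h by (auto simp: ennreal_less_iff)
    qed (use assms real in \<open>simp flip: ennreal_plus\<close>)
  next
    case top
    hence "h = top" using assms(1) assms(3)
      by (cases h) (auto simp flip: ennreal_plus simp: top_unique)
    thus ?thesis using top by simp
  qed
  thus "a = ennreal g \<longleftrightarrow> h = ennreal c" "a < ennreal g \<longleftrightarrow> h < ennreal c" by auto
qed

lemma type_fun_imp_gen_fun_finite:
  assumes w: "weight_sequence w" and t: "0 < t" and "type_fun w t < \<infinity>"
  shows "gen_fun w t < \<infinity>"
  using gen_fun_le[OF w t] assms(3)
  by (simp add: order_le_less_trans)

lemma type_ratio_iff: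
  assumes w: "weight_sequence w" and t: "0 < t"
  shows "gen_fun w t < \<infinity> \<and> ennreal t * gen_fun_deriv w t / gen_fun w t = 1 \<longleftrightarrow>
           type_fun w t = ennreal (w 0)" (is ?A)
    and "gen_fun w t < \<infinity> \<and> ennreal t * gen_fun_deriv w t / gen_fun w t < 1 \<longleftrightarrow>
           type_fun w t < ennreal (w 0)" (is ?B)
proof -
  have w0: "w 0 \<ge> 0" using w by (simp add: weight_sequence_def)
  have "?A \<and> ?B"
  proof (cases "gen_fun w t < \<infinity>")
    case True
    then obtain g where g: "gen_fun w t = ennreal g" "g > 0"
      using gen_fun_real[OF w t] by blast
    have id: "ennreal t * gen_fun_deriv w t + ennreal (w 0) = ennreal g + type_fun w t"
      using type_fun_identity[OF w t] by (simp only: g)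
    show ?thesis
      using ennreal_cmp_shift[OF id w0 less_imp_le[OF g(2)]] ennreal_divide_cmp_1[OF g(2), of "ennreal t * gen_fun_deriv w t"] g
      by (simp only: ) simp
  next
    case False
    have "\<not> type_fun w t \<le> ennreal (w 0)"
      using False type_fun_imp_gen_fun_finite[OF w t]
      by (metis ennreal_less_top infinity_ennreal_def order_le_less_trans)
    thus ?thesis using False by (metis order_refl less_imp_le)
  qed
  thus ?A ?B by blast+
qed

lemma type_I_at_iff:
  assumes w: "weight_sequence w"
  shows "type_I_at w t \<longleftrightarrow> 0 < t \<and> type_fun w t = ennreal (w 0)"
  using type_ratio_iff(1)[OF w] le_conv_radius[OF w] unfolding type_I_at_def by blast

lemma type_II_at_iff:
  assumes w: "weight_sequence w"
  shows "type_II_at w r \<longleftrightarrow> conv_radius w = ereal r \<and> 0 < r \<and> type_fun w r < ennreal (w 0)"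
  using type_ratio_iff(2)[OF w] unfolding type_II_at_def by blast

lemma type_fun_mono:
  assumes w: "weight_sequence w" and "0 \<le> s" "s \<le> t"
  shows "type_fun w s \<le> type_fun w t"
  using w assms(2,3) unfolding type_fun_def weight_sequence_def
  by (intro suminf_le ennreal_leI mult_left_mono power_mono) auto

lemma type_fun_strict:
  assumes w: "weight_sequence w" and st: "0 < s" "s < t"
  shows "type_fun w s \<le> ennreal ((s / t)\<^sup>2) * type_fun w t"
  unfolding type_fun_def ennreal_suminf_cmult[symmetric]
proof (intro suminf_le)
  have nn: "w k \<ge> 0" for k using w unfolding weight_sequence_def by auto
  fix k :: nat
  show "ennreal (real (k - 1) * w k * s ^ k) \<le>
      ennreal ((s / t)\<^sup>2) * ennreal (real (k - 1) * w k * t ^ k)"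
  proof (cases "k \<ge> 2")
    case True
    have "(s / t) ^ k \<le> (s / t)\<^sup>2" using True st by (intro power_decreasing) auto
    hence "s ^ k \<le> (s / t)\<^sup>2 * t ^ k" using st by (simp add: power_divide field_simps)
    hence "real (k - 1) * w k * s ^ k \<le> real (k - 1) * w k * ((s / t)\<^sup>2 * t ^ k)"
      using nn by (intro mult_left_mono) auto
    thus ?thesis using nn st by (simp add: ennreal_mult[symmetric] ennreal_leI mult_ac)
  next
    case False
    hence "k - 1 = 0" by simp
    thus ?thesis by simp
  qed
qed auto

lemma type_I_at_less:
  assumes w: "weight_sequence w" and t: "type_I_at w t" and s: "0 < s" "s < t"
  shows "type_fun w s < ennreal (w 0)"
proof -
  have w0: "w 0 > 0" using w by (simp add: weight_sequence_def)
  have "type_fun w s \<le> ennreal ((s / t)\<^sup>2) * ennreal (w 0)"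
    using type_fun_strict[OF w s] t by (simp add: type_I_at_iff[OF w])
  also have "\<dots> = ennreal ((s / t)\<^sup>2 * w 0)" using w0 by (simp add: ennreal_mult[symmetric])
  also have "(s / t)\<^sup>2 < 1" using s by (simp add: power_less_one_iff abs_square_less_1)
  hence "ennreal ((s / t)\<^sup>2 * w 0) < ennreal (w 0)" using w0 by (simp add: ennreal_less_iff)
  finally show ?thesis .
qed

lemma type_I_at_unique:
  assumes w: "weight_sequence w" and "type_I_at w s" "type_I_at w t"
  shows "s = t"
  using type_I_at_less[OF w assms(2), of t] type_I_at_less[OF w assms(3), of s] assms(2,3)
  by (cases s t rule: linorder_cases) (auto simp: type_I_at_iff[OF w])

lemma type_II_at_unique:
  assumes "type_II_at w r" "type_II_at w s"
  shows "r = s"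
  using assms by (simp add: type_II_at_def)

lemma type_fun_real:
  assumes w: "weight_sequence w" and x: "0 \<le> x" "ereal x < conv_radius w"
  shows "summable (\<lambda>k. real (k - 1) * w k * x ^ k)"
    and "type_fun w x = ennreal (\<Sum>k. real (k - 1) * w k * x ^ k)"
proof -
  have nn: "w k \<ge> 0" for k using w unfolding weight_sequence_def by auto
  obtain K where K: "x < K" "ereal K < conv_radius w"
    using ereal_dense2[OF x(2)] by auto
  have "summable (\<lambda>k. diffs w k * x ^ k)"
    using x K
    by (intro termdiff_converges[of x K])
       (auto intro!: summable_in_conv_radius intro: order_less_trans[OF _ K(2)])
  hence "summable (\<lambda>k. x * (diffs w k * x ^ k))" by (rule summable_mult)
  hence "summable (\<lambda>k. real (Suc k) * w (Suc k) * x ^ (Suc k))"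
    by (simp add: diffs_def mult_ac)
  hence s: "summable (\<lambda>k. real k * w k * x ^ k)"
    by (subst (asm) summable_Suc_iff[of "\<lambda>k. real k * w k * x ^ k"])
  show s': "summable (\<lambda>k. real (k - 1) * w k * x ^ k)"
    using nn x(1) by (intro summable_comparison_test_ev[OF _ s] always_eventually allI)
      (auto intro!: mult_right_mono)
  show "type_fun w x = ennreal (\<Sum>k. real (k - 1) * w k * x ^ k)"
    unfolding type_fun_def using nn x(1) s' by (intro suminf_ennreal2) auto
qed

theorem weight_sequence_types:
  assumes w: "weight_sequence w"
  shows "(\<exists>t. type_I_at w t) \<or> (\<exists>r. type_II_at w r) \<or> type_III w"
    and "\<not> (type_I_at w t \<and> type_II_at w r)"
    and "\<not> (type_I_at w t \<and> type_III w)"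
    and "\<not> (type_II_at w r \<and> type_III w)"
proof -
  have nn: "w k \<ge> 0" for k using w unfolding weight_sequence_def by auto
  have w0: "w 0 > 0" using w by (simp add: weight_sequence_def)
  show "\<not> (type_I_at w t \<and> type_II_at w r)"
  proof
    assume *: "type_I_at w t \<and> type_II_at w r"
    hence "0 < t" "t \<le> r" by (auto simp: type_I_at_def type_II_at_def)
    with type_fun_mono[OF w, of t r] * show False
      by (auto simp: type_I_at_iff[OF w] type_II_at_iff[OF w])
  qed
  show "\<not> (type_I_at w t \<and> type_III w)" "\<not> (type_II_at w r \<and> type_III w)"
    by (auto simp: type_I_at_def type_II_at_def type_III_def zero_ereal_def)
  show "(\<exists>t. type_I_at w t) \<or> (\<exists>r. type_II_at w r) \<or> type_III w"
  proof (cases "type_III w")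
    case False
    hence R0: "conv_radius w > 0"
      using conv_radius_nonneg[of w] by (simp add: type_III_def)
    define A where "A = {t. 0 \<le> t \<and> type_fun w t \<le> ennreal (w 0)}"
    have "type_fun w 0 = 0"
    proof -
      have "ennreal (real (k - 1) * w k * 0 ^ k) = 0" for k by (cases k) auto
      thus ?thesis by (simp add: type_fun_def)
    qed
    hence A0: "0 \<in> A" by (simp add: A_def)
    have part: "(\<Sum>k<N. real (k - 1) * w k * t ^ k) \<le> w 0" if "t \<in> A" for t N
    proof -
      have "ennreal (\<Sum>k<N. real (k - 1) * w k * t ^ k) =
          (\<Sum>k<N. ennreal (real (k - 1) * w k * t ^ k))"
        using nn that by (subst sum_ennreal) (auto simp: A_def)
      also have "\<dots> \<le> type_fun w t" unfolding type_fun_def by (intro sum_le_suminf) auto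
      also have "\<dots> \<le> ennreal (w 0)" using that by (simp add: A_def)
      finally show ?thesis using w0 by (simp add: ennreal_le_iff)
    qed
    have bdd: "bdd_above A"
    proof -
      obtain k where k: "k \<ge> 2" "w k > 0" using w by (auto simp: weight_sequence_def)
      have "t \<le> max 1 (w 0 / w k)" if "t \<in> A" for t
      proof (cases "t \<le> 1")
        case False
        have "t ^ 1 \<le> t ^ k" using False k by (intro power_increasing) auto
        hence "w k * t \<le> 1 * w k * t ^ k" using k by simp
        also have "\<dots> \<le> real (k - 1) * w k * t ^ k"
          using k False by (intro mult_right_mono) auto
        also have "\<dots> \<le> (\<Sum>k<Suc k. real (k - 1) * w k * t ^ k)"
          using nn that by (intro member_le_sum) (auto simp: A_def)
        also have "\<dots> \<le> w 0" by (rule part[OF that])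
        finally have "t \<le> w 0 / w k" using k by (simp add: field_simps)
        thus ?thesis by simp
      qed auto
      thus ?thesis by (auto simp: bdd_above_def)
    qed
    define t where "t = Sup A"
    have ub: "s \<le> t" if "s \<in> A" for s unfolding t_def by (rule cSup_upper[OF that bdd])
    have t0: "t \<ge> 0" using ub[OF A0] .
    have "t \<in> closure A" unfolding t_def using A0 bdd by (intro closure_contains_Sup) auto
    then obtain x where x: "\<And>n. x n \<in> A" "x \<longlonglongrightarrow> t" by (auto simp: closure_sequential)
    have partt: "(\<Sum>k<N. real (k - 1) * w k * t ^ k) \<le> w 0" for N
    proof (rule LIMSEQ_le_const2)
      show "(\<lambda>n. \<Sum>k<N. real (k - 1) * w k * x n ^ k) \<longlonglongrightarrow> (\<Sum>k<N. real (k - 1) * w k * t ^ k)"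
        by (intro tendsto_intros x)
    qed (use part x in auto)
    have le: "type_fun w t \<le> ennreal (w 0)"
      unfolding type_fun_def
    proof (rule suminf_le_const)
      fix N
      show "(\<Sum>k<N. ennreal (real (k - 1) * w k * t ^ k)) \<le> ennreal (w 0)"
        using nn t0 partt[of N] by (subst sum_ennreal) (auto intro: ennreal_leI)
    qed auto
    have tR: "ereal t \<le> conv_radius w"
    proof (cases "t = 0")
      case False
      hence "gen_fun w t < \<infinity>"
        using t0 le by (intro type_fun_imp_gen_fun_finite[OF w]) (auto simp: order_le_less_trans)
      thus ?thesis using False t0 by (intro le_conv_radius[OF w]) auto
    qed (use R0 in \<open>auto simp flip: zero_ereal_def\<close>)
    have eq: "type_fun w t = ennreal (w 0)" if "ereal t < conv_radius w"
    proof (rule ccontr)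
      assume "type_fun w t \<noteq> ennreal (w 0)"
      hence less: "type_fun w t < ennreal (w 0)" using le by simp
      obtain K where K: "t < K" "ereal K < conv_radius w" using ereal_dense2[OF \<open>ereal t < _\<close>] by auto
      let ?h = "\<lambda>x. \<Sum>k. real (k - 1) * w k * x ^ k"
      have "isCont ?h t"
        using K t0 by (intro isCont_powser[OF type_fun_real(1)[OF w, of K]]) auto
      moreover have "?h t < w 0"
        using less type_fun_real[OF w t0 that] w0 nn t0
        by (simp add: ennreal_less_iff suminf_nonneg)
      ultimately have "eventually (\<lambda>x. ?h x < w 0) (at t)"
        by (intro order_tendstoD(2)[of ?h "?h t"]) (auto simp: isCont_def)
      hence "eventually (\<lambda>x. ?h x < w 0) (at_right t)"
        by (rule filter_leD[OF at_le, rotated]) auto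
      moreover have "eventually (\<lambda>x. x \<in> {t<..<K}) (at_right t)"
        using K by (intro eventually_at_right_real)
      ultimately have "eventually (\<lambda>x. ?h x < w 0 \<and> x \<in> {t<..<K}) (at_right t)"
        by eventually_elim auto
      then obtain y where y: "?h y < w 0" "t < y" "y < K"
        by (auto dest!: eventually_happens)
      have yR: "ereal y < conv_radius w"
        using y(3) K(2) by (meson ereal_less_eq(3) less_imp_le order_le_less_trans)
      have "type_fun w y \<le> ennreal (w 0)"
        using type_fun_real(2)[OF w _ yR] y t0 by (simp add: ennreal_leI)
      hence "y \<in> A" using y t0 by (simp add: A_def)
      from ub[OF this] y show False by simp
    qed
    show ?thesis
    proof (cases "ereal t < conv_radius w")
      case True
      have "t \<noteq> 0" using eq[OF True] \<open>type_fun w 0 = 0\<close> w0 by auto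
      thus ?thesis using eq[OF True] t0 type_I_at_iff[OF w] by auto
    next
      case False
      hence R: "conv_radius w = ereal t" using tR by simp
      have "t > 0" using R0 R by (simp add: zero_ereal_def)
      thus ?thesis using le R type_I_at_iff[OF w, of t] type_II_at_iff[OF w, of t]
        by (meson order_le_less)
    qed
  qed blast
qed

lemma offspring_pmf_type_I:
  assumes "weight_sequence w" "type_I_at w t"
  shows "pmf (offspring_pmf w) k = w k * t ^ k / enn2real (gen_fun w t)"
proof -
  have "(THE t. type_I_at w t) = t" using assms type_I_at_unique by blast
  thus ?thesis using assms pmf_tilted_pmf[of w t]
    by (auto simp: offspring_pmf_def type_I_at_def)
qed

lemma offspring_pmf_type_II:
  assumes "weight_sequence w" "type_II_at w r"
  shows "pmf (offspring_pmf w) k = w k * r ^ k / enn2real (gen_fun w r)"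
proof -
  have "(THE r. type_II_at w r) = r" using assms type_II_at_unique by blast
  moreover have "\<nexists>t. type_I_at w t" using assms weight_sequence_types(2) by blast
  ultimately have "offspring_pmf w = tilted_pmf w r"
    using assms by (auto simp: offspring_pmf_def)
  thus ?thesis using assms pmf_tilted_pmf[of w r] by (simp add: type_II_at_def)
qed

lemma offspring_pmf_type_III:
  assumes "weight_sequence w" "type_III w"
  shows "offspring_pmf w = return_pmf 0"
  using weight_sequence_types(3,4)[OF assms(1)] assms(2) by (auto simp: offspring_pmf_def)

lemma offspring_pmf_mean:
  assumes w: "weight_sequence w"
  shows "integrable (measure_pmf (offspring_pmf w)) real"
    and "measure_pmf.expectation (offspring_pmf w) real \<le> 1"
proof -
  have "(\<integral>\<^sup>+k. ennreal (real k) \<partial>measure_pmf (offspring_pmf w)) \<le> 1"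
  proof -
    have *: "(\<integral>\<^sup>+k. ennreal (real k) \<partial>measure_pmf (offspring_pmf w)) \<le> 1"
      if p: "\<And>k. pmf (offspring_pmf w) k = w k * t ^ k / enn2real (gen_fun w t)"
        and t: "0 < t" "gen_fun w t < \<infinity>" "ennreal t * gen_fun_deriv w t / gen_fun w t \<le> 1" for t
    proof -
      have nn: "w k \<ge> 0" for k using w unfolding weight_sequence_def by auto
      obtain g where g: "gen_fun w t = ennreal g" "g > 0"
        using gen_fun_real[OF w t(1,2)] by blast
      have "(\<integral>\<^sup>+k. ennreal (real k) \<partial>measure_pmf (offspring_pmf w)) =
          (\<Sum>k. ennreal t / ennreal g * ennreal (real k * w k * t ^ (k - 1)))"
        unfolding nn_integral_measure_pmf nn_integral_count_space_nat
      proof (intro suminf_cong)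
        fix k
        have "k = 0 \<or> t ^ k = t * t ^ (k - Suc 0)" by (cases k) auto
        thus "ennreal (pmf (offspring_pmf w) k) * ennreal (real k) =
            ennreal t / ennreal g * ennreal (real k * w k * t ^ (k - 1))"
          using g nn[of k] t(1)
          by (auto simp add: p ennreal_mult[symmetric] divide_ennreal mult_ac)
      qed
      also have "\<dots> = ennreal t / ennreal g * gen_fun_deriv w t"
        by (simp add: gen_fun_deriv_def ennreal_suminf_cmult)
      also have "\<dots> = ennreal t * gen_fun_deriv w t / gen_fun w t"
        by (simp add: g ennreal_divide_times ennreal_times_divide mult.commute)
      finally show ?thesis using t(3) by simp
    qed
    consider t where "type_I_at w t" | t where "type_II_at w t" | "type_III w"
      using weight_sequence_types(1)[OF w] by blast
    thus ?thesis
    proof cases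
      case (1 t) thus ?thesis using *[OF offspring_pmf_type_I[OF w 1]] by (simp add: type_I_at_def)
    next
      case (2 t) thus ?thesis
        using *[OF offspring_pmf_type_II[OF w 2]] by (simp add: type_II_at_def less_imp_le)
    next
      case 3 thus ?thesis by (simp add: offspring_pmf_type_III[OF w])
    qed
  qed
  note le = this
  show int: "integrable (measure_pmf (offspring_pmf w)) real"
    using le by (intro integrableI_nonneg) (auto simp: order_le_less_trans)
  have "ennreal (measure_pmf.expectation (offspring_pmf w) real) \<le> 1"
    using le nn_integral_eq_integral[OF int] by simp
  thus "measure_pmf.expectation (offspring_pmf w) real \<le> 1" by simp
qed

lemma pmf_size_biased_pmf:
  assumes int: "integrable (measure_pmf p) real" and le: "measure_pmf.expectation p real \<le> 1"
  shows "pmf (size_biased_pmf p) (enat k) = real k * pmf p k"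
    and "pmf (size_biased_pmf p) \<infinity> = 1 - measure_pmf.expectation p real"
proof -
  let ?f = "\<lambda>k. case k of enat j \<Rightarrow> real j * pmf p j | \<infinity> \<Rightarrow> 1 - measure_pmf.expectation p real"
  have nn: "0 \<le> ?f k" for k using le by (cases k) auto
  have "(\<integral>\<^sup>+k. ennreal (?f k) \<partial>count_space UNIV) =
      (\<integral>\<^sup>+k. ennreal (?f k) * indicator (range enat) k + ennreal (?f k) * indicator {\<infinity>} k
         \<partial>count_space UNIV)"
    by (intro nn_integral_cong) (auto simp: indicator_def split: enat.splits)
  also have "\<dots> = (\<integral>\<^sup>+k. ennreal (?f k) * indicator (range enat) k \<partial>count_space UNIV) +
      (\<integral>\<^sup>+k. ennreal (?f k) * indicator {\<infinity>} k \<partial>count_space UNIV)"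
    by (rule nn_integral_add) auto
  also have "(\<integral>\<^sup>+k. ennreal (?f k) * indicator {\<infinity>} k \<partial>count_space UNIV) =
      ennreal (1 - measure_pmf.expectation p real)"
    by (subst nn_integral_count_space'[of "{\<infinity>}"]) auto
  also have "(\<integral>\<^sup>+k. ennreal (?f k) * indicator (range enat) k \<partial>count_space UNIV) =
      (\<integral>\<^sup>+k. ennreal (?f k) \<partial>count_space (range enat))"
    by (subst nn_integral_count_space_indicator) (auto simp: nn_integral_count_space_indicator)
  also have "\<dots> = (\<integral>\<^sup>+k. ennreal (?f (enat k)) \<partial>count_space UNIV)"
    by (intro nn_integral_bij_count_space[symmetric]) (auto simp: bij_betw_def inj_on_def)
  also have "\<dots> = (\<integral>\<^sup>+k. ennreal (real k) \<partial>measure_pmf p)"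
    by (simp add: nn_integral_measure_pmf ennreal_mult mult.commute)
  also have "\<dots> = ennreal (measure_pmf.expectation p real)"
    by (rule nn_integral_eq_integral[OF int]) auto
  also have "ennreal (measure_pmf.expectation p real) +
      ennreal (1 - measure_pmf.expectation p real) = 1"
    using le by (simp flip: ennreal_plus add: integral_nonneg_AE)
  finally have "pmf (embed_pmf ?f) x = ?f x" for x
    by (intro pmf_embed_pmf nn)
  thus "pmf (size_biased_pmf p) (enat k) = real k * pmf p k"
    and "pmf (size_biased_pmf p) \<infinity> = 1 - measure_pmf.expectation p real"
    by (simp_all add: size_biased_pmf_def)
qed


lemma prob_space_labelling_space: "prob_space (labelling_space p)"
  unfolding labelling_space_def by (intro prob_space_PiM measure_pmf.prob_space_axioms)

lemma special_Nil: "special l []"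
  by (rule special.root)

lemma special_snoc: "special l (u @ [j]) \<longleftrightarrow> special l u \<and> (\<exists>a k. l u = (a, enat k, j))"
  by (subst special.simps) auto

lemma limit_tree_Nil: "[] \<in> limit_tree l"
  by (rule limit_tree.root)

lemma limit_tree_snoc:
  "u @ [i] \<in> limit_tree l \<longleftrightarrow> u \<in> limit_tree l \<and> enat i < offspring_number l u"
  by (subst limit_tree.simps) auto

lemma plane_tree_limit_tree: "plane_tree (limit_tree l)"
  unfolding plane_tree_def limit_tree_snoc
  by (auto intro: limit_tree.root order_less_trans[rotated])

lemma border_dist_limit_tree_measurable:
  "(\<lambda>l. border_dist (limit_tree l)) \<in> borel_measurable (labelling_space p)"
proof -
  let ?M = "labelling_space p"
  have coord [measurable]: "(\<lambda>l. l u) \<in> measurable ?M (count_space UNIV)" for u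
  proof -
    have "(\<lambda>l. l u) \<in> measurable ?M (measure_pmf (label_pmf p))"
      unfolding labelling_space_def by (rule measurable_component_singleton) simp
    thus ?thesis by simp
  qed
  have special [measurable]: "Measurable.pred ?M (\<lambda>l. special l u)" for u
  proof (induction u rule: rev_induct)
    case (snoc j u)
    have "Measurable.pred ?M (\<lambda>l. \<exists>a k. l u = (a, enat k, j))"
      by (rule measurable_compose[OF coord, where g = "\<lambda>x. \<exists>a k. x = (a, enat k, j)"]) simp
    with snoc show ?case by (simp add: special_snoc)
  qed (simp add: special_Nil)
  have tree [measurable]: "Measurable.pred ?M (\<lambda>l. u \<in> limit_tree l)" for u
  proof (induction u rule: rev_induct)
    case (snoc i u)
    have 1: "Measurable.pred ?M (\<lambda>l. enat i < fst (snd (l u)))"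
      by (rule measurable_compose[OF coord, where g = "\<lambda>x. enat i < fst (snd x)"]) simp
    have 2: "Measurable.pred ?M (\<lambda>l. i < fst (l u))"
      by (rule measurable_compose[OF coord, where g = "\<lambda>x. i < fst x"]) simp
    have "enat i < offspring_number l u \<longleftrightarrow>
        (special l u \<and> enat i < fst (snd (l u))) \<or> (\<not> special l u \<and> i < fst (l u))" for l
      by (auto simp: offspring_number_def split: prod.splits)
    with snoc 1 2 show ?case by (simp add: limit_tree_snoc)
  qed (simp add: limit_tree_Nil)
  have leaf [measurable]: "Measurable.pred ?M (\<lambda>l. u \<in> leaves (limit_tree l))" for u
  proof -
    have "u \<in> leaves (limit_tree l) \<longleftrightarrow>
        u \<in> limit_tree l \<and> (\<forall>i. u @ [i] \<notin> limit_tree l)" for l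
      by (auto simp: leaves_def children_def)
    thus ?thesis by simp
  qed
  have pred_const: "Measurable.pred ?M (\<lambda>_. P)" for P by simp
  have le_iff: "b \<le> border_dist T \<longleftrightarrow> (\<forall>u. u \<in> leaves T \<longrightarrow> b \<le> enat (length u))" for b T
    by (auto simp: border_dist_def le_INF_iff)
  have le: "Measurable.pred ?M (\<lambda>l. b \<le> border_dist (limit_tree l))" for b
    unfolding le_iff by (intro pred_intros_countable pred_intros_logic leaf pred_const)
  have eq: "border_dist T = a \<longleftrightarrow>
      a \<le> border_dist T \<and> (\<forall>b. b \<le> border_dist T \<longrightarrow> b \<le> a)" for T a
    by (auto intro: antisym)
  have "(\<lambda>l. border_dist (limit_tree l)) \<in> measurable ?M (count_space UNIV)"
  proof (subst measurable_count_space_eq2_countable, safe)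
    fix a
    have "Measurable.pred ?M (\<lambda>l. border_dist (limit_tree l) = a)"
      by (subst eq) (intro pred_intros_countable pred_intros_logic le pred_const)
    hence "{l \<in> space ?M. border_dist (limit_tree l) = a} \<in> sets ?M" by (simp add: pred_def)
    also have "{l \<in> space ?M. border_dist (limit_tree l) = a} =
      (\<lambda>l. border_dist (limit_tree l)) -` {a} \<inter> space ?M" by auto
    finally show "(\<lambda>l. border_dist (limit_tree l)) -` {a} \<inter> space ?M \<in> sets ?M" .
  qed auto
  thus ?thesis
    by (rule measurable_compose) simp
qed

end

theory Submission
  imports Defs "HOL-Real_Asymp.Real_Asymp"
begin

text \<open>
  Let \<open>A\<^sub>k(z)\<close> be the generating function of the trees without leaves at height less than \<open>k\<close>, weighted
  by \<open>w\<close>, and \<open>y = A\<^sub>0\<close>. Cutting off the root gives \<open>A\<^sub>k\<^sub>+\<^sub>1 = z (\<Phi>(A\<^sub>k) - w\<^sub>0)\<close> and \<open>y = z \<Phi>(y)\<close>, and the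
  probability that the border distance is at least \<open>k\<close> is \<open>[z^n] A\<^sub>k / [z^n] y\<close>.

  By Lagrange inversion, the ratios \<open>w\<^sub>d [z^(n-1)] y^(r-1+d) / [z^n] y^r\<close> are, up to a factor tending to
  \<open>(r-1+d)/r\<close>, the mean proportion of boxes containing \<open>d\<close> balls when \<open>n - r\<close> balls are thrown into
  \<open>n\<close> boxes with weights \<open>w\<close>. This proportion tends to \<open>P(\<xi> = d)\<close>: its exponential moments are
  controlled in types I and II because the total weight has the largest possible exponential growth,
  which follows from supermultiplicativity and the divergence of \<open>y\<close> beyond \<open>\<tau> / \<Phi>(\<tau>)\<close>; in type III,
  \<open>k\<close> boxes with \<open>j\<close> balls are traded for \<open>j\<close> boxes with \<open>k\<close> balls, for \<open>k\<close> with a huge weight.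

  The recursion for \<open>A\<^sub>k\<close> then passes to the limit. The mass escaping to vertices of large degree is
  negligible, since \<open>A\<^sub>1^2 \<le> (1 - c) y^2\<close> coefficientwise: a forest of \<open>d\<close> trees has no root that is a
  leaf with probability at most exponentially small in \<open>d\<close>. In the same way \<open>A\<^sub>k \<le> \<rho> y\<close> for some \<open>k\<close> and
  \<open>\<rho> < 1\<close>, which propagates along the recursion to \<open>A\<^sub>j\<^sub>+\<^sub>k \<le> \<rho> A\<^sub>j\<close> and gives exponential tails, hence
  convergence of all moments.
\<close>

text \<open>The ratio \<open>A k $ n / y $ n\<close> alone satisfies no closed recursion: removing a
  root of degree \<open>d\<close> turns one tree into \<open>d\<close> trees, so limits are needed
  for forests of any number of trees, and with two height bounds at once, since only one tree at a
  time loses its root. The products \<open>A (Suc k) ^ i * A k ^ j\<close> are closed under this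
  operation. Their limits reflect that one tree of a large forest carries almost all vertices while
  the others look like Galton--Watson trees. At \<open>k = 0\<close> the trees left after removing a
  root are unrestricted. If the mean \<open>m\<close> of the offspring law is below 1, mass
  \<open>1 - m\<close> escapes to infinite degree, and no majorant summable in \<open>d\<close> can
  exist; the identity \<open>A 1 = y - w 0 z\<close> takes the place of the recursion there. For
  periodic weights, forests of \<open>r\<close> trees with \<open>n\<close> vertices exist only for
  some \<open>n\<close>, depending on \<open>r\<close>. Hence each limit is taken along a filter of
  its own, and passing from \<open>n\<close> to \<open>n - 1\<close> needs an argument.\<close>

unbundle no vec_syntax
unbundle fps_syntax

section \<open>Coefficientwise order on power series\<close>

definition fps_le :: "real fps \<Rightarrow> real fps \<Rightarrow> bool"  (infix "\<preceq>" 50) where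
  "F \<preceq> G \<longleftrightarrow> (\<forall>n. F $ n \<le> G $ n)"

lemma fps_leD: "F \<preceq> G \<Longrightarrow> F $ n \<le> G $ n"
  by (simp add: fps_le_def)

lemma fps_le_refl: "F \<preceq> F"
  by (simp add: fps_le_def)

lemma fps_le_trans: "F \<preceq> G \<Longrightarrow> G \<preceq> H \<Longrightarrow> F \<preceq> H"
  unfolding fps_le_def by (meson order_trans)

lemma fps_le_mult:
  assumes "F \<preceq> G" "F' \<preceq> G'" "0 \<preceq> F'" "0 \<preceq> G"
  shows "F * F' \<preceq> G * G'"
  using assms unfolding fps_le_def fps_mult_nth
  by (auto intro!: sum_mono mult_mono)

lemma fps_nonneg_mult: "0 \<preceq> F \<Longrightarrow> 0 \<preceq> G \<Longrightarrow> 0 \<preceq> F * G"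
  unfolding fps_le_def fps_mult_nth by (auto intro!: sum_nonneg)

lemma fps_nonneg_power: "0 \<preceq> F \<Longrightarrow> 0 \<preceq> F ^ n"
proof (induction n)
  case 0
  show ?case by (simp add: fps_le_def)
qed (simp add: fps_nonneg_mult)

lemma fps_le_power:
  assumes "0 \<preceq> F" "F \<preceq> G"
  shows "F ^ n \<preceq> G ^ n"
proof (induction n)
  case (Suc n)
  show ?case
    using assms Suc fps_nonneg_power[OF assms(1)] fps_le_trans[OF assms]
    by (auto intro!: fps_le_mult)
qed (simp add: fps_le_refl)

lemma fps_nonneg_Abs: "(\<And>k. f k \<ge> 0) \<Longrightarrow> 0 \<preceq> Abs_fps f"
  by (simp add: fps_le_def)

lemma fps_power_nth_eq_0:
  fixes G :: "real fps"
  assumes "G $ 0 = 0" "n < d"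
  shows "(G ^ d) $ n = 0"
  using startsby_zero_power_prefix[OF assms(1), of d] assms(2) by simp

text \<open>Removing the root of the first tree of a forest turns it into a forest with one vertex less.\<close>

lemma fps_peel_root:
  fixes F G B :: "real fps"
  assumes G: "G $ 0 = 0" and B: "B $ 0 = 0" "\<And>n. B $ Suc n = (\<Sum>d\<le>n. c d * (G ^ d) $ n)"
  shows "(B * F) $ Suc n = (\<Sum>d\<le>n. c d * (G ^ d * F) $ n)"
proof -
  have "(B * F) $ Suc n = (\<Sum>i\<le>n. B $ Suc i * F $ (n - i))"
    by (simp add: fps_mult_nth B(1) atLeast0AtMost sum.atMost_Suc_shift del: sum.atMost_Suc)
  also have "\<dots> = (\<Sum>i\<le>n. \<Sum>d\<le>n. c d * ((G ^ d) $ i * F $ (n - i)))"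
  proof (rule sum.cong)
    fix i assume "i \<in> {..n}"
    hence "(\<Sum>d\<le>n. c d * (G ^ d) $ i) = (\<Sum>d\<le>i. c d * (G ^ d) $ i)"
      using fps_power_nth_eq_0[OF G] by (intro sum.mono_neutral_right) auto
    thus "B $ Suc i * F $ (n - i) = (\<Sum>d\<le>n. c d * ((G ^ d) $ i * F $ (n - i)))"
      unfolding B(2) by (metis (no_types, lifting) mult.assoc sum.cong sum_distrib_right)
  qed simp
  also have "\<dots> = (\<Sum>d\<le>n. c d * (G ^ d * F) $ n)"
    by (subst sum.swap) (simp add: fps_mult_nth sum_distrib_left atLeast0AtMost)
  finally show ?thesis .
qed

lemma fps_power_Suc_nth:
  fixes w :: "nat \<Rightarrow> real"
  shows "(Abs_fps w ^ Suc n) $ s = (\<Sum>d\<le>s. w d * (Abs_fps w ^ n) $ (s - d))"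
  by (simp add: fps_mult_nth atLeast0AtMost)

text \<open>Coefficient \<open>s\<close> of
  \<open>z (\<Phi> ^ (n + 1))' = (n + 1) z \<Phi>' \<Phi> ^ n\<close>. In terms of boxes: by
  symmetry, the mean content of one of \<open>n + 1\<close> boxes sharing \<open>s\<close> balls is
  \<open>s / (n + 1)\<close>.\<close>

lemma fps_power_Suc_nth_size_biased:
  fixes w :: "nat \<Rightarrow> real"
  shows "real (Suc n) * (\<Sum>d\<le>s. real d * w d * (Abs_fps w ^ n) $ (s - d)) =
    real s * (Abs_fps w ^ Suc n) $ s"
proof -
  let ?F = "Abs_fps w"
  have "fps_X * fps_deriv (?F ^ Suc n) = of_nat (Suc n) * (fps_X * fps_deriv ?F * ?F ^ n)"
    by (simp add: fps_deriv_power fps_of_nat[symmetric] mult_ac del: of_nat_Suc power_Suc)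
  hence "(fps_X * fps_deriv (?F ^ Suc n)) $ s = real (Suc n) * (fps_X * fps_deriv ?F * ?F ^ n) $ s"
    by (simp only: fps_mult_of_nat_nth)
  moreover have X: "(fps_X * fps_deriv G) $ k = real k * G $ k" for G :: "real fps" and k
    by (cases k) auto
  moreover have "(fps_X * fps_deriv ?F * ?F ^ n) $ s = (\<Sum>d\<le>s. real d * w d * (?F ^ n) $ (s - d))"
    unfolding fps_mult_nth[of "fps_X * fps_deriv ?F"] X by (simp add: atLeast0AtMost)
  ultimately show ?thesis by (simp only:)
qed

text \<open>Induction on the number of vertices instead of a residue computation: peeling a root
  replaces \<open>r\<close> by \<open>r - 1 + d\<close>, and the factor \<open>r - 1 + d\<close> of
  the induction hypothesis splits into the constant \<open>r - 1\<close>, which gives a full power,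
  and \<open>d\<close>, which gives the size-biased sum.\<close>

theorem lagrange_inversion:
  fixes w :: "nat \<Rightarrow> real" and y :: "real fps"
  assumes y: "y $ 0 = 0" "\<And>n. y $ Suc n = (\<Sum>d\<le>n. w d * (y ^ d) $ n)"
  assumes "1 \<le> r" "r \<le> n"
  shows "real n * (y ^ r) $ n = real r * (Abs_fps w ^ n) $ (n - r)"
  using assms(3,4)
proof (induction n arbitrary: r)
  case (Suc n)
  let ?F = "Abs_fps w"
  have peel: "(y ^ r) $ Suc n = (\<Sum>d\<le>n. w d * (y ^ (r - 1 + d)) $ n)"
    using fps_peel_root[OF y(1) y, of "y ^ (r - 1)" n] Suc.prems
    by (simp add: power_add[symmetric] power_Suc[symmetric] add.commute del: power_Suc)
  show ?case
  proof (cases "n = 0")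
    case True
    hence "r = 1" using Suc.prems by simp
    thus ?thesis using peel True by (simp add: y(2))
  next
    case False
    define s where "s = Suc n - r"
    have s: "s + r = Suc n" using Suc.prems s_def by simp
    have "real n * (y ^ r) $ Suc n = (\<Sum>d\<le>n. w d * (real n * (y ^ (r - 1 + d)) $ n))"
      by (simp add: peel sum_distrib_left mult_ac)
    also have "\<dots> = (\<Sum>d\<le>s. w d * (real n * (y ^ (r - 1 + d)) $ n))"
    proof (rule sum.mono_neutral_right, simp, use s Suc.prems in force, rule ballI)
      fix d assume "d \<in> {..n} - {..s}"
      hence "n < r - 1 + d" using s Suc.prems by auto
      thus "w d * (real n * (y ^ (r - 1 + d)) $ n) = 0"
        using fps_power_nth_eq_0[OF y(1)] by simp
    qed
    also have "\<dots> = (\<Sum>d\<le>s. w d * (real (r - 1 + d) * (?F ^ n) $ (s - d)))"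
    proof (rule sum.cong)
      fix d assume "d \<in> {..s}"
      show "w d * (real n * (y ^ (r - 1 + d)) $ n) = w d * (real (r - 1 + d) * (?F ^ n) $ (s - d))"
      \<comment> \<open>The induction hypothesis needs a positive exponent. For \<open>r = 1\<close>
        and \<open>d = 0\<close> both sides vanish because \<open>n > 0\<close>.\<close>
      proof (cases "r - 1 + d = 0")
        case True
        thus ?thesis using False by simp
      next
        case nz: False
        have "n - (r - 1 + d) = s - d" using s Suc.prems by simp
        thus ?thesis using Suc.IH[of "r - 1 + d"] nz s Suc.prems \<open>d \<in> _\<close> by simp
      qed
    qed simp
    also have "\<dots> = real (r - 1) * (?F ^ Suc n) $ s + (\<Sum>d\<le>s. real d * w d * (?F ^ n) $ (s - d))"
      by (simp add: fps_power_Suc_nth sum.distrib[symmetric] sum_distrib_left algebra_simps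
            del: power_Suc)
    finally have "real (Suc n) * (real n * (y ^ r) $ Suc n) =
        real (Suc n) * (real (r - 1) * (?F ^ Suc n) $ s) + real s * (?F ^ Suc n) $ s"
      using fps_power_Suc_nth_size_biased[of n w s] by (simp add: algebra_simps del: power_Suc)
    also have "\<dots> = (real (Suc n) * real (r - 1) + real s) * (?F ^ Suc n) $ s"
      by (simp add: algebra_simps)
    also have "real (Suc n) * real (r - 1) + real s = real n * real r"
      using s Suc.prems by (simp add: of_nat_diff s_def algebra_simps)
    finally have "real n * (real (Suc n) * (y ^ r) $ Suc n) = real n * (real r * (?F ^ Suc n) $ s)"
      by (simp add: mult_ac del: power_Suc)
    thus ?thesis using False by (simp add: s_def del: power_Suc of_nat_Suc)
  qed
qed simp

section \<open>Root decomposition of plane trees\<close>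

definition no_leaf_below :: "nat \<Rightarrow> nat list set \<Rightarrow> bool" where
  "no_leaf_below k T \<longleftrightarrow> (\<forall>u\<in>T. length u < k \<longrightarrow> (\<exists>i. u @ [i] \<in> T))"

lemma no_leaf_below_0: "no_leaf_below 0 T"
  by (simp add: no_leaf_below_def)

lemma no_leaf_below_mono: "no_leaf_below l T \<Longrightarrow> k \<le> l \<Longrightarrow> no_leaf_below k T"
  by (auto simp: no_leaf_below_def)

lemma border_dist_ge_iff: "enat k \<le> border_dist T \<longleftrightarrow> no_leaf_below k T"
  by (auto simp: border_dist_def le_INF_iff leaves_def children_def no_leaf_below_def not_less)

definition branch :: "nat list set \<Rightarrow> nat \<Rightarrow> nat list set" where
  "branch T i = {u. i # u \<in> T}"

lemma plane_tree_Nil: "plane_tree T \<Longrightarrow> [] \<in> T"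
  by (simp add: plane_tree_def)

lemma plane_tree_singleton: "plane_tree T \<Longrightarrow> i # u \<in> T \<Longrightarrow> [i] \<in> T"
  using plane_tree_take[of T "i # u" 1] by simp

lemma plane_tree_branch:
  assumes "plane_tree T" "[i] \<in> T"
  shows "plane_tree (branch T i)"
  using assms unfolding plane_tree_def branch_def
  by (metis append_Cons mem_Collect_eq)

text \<open>A root with any child has child number 0, since sibling indices are downward closed; so
  \<open>[0] \<in> T\<close> says that the root is not a leaf.\<close>

lemma no_leaf_below_Suc:
  assumes T: "plane_tree T"
  shows "no_leaf_below (Suc k) T \<longleftrightarrow> [0] \<in> T \<and> (\<forall>i. [i] \<in> T \<longrightarrow> no_leaf_below k (branch T i))"
    (is "?L \<longleftrightarrow> ?R")
proof
  assume L: ?L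
  have "[] \<in> T" using T by (rule plane_tree_Nil)
  then obtain i where "[] @ [i] \<in> T" using L unfolding no_leaf_below_def by force
  hence "[0] \<in> T" using T unfolding plane_tree_def by (metis append_Nil not_gr0)
  thus ?R using L unfolding no_leaf_below_def branch_def by force
next
  assume R: ?R
  show ?L unfolding no_leaf_below_def
  proof (intro ballI impI)
    fix u assume u: "u \<in> T" "length u < Suc k"
    show "\<exists>i. u @ [i] \<in> T"
    proof (cases u)
      case Nil
      thus ?thesis using R by (intro exI[of _ 0]) simp
    next
      case (Cons i v)
      thus ?thesis using R u plane_tree_singleton[OF T]
        unfolding no_leaf_below_def branch_def by force
    qed
  qed
qed

definition graft :: "nat list set list \<Rightarrow> nat list set" where
  "graft ts = insert [] (\<Union>i<length ts. (#) i ` (ts ! i))"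

definition forests :: "nat \<Rightarrow> nat \<Rightarrow> nat list set list set" where
  "forests d n = {ts. length ts = d \<and> (\<forall>t\<in>set ts. plane_tree t \<and> finite t) \<and>
     sum_list (map card ts) = n}"

lemma forests_0: "forests 0 n = (if n = 0 then {[]} else {})"
  by (auto simp: forests_def)

lemma finite_forests: "finite (forests d n)"
proof (induction d arbitrary: n)
  case (Suc d)
  have "forests (Suc d) n \<subseteq> (\<Union>m\<le>n. (\<lambda>(t, ts). t # ts) ` (plane_trees m \<times> forests d (n - m)))"
  proof
    fix ts assume "ts \<in> forests (Suc d) n"
    then obtain t us where "ts = t # us" "plane_tree t" "finite t" "us \<in> forests d (n - card t)"
        "card t \<le> n"
      unfolding forests_def by (cases ts) auto
    thus "ts \<in> (\<Union>m\<le>n. (\<lambda>(t, ts). t # ts) ` (plane_trees m \<times> forests d (n - m)))"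
      unfolding plane_trees_def by auto
  qed
  thus ?case by (rule finite_subset) (auto intro: Suc finite_plane_trees)
qed (simp add: forests_0)

text \<open>Convolution enumerates ordered sequences of trees by their total size. The function
  \<open>h\<close> is arbitrary so that the same identity serves every height bound.\<close>

lemma fps_power_sum_forests:
  fixes h :: "nat list set \<Rightarrow> real"
  shows "(Abs_fps (\<lambda>n. \<Sum>T\<in>plane_trees n. h T) ^ d) $ n = (\<Sum>ts\<in>forests d n. prod_list (map h ts))"
proof (induction d arbitrary: n)
  case 0
  show ?case by (simp add: forests_0)
next
  case (Suc d)
  have "(Abs_fps (\<lambda>n. \<Sum>T\<in>plane_trees n. h T) ^ Suc d) $ n =
      (\<Sum>m\<le>n. (\<Sum>T\<in>plane_trees m. h T) * (\<Sum>ts\<in>forests d (n - m). prod_list (map h ts)))"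
    by (simp add: fps_mult_nth Suc atLeast0AtMost)
  also have "\<dots> = (\<Sum>m\<le>n. \<Sum>x\<in>plane_trees m \<times> forests d (n - m). h (fst x) * prod_list (map h (snd x)))"
    by (simp add: sum_product sum.cartesian_product case_prod_unfold)
  also have "\<dots> = (\<Sum>(m, x)\<in>(SIGMA m:{..n}. plane_trees m \<times> forests d (n - m)).
      h (fst x) * prod_list (map h (snd x)))"
    by (rule sum.Sigma) (auto simp: finite_plane_trees finite_forests)
  also have "\<dots> = (\<Sum>ts\<in>forests (Suc d) n. prod_list (map h ts))"
  proof (rule sum.reindex_bij_witness[where i = "\<lambda>ts. (card (hd ts), hd ts, tl ts)"
        and j = "\<lambda>(m, t, ts). t # ts"])
    fix ts assume "ts \<in> forests (Suc d) n"
    then obtain t us where ts: "ts = t # us" "length us = d"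
      "\<forall>t\<in>set (t # us). plane_tree t \<and> finite t" "card t + sum_list (map card us) = n"
      unfolding forests_def by (cases ts) auto
    thus "(card (hd ts), hd ts, tl ts) \<in> (SIGMA m:{..n}. plane_trees m \<times> forests d (n - m))"
      by (auto simp: plane_trees_def forests_def)
    show "(case (card (hd ts), hd ts, tl ts) of (m, t, ts) \<Rightarrow> t # ts) = ts" using ts by simp
  qed (auto simp: plane_trees_def forests_def)
  finally show ?case .
qed

lemma downward_closed_lessThan:
  fixes S :: "nat set"
  assumes "finite S" "\<And>i j. i \<in> S \<Longrightarrow> j < i \<Longrightarrow> j \<in> S"
  shows "S = {..<card S}"
proof (rule card_subset_eq[OF assms(1), symmetric])
  show "{..<card S} \<subseteq> S"
  proof
    fix i assume "i \<in> {..<card S}"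
    show "i \<in> S"
    proof (rule ccontr)
      assume "i \<notin> S"
      hence "S \<subseteq> {..<i}" using assms(2) by (metis lessThan_iff linorder_cases subsetI)
      hence "card S \<le> i" using card_mono[of "{..<i}" S] by simp
      with \<open>i \<in> _\<close> show False by simp
    qed
  qed
qed simp

lemma Cons_in_graft: "i # u \<in> graft ts \<longleftrightarrow> i < length ts \<and> u \<in> ts ! i"
  by (auto simp: graft_def)

lemma Nil_in_graft: "[] \<in> graft ts"
  by (simp add: graft_def)

lemma plane_tree_graft:
  assumes "\<forall>t\<in>set ts. plane_tree t"
  shows "plane_tree (graft ts)"
proof -
  have pt: "plane_tree (ts ! i)" if "i < length ts" for i using assms that by simp
  show ?thesis unfolding plane_tree_def
  proof (intro conjI allI impI)
    fix u i assume "u @ [i] \<in> graft ts"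
    thus "u \<in> graft ts"
      using pt by (cases u) (auto simp: Cons_in_graft Nil_in_graft plane_tree_def)
  next
    fix u i j assume "u @ [i] \<in> graft ts" "j < i"
    thus "u @ [j] \<in> graft ts"
      using pt by (cases u) (auto simp: Cons_in_graft intro: plane_tree_Nil, auto simp: plane_tree_def)
  qed (simp add: Nil_in_graft)
qed

lemma branch_graft: "i < length ts \<Longrightarrow> branch (graft ts) i = ts ! i"
  by (simp add: branch_def Cons_in_graft)

lemma finite_graft: "\<forall>t\<in>set ts. finite t \<Longrightarrow> finite (graft ts)"
  by (auto simp: graft_def)

lemma children_graft_Nil:
  assumes "\<forall>t\<in>set ts. plane_tree t"
  shows "children (graft ts) [] = (\<lambda>i. [i]) ` {..<length ts}"
  using assms by (auto simp: children_def Cons_in_graft plane_tree_Nil)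

lemma children_graft_Cons:
  assumes "i < length ts"
  shows "children (graft ts) (i # u) = (#) i ` children (ts ! i) u"
  using assms by (auto simp: children_def Cons_in_graft)

lemma prod_graft:
  fixes f :: "nat list \<Rightarrow> 'a :: comm_monoid_mult"
  assumes "\<forall>t\<in>set ts. finite t"
  shows "prod f (graft ts) = f [] * (\<Prod>i<length ts. \<Prod>u\<in>ts ! i. f (i # u))"
proof -
  have "prod f (graft ts) = f [] * prod f (\<Union>i<length ts. (#) i ` (ts ! i))"
    unfolding graft_def using assms by (subst prod.insert) auto
  also have "prod f (\<Union>i<length ts. (#) i ` (ts ! i)) = (\<Prod>i<length ts. prod f ((#) i ` (ts ! i)))"
    using assms by (subst prod.UNION_disjoint) auto
  also have "\<dots> = (\<Prod>i<length ts. \<Prod>u\<in>ts ! i. f (i # u))"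
    by (simp add: prod.reindex)
  finally show ?thesis .
qed

lemma card_graft:
  assumes "\<forall>t\<in>set ts. finite t"
  shows "card (graft ts) = Suc (sum_list (map card ts))"
proof -
  have "card (graft ts) = Suc (card (\<Union>i<length ts. (#) i ` (ts ! i)))"
    unfolding graft_def using assms by (subst card_insert_disjoint) auto
  also have "card (\<Union>i<length ts. (#) i ` (ts ! i)) = (\<Sum>i<length ts. card ((#) i ` (ts ! i)))"
    using assms by (subst card_UN_disjoint) auto
  also have "\<dots> = (\<Sum>i<length ts. card (ts ! i))"
    by (intro sum.cong refl card_image) auto
  also have "\<dots> = sum_list (map card ts)"
    by (simp add: sum_list_sum_nth atLeast0LessThan)
  finally show ?thesis .
qed

lemma tree_weight_graft:
  assumes "\<forall>t\<in>set ts. finite t \<and> plane_tree t"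
  shows "tree_weight w (graft ts) = w (length ts) * prod_list (map (tree_weight w) ts)"
proof -
  have "tree_weight w (graft ts) = w (card (children (graft ts) [])) *
      (\<Prod>i<length ts. \<Prod>u\<in>ts ! i. w (card (children (graft ts) (i # u))))"
    unfolding tree_weight_def using assms by (subst prod_graft) auto
  also have "card (children (graft ts) []) = length ts"
    using assms by (subst children_graft_Nil) (auto simp: card_image inj_on_def)
  also have "(\<Prod>i<length ts. \<Prod>u\<in>ts ! i. w (card (children (graft ts) (i # u)))) =
      (\<Prod>i<length ts. tree_weight w (ts ! i))"
    by (simp add: tree_weight_def children_graft_Cons card_image)
  also have "\<dots> = prod_list (map (tree_weight w) ts)"
    by (simp add: prod.list_conv_set_nth atLeast0LessThan)
  finally show ?thesis .
qed

lemma graft_branches: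
  assumes T: "plane_tree T" "finite T" and d: "d = card (children T [])"
  shows "graft (map (branch T) [0..<d]) = T" and "\<And>i. [i] \<in> T \<longleftrightarrow> i < d"
proof -
  let ?S = "{i. [i] \<in> T}"
  have ch: "children T [] = (\<lambda>i. [i]) ` ?S" by (auto simp: children_def)
  have inj: "inj_on (\<lambda>i. [i]) A" for A :: "nat set" by (auto simp: inj_on_def)
  have "finite ((\<lambda>i. [i]) ` ?S)" using T(2) by (rule rev_finite_subset) auto
  hence "finite ?S" using inj by (rule finite_imageD)
  moreover have "j \<in> ?S" if "i \<in> ?S" "j < i" for i j
    using T(1) that unfolding plane_tree_def by (metis append_Nil mem_Collect_eq)
  ultimately have "?S = {..<card ?S}" by (rule downward_closed_lessThan)
  moreover have "card ?S = d" using ch inj d by (simp add: card_image)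
  ultimately show S: "\<And>i. [i] \<in> T \<longleftrightarrow> i < d" by auto
  show "graft (map (branch T) [0..<d]) = T"
  proof (intro set_eqI)
    fix u
    show "u \<in> graft (map (branch T) [0..<d]) \<longleftrightarrow> u \<in> T"
      using S plane_tree_singleton[OF T(1)] plane_tree_Nil[OF T(1)]
      by (cases u) (auto simp: Nil_in_graft Cons_in_graft branch_def)
  qed
qed

text \<open>Grafting and cutting into branches are inverse bijections between trees and forests. The
  degree is at most \<open>n\<close> because each child of the root is a vertex other than the
  root.\<close>

lemma sum_plane_trees_Suc:
  fixes g :: "nat list set \<Rightarrow> real"
  shows "(\<Sum>T\<in>plane_trees (Suc n). g T) = (\<Sum>d\<le>n. \<Sum>ts\<in>forests d n. g (graft ts))"
proof -
  have "(\<Sum>d\<le>n. \<Sum>ts\<in>forests d n. g (graft ts)) = (\<Sum>(d, ts)\<in>(SIGMA d:{..n}. forests d n). g (graft ts))"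
    by (rule sum.Sigma) (auto simp: finite_forests)
  also have "\<dots> = (\<Sum>T\<in>plane_trees (Suc n). g T)"
  proof (rule sum.reindex_bij_witness[where j = "\<lambda>(d, ts). graft ts" and
        i = "\<lambda>T. (card (children T []), map (branch T) [0..<card (children T [])])"])
    fix x assume "x \<in> (SIGMA d:{..n}. forests d n)"
    then obtain d ts where x: "x = (d, ts)" and ts: "ts \<in> forests d n" by auto
    hence f: "\<forall>t\<in>set ts. finite t \<and> plane_tree t" "length ts = d" "sum_list (map card ts) = n"
      by (auto simp: forests_def)
    have "card (children (graft ts) []) = d"
      using f by (subst children_graft_Nil) (auto simp: card_image inj_on_def)
    moreover have "map (branch (graft ts)) [0..<d] = ts"
      using f by (intro nth_equalityI) (auto simp: branch_graft)
    ultimately show "(card (children (case x of (d, ts) \<Rightarrow> graft ts) []),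
        map (branch (case x of (d, ts) \<Rightarrow> graft ts))
          [0..<card (children (case x of (d, ts) \<Rightarrow> graft ts) [])]) = x"
      using x by simp
    show "(case x of (d, ts) \<Rightarrow> graft ts) \<in> plane_trees (Suc n)"
      using f x by (auto simp: plane_trees_def plane_tree_graft finite_graft card_graft)
  next
    fix T assume "T \<in> plane_trees (Suc n)"
    hence T: "plane_tree T" "finite T" "card T = Suc n" by (auto simp: plane_trees_def)
    define d where "d = card (children T [])"
    note gb = graft_branches[OF T(1,2) d_def]
    let ?ts = "map (branch T) [0..<d]"
    have fin: "finite (branch T i)" for i
      unfolding branch_def using T(2) by (intro finite_inverse_image) (auto simp: inj_on_def)
    have ts: "\<forall>t\<in>set ?ts. plane_tree t \<and> finite t"
      using gb(2) plane_tree_branch[OF T(1)] fin by auto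
    hence "sum_list (map card ?ts) = n"
      using card_graft[of ?ts] gb(1) T(3) by simp
    moreover have "d \<le> n"
    proof -
      have "d \<le> card (T - {[]})"
        unfolding d_def using T(2) by (intro card_mono) (auto simp: children_def)
      thus ?thesis using T plane_tree_Nil[OF T(1)] by simp
    qed
    ultimately show "(card (children T []), map (branch T) [0..<card (children T [])])
        \<in> (SIGMA d:{..n}. forests d n)"
      using ts unfolding d_def[symmetric] by (auto simp: forests_def)
    show "(case (card (children T []), map (branch T) [0..<card (children T [])]) of
        (d, ts) \<Rightarrow> graft ts) = T"
      using gb(1) by (simp add: d_def)
  qed auto
  finally show ?thesis ..
qed

definition tree_fps :: "(nat \<Rightarrow> real) \<Rightarrow> nat \<Rightarrow> real fps" where
  "tree_fps w k = Abs_fps (\<lambda>n. \<Sum>T\<in>plane_trees n. if no_leaf_below k T then tree_weight w T else 0)"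

lemma tree_fps_0 [simp]: "tree_fps w k $ 0 = 0"
  by (auto simp: tree_fps_def plane_trees_def plane_tree_def intro!: sum.neutral)

lemma prod_list_if:
  "prod_list (map (\<lambda>x. if P x then f x else 0) xs) =
     (if \<forall>x\<in>set xs. P x then prod_list (map f xs) else (0 :: real))"
  by (induction xs) auto

text \<open>A root of degree 0 is a leaf at height 0, which a positive height bound forbids; hence
  \<open>w 0\<close> is replaced by 0 in the second recursion.\<close>

lemma tree_fps_Suc:
  "tree_fps w 0 $ Suc n = (\<Sum>d\<le>n. w d * (tree_fps w 0 ^ d) $ n)"
  "tree_fps w (Suc k) $ Suc n = (\<Sum>d\<le>n. (w(0 := 0)) d * (tree_fps w k ^ d) $ n)"
proof -
  let ?g = "\<lambda>k T. if no_leaf_below k T then tree_weight w T else 0"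
  \<comment> \<open>Common computation for both recursions: \<open>l\<close> bounds the heights in
    the whole tree, \<open>k\<close> those in its branches.\<close>
  have *: "w' d * (tree_fps w k ^ d) $ n = (\<Sum>ts\<in>forests d n. ?g l (graft ts))"
    if "\<And>ts. ts \<in> forests d n \<Longrightarrow>
      ?g l (graft ts) = (if \<forall>t\<in>set ts. no_leaf_below k t then w' d * prod_list (map (tree_weight w) ts) else 0)"
    for w' d l k
    unfolding tree_fps_def fps_power_sum_forests prod_list_if
    by (simp add: sum_distrib_left that cong: sum.cong) (auto intro!: sum.cong)
  have wt: "tree_weight w (graft ts) = w d * prod_list (map (tree_weight w) ts)"
    if "ts \<in> forests d n" for d ts
    using that by (subst tree_weight_graft) (auto simp: forests_def)
  show "tree_fps w 0 $ Suc n = (\<Sum>d\<le>n. w d * (tree_fps w 0 ^ d) $ n)"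
    unfolding tree_fps_def[of w 0, THEN arg_cong[where f="\<lambda>F. F $ Suc n"]] fps_nth_Abs_fps
      sum_plane_trees_Suc
    by (intro sum.cong refl *[symmetric]) (simp add: no_leaf_below_0 wt)
  have nl: "no_leaf_below (Suc k) (graft ts) \<longleftrightarrow> d \<noteq> 0 \<and> (\<forall>t\<in>set ts. no_leaf_below k t)"
    if "ts \<in> forests d n" for d ts
  proof -
    have ts: "\<forall>t\<in>set ts. plane_tree t" "length ts = d" using that by (auto simp: forests_def)
    have in_iff: "[i] \<in> graft ts \<longleftrightarrow> i < d" for i
      using ts by (auto simp: Cons_in_graft plane_tree_Nil)
    show ?thesis
      unfolding no_leaf_below_Suc[OF plane_tree_graft[OF ts(1)]] in_iff
      using ts(2) by (auto simp: branch_graft all_set_conv_all_nth)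
  qed
  show "tree_fps w (Suc k) $ Suc n = (\<Sum>d\<le>n. (w(0 := 0)) d * (tree_fps w k ^ d) $ n)"
    unfolding tree_fps_def[of w "Suc k"] fps_nth_Abs_fps sum_plane_trees_Suc
    by (intro sum.cong refl *[symmetric]) (simp add: nl wt)
qed

section \<open>Balls in boxes\<close>

text \<open>One term of a nonnegative series is at most its sum: at the point \<open>t\<close> the
  series \<open>Abs_fps f ^ n\<close> has the value \<open>M ^ n\<close>.\<close>

lemma fps_power_nth_le:
  fixes f :: "nat \<Rightarrow> real"
  assumes nn: "\<And>k. f k \<ge> 0" and t: "t > 0" and f: "(\<lambda>k. f k * t ^ k) sums M"
  shows "(Abs_fps f ^ n) $ s * t ^ s \<le> M ^ n"
proof (induction n arbitrary: s)
  case 0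
  show ?case using t by (cases s) auto
next
  case (Suc n)
  have nn': "0 \<le> f k * t ^ k" for k using nn t by simp
  hence M: "M \<ge> 0" using f suminf_nonneg[of "\<lambda>k. f k * t ^ k"] by (simp add: sums_iff)
  have "(Abs_fps f ^ Suc n) $ s * t ^ s = (\<Sum>d\<le>s. f d * (Abs_fps f ^ n) $ (s - d) * t ^ s)"
    by (simp add: fps_power_Suc_nth sum_distrib_right del: power_Suc)
  also have "\<dots> = (\<Sum>d\<le>s. (f d * t ^ d) * ((Abs_fps f ^ n) $ (s - d) * t ^ (s - d)))"
  proof (intro sum.cong refl)
    fix d assume "d \<in> {..s}"
    hence "t ^ s = t ^ d * t ^ (s - d)" by (simp add: power_add[symmetric])
    thus "f d * (Abs_fps f ^ n) $ (s - d) * t ^ s =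
      (f d * t ^ d) * ((Abs_fps f ^ n) $ (s - d) * t ^ (s - d))" by simp
  qed
  also have "\<dots> \<le> (\<Sum>d\<le>s. (f d * t ^ d) * M ^ n)"
    using Suc nn' by (intro sum_mono mult_left_mono) auto
  also have "\<dots> = (\<Sum>d\<le>s. f d * t ^ d) * M ^ n" by (simp add: sum_distrib_right)
  also have "(\<Sum>d\<le>s. f d * t ^ d) \<le> M"
    using sum_le_suminf[of "\<lambda>k. f k * t ^ k" "{..s}"] f nn' by (simp add: sums_iff)
  finally show ?case using M by (simp add: mult_right_mono)
qed

text \<open>Binomial expansion by the number \<open>i\<close> of boxes that use the additional
  weight \<open>v\<close> for \<open>j\<close> balls. The guard stands for coefficients of negative
  index, which truncated subtraction would turn into coefficient 0.\<close>

lemma fps_power_upd_nth: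
  fixes w :: "nat \<Rightarrow> real"
  shows "(Abs_fps (w(j := w j + v)) ^ n) $ s = (\<Sum>i\<le>n. real (n choose i) * v ^ i *
    (if i * j \<le> s then (Abs_fps w ^ (n - i)) $ (s - i * j) else 0))"
proof -
  let ?G = "Abs_fps w"
  have "Abs_fps (w(j := w j + v)) = fps_const v * fps_X ^ j + ?G"
    by (rule fps_ext) (auto simp: fps_X_power_nth)
  hence "Abs_fps (w(j := w j + v)) ^ n =
      (\<Sum>i\<le>n. of_nat (n choose i) * (fps_const v * fps_X ^ j) ^ i * ?G ^ (n - i))"
    by (simp add: binomial_ring)
  also have "\<dots> = (\<Sum>i\<le>n. fps_const (real (n choose i) * v ^ i) * (fps_X ^ (i * j) * ?G ^ (n - i)))"
    by (intro sum.cong refl)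
       (simp add: power_mult_distrib fps_const_power power_mult[symmetric] mult_ac
          fps_of_nat[symmetric] fps_const_mult[symmetric] del: fps_const_mult)
  finally show ?thesis
    by (auto simp: fps_sum_nth fps_X_power_mult_nth intro!: sum.cong)
qed

text \<open>Convexity of \<open>x \<mapsto> u powr x\<close>: its tangent at the mean
  \<open>e\<close> lies below it, by \<open>1 + x \<le> exp x\<close>, and the linear term of the
  tangent averages to zero.\<close>

lemma jensen_powr:
  fixes b :: "nat \<Rightarrow> real"
  assumes b: "\<And>i. i \<in> A \<Longrightarrow> b i \<ge> 0" and pos: "sum b A > 0" and u: "u > 0"
  shows "sum b A * u powr ((\<Sum>i\<in>A. real i * b i) / sum b A) \<le> (\<Sum>i\<in>A. b i * u ^ i)"
proof -
  define e where "e = (\<Sum>i\<in>A. real i * b i) / sum b A"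
  have "sum b A * u powr e = u powr e * (sum b A + ((\<Sum>i\<in>A. real i * b i) - e * sum b A) * ln u)"
    using pos by (simp add: e_def)
  also have "\<dots> = (\<Sum>i\<in>A. b i * (u powr e * (1 + (real i - e) * ln u)))"
    by (simp add: sum_distrib_left sum_distrib_right sum_subtractf sum.distrib algebra_simps)
  also have "\<dots> \<le> (\<Sum>i\<in>A. b i * u ^ i)"
  proof (intro sum_mono mult_left_mono b)
    fix i
    have "u powr e * (1 + (real i - e) * ln u) \<le> u powr e * exp ((real i - e) * ln u)"
      by (intro mult_left_mono exp_ge_add_one_self) auto
    also have "\<dots> = u powr (real i)"
      unfolding powr_def using u by (simp add: exp_add[symmetric] algebra_simps)
    also have "\<dots> = u ^ i" using u by (rule powr_realpow)
    finally show "u powr e * (1 + (real i - e) * ln u) \<le> u ^ i" .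
  qed
  finally show ?thesis by (simp add: e_def)
qed

text \<open>
  Jensen's inequality for the number \<open>N\<close> of boxes containing \<open>j\<close> balls: multiplying the weight of \<open>j\<close>
  by \<open>u\<close> gives the moment of \<open>u ^ N\<close>, and the exponent on the left is the mean of \<open>N\<close>.
\<close>

lemma box_count_jensen:
  fixes w :: "nat \<Rightarrow> real"
  assumes nn: "\<And>k. w k \<ge> 0" and pos: "(Abs_fps w ^ n) $ s > 0" and u: "u > 0" and j: "j \<le> s" and n: "n > 0"
  shows "(Abs_fps w ^ n) $ s *
      u powr (real n * (w j * (Abs_fps w ^ (n - 1)) $ (s - j) / (Abs_fps w ^ n) $ s))
    \<le> (Abs_fps (w(j := u * w j)) ^ n) $ s"
proof -
  obtain m where m: "n = Suc m" using n by (cases n) auto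
  let ?G = "Abs_fps (w(j := 0))"
  \<comment> \<open>\<open>g s n i\<close> is the weight with which the other \<open>n - i\<close>
    boxes, none holding exactly \<open>j\<close> balls, share the remaining balls; so
    \<open>b i\<close> collects the configurations with exactly \<open>i\<close> boxes holding
    \<open>j\<close> balls.\<close>
  define g where "g = (\<lambda>s n i. if i * j \<le> s then (?G ^ (n - i)) $ (s - i * j) else 0)"
  define b where "b = (\<lambda>i. real (n choose i) * w j ^ i * g s n i)"
  have upd: "(Abs_fps (w(j := v)) ^ n) $ s = (\<Sum>i\<le>n. real (n choose i) * v ^ i * g s n i)" for v n s
    using fps_power_upd_nth[of "w(j := 0)" j v n s] by (simp add: g_def)
  have G: "0 \<preceq> ?G ^ k" for k using nn by (intro fps_nonneg_power fps_nonneg_Abs) auto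
  have b_nn: "b i \<ge> 0" for i
    using nn fps_leD[OF G] by (auto simp: b_def g_def intro!: mult_nonneg_nonneg)
  have b_sum: "(\<Sum>i\<le>n. b i) = (Abs_fps w ^ n) $ s"
    using upd[of "w j" n s] by (simp add: b_def)
  \<comment> \<open>The absorption identity for binomial coefficients reduces the mean number of
    such boxes to \<open>n\<close> times the weight of the event that one given box holds
    \<open>j\<close> balls.\<close>
  have "(\<Sum>i\<le>n. real i * b i) = (\<Sum>i\<le>m. real (Suc i) * b (Suc i))"
    unfolding m by (simp add: sum.atMost_Suc_shift del: sum.atMost_Suc)
  also have "\<dots> = (\<Sum>i\<le>m. real n * w j * (real (m choose i) * w j ^ i * g (s - j) m i))"
  proof (intro sum.cong refl)
    fix i
    have "real (Suc i) * real (n choose Suc i) = real n * real (m choose i)"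
      unfolding m of_nat_mult[symmetric] by (simp only: Suc_times_binomial)
    moreover have "g s n (Suc i) = g (s - j) m i"
      using j by (auto simp: g_def m algebra_simps)
    moreover have "real (Suc i) * b (Suc i) =
        real (Suc i) * real (n choose Suc i) * (w j * w j ^ i * g s n (Suc i))"
      by (simp add: b_def mult_ac del: of_nat_Suc)
    ultimately show "real (Suc i) * b (Suc i) =
        real n * w j * (real (m choose i) * w j ^ i * g (s - j) m i)"
      by (simp add: mult_ac del: of_nat_Suc)
  qed
  also have "\<dots> = real n * (w j * (Abs_fps w ^ m) $ (s - j))"
    using upd[of "w j" m "s - j"] by (simp add: sum_distrib_left mult.assoc)
  finally have e: "(\<Sum>i\<le>n. real i * b i) = real n * (w j * (Abs_fps w ^ (n - 1)) $ (s - j))"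
    by (simp add: m)
  have "(\<Sum>i\<le>n. b i * u ^ i) = (Abs_fps (w(j := u * w j)) ^ n) $ s"
    unfolding upd by (intro sum.cong refl) (simp add: b_def power_mult_distrib)
  thus ?thesis
    using jensen_powr[of "{..n}" b u] b_nn pos u by (simp add: b_sum e)
qed

section \<open>Proportion of boxes with a given content: tilted weights\<close>

lemma box_ratio_bounds:
  fixes w :: "nat \<Rightarrow> real"
  assumes nn: "\<And>k. w k \<ge> 0"
  shows "0 \<le> w j * (Abs_fps w ^ (n - 1)) $ (s - j) / (Abs_fps w ^ n) $ s"
  using nn fps_leD[OF fps_nonneg_power[OF fps_nonneg_Abs[of w]]]
  by (auto intro!: divide_nonneg_nonneg mult_nonneg_nonneg)

text \<open>Let \<open>N\<close> be the number of boxes with \<open>j\<close> balls. Jensen bounds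
  the moment of \<open>u ^ N\<close> from below; \<open>fps_power_nth_le\<close> at \<open>t\<close>
  bounds it from above by \<open>(1 + (u - 1) * p) ^ n\<close>, up to the subexponential loss
  allowed by \<open>lower\<close>. Comparing exponents gives
  \<open>e n * ln u \<le> (u - 1) * p + \<epsilon>\<close>, and \<open>u\<close> slightly above and
  slightly below 1 forces \<open>e n\<close> towards \<open>p\<close>.\<close>

lemma box_ratio_tendsto_tilted:
  fixes w :: "nat \<Rightarrow> real" and s :: "nat \<Rightarrow> nat"
  assumes nn: "\<And>k. w k \<ge> 0" and t: "t > 0" and \<phi>: "(\<lambda>k. w k * t ^ k) sums \<phi>" "\<phi> > 0"
    and F: "F \<le> sequentially" and j: "eventually (\<lambda>n. j \<le> s n) F"
    and lower: "\<And>\<epsilon> :: real. \<epsilon> > 0 \<Longrightarrow> eventually (\<lambda>n. (Abs_fps w ^ n) $ s n * t ^ s n \<ge> \<phi> ^ n * exp (- \<epsilon> * real n)) F"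
  shows "((\<lambda>n. w j * (Abs_fps w ^ (n - 1)) $ (s n - j) / (Abs_fps w ^ n) $ s n) \<longlongrightarrow> w j * t ^ j / \<phi>) F"
proof -
  define p where "p = w j * t ^ j / \<phi>"
  define e where "e = (\<lambda>n. w j * (Abs_fps w ^ (n - 1)) $ (s n - j) / (Abs_fps w ^ n) $ s n)"
  have p0: "p \<ge> 0" using nn t \<phi> by (simp add: p_def)
  have "w j * t ^ j \<le> \<phi>"
    using sum_le_suminf[of "\<lambda>k. w k * t ^ k" "{j}"] \<phi> nn t by (auto simp: sums_iff)
  hence p1: "p \<le> 1" using \<phi> by (simp add: p_def)
  have e_nn: "e n \<ge> 0" for n using box_ratio_bounds[of w j n "s n"] nn by (simp add: e_def)
  have key: "eventually (\<lambda>n. e n * ln u \<le> (u - 1) * p + \<epsilon>) F" if u: "u > 0" and \<epsilon>: "\<epsilon> > 0" for u \<epsilon>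
  proof -
    have "eventually (\<lambda>n. n > 0) F"
      using F eventually_gt_at_top[of 0] by (rule filter_leD)
    with lower[OF \<epsilon>] j show ?thesis
    proof eventually_elim
      case (elim n)
      let ?x = "(Abs_fps w ^ n) $ s n"
      have "0 < \<phi> ^ n * exp (- \<epsilon> * real n)" using \<phi>(2) by simp
      hence "0 < ?x * t ^ s n" using elim(1) by (rule less_le_trans)
      hence x: "?x > 0" using t by (simp add: zero_less_mult_iff)
      have "(\<lambda>k. (w(j := u * w j)) k * t ^ k) sums (\<phi> + (u - 1) * w j * t ^ j)"
      proof -
        have "(\<lambda>k. w k * t ^ k + (if k = j then (u - 1) * w j * t ^ j else 0)) sums (\<phi> + (u - 1) * w j * t ^ j)"
          using \<phi>(1) sums_single[of j "\<lambda>_. (u - 1) * w j * t ^ j"] by (intro sums_add) auto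
        also have "(\<lambda>k. w k * t ^ k + (if k = j then (u - 1) * w j * t ^ j else 0)) =
          (\<lambda>k. (w(j := u * w j)) k * t ^ k)" by (auto simp: algebra_simps)
        finally show ?thesis .
      qed
      hence "(Abs_fps (w(j := u * w j)) ^ n) $ s n * t ^ s n \<le> (\<phi> + (u - 1) * w j * t ^ j) ^ n"
        using nn u t by (intro fps_power_nth_le) auto
      also have "\<phi> + (u - 1) * w j * t ^ j = \<phi> * (1 + (u - 1) * p)"
      proof -
        have "\<phi> * (1 + (u - 1) * p) = \<phi> + (u - 1) * (\<phi> * p)" by (simp add: algebra_simps)
        also have "\<phi> * p = w j * t ^ j" using \<phi>(2) by (simp add: p_def)
        finally show ?thesis by simp
      qed
      also have "(\<phi> * (1 + (u - 1) * p)) ^ n \<le> \<phi> ^ n * exp ((u - 1) * p) ^ n"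
      proof -
        \<comment> \<open>Keeps the base \<open>1 + (u - 1) * p\<close> nonnegative, so that the
          power is monotone in it.\<close>
        have "(u - 1) * p \<ge> -1"
        proof (cases "u \<ge> 1")
          case True thus ?thesis using p0 mult_nonneg_nonneg[of "u - 1" p] by linarith
        next
          case False
          hence "(1 - u) * p \<le> 1 * 1" using u p0 p1 by (intro mult_mono) auto
          thus ?thesis by (simp add: algebra_simps)
        qed
        thus ?thesis unfolding power_mult_distrib using \<phi>
          by (intro mult_left_mono power_mono) (auto simp: exp_ge_add_one_self)
      qed
      finally have up: "(Abs_fps (w(j := u * w j)) ^ n) $ s n * t ^ s n \<le> \<phi> ^ n * exp ((u - 1) * p * real n)"
        unfolding exp_of_nat2_mult .
      have "\<phi> ^ n * exp (- \<epsilon> * real n) * u powr (real n * e n) \<le> ?x * t ^ s n * u powr (real n * e n)"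
        using elim(1) by (intro mult_right_mono) auto
      also have "\<dots> = (?x * u powr (real n * e n)) * t ^ s n" by simp
      also have "\<dots> \<le> (Abs_fps (w(j := u * w j)) ^ n) $ s n * t ^ s n"
        using box_count_jensen[OF nn x u elim(2) elim(3)] t by (intro mult_right_mono) (auto simp: e_def)
      also note up
      finally have "exp (- \<epsilon> * real n) * u powr (real n * e n) \<le> exp ((u - 1) * p * real n)"
        using \<phi> by (simp add: mult.assoc)
      hence "exp (real n * (e n * ln u - \<epsilon>)) \<le> exp (real n * ((u - 1) * p))"
        using u by (simp add: powr_def exp_add[symmetric] algebra_simps)
      hence "e n * ln u - \<epsilon> \<le> (u - 1) * p" using elim(3) by simp
      thus ?case by simp
    qed
  qed
  have "(e \<longlongrightarrow> p) F"
  proof (rule tendstoI)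
    fix \<delta> :: real assume \<delta>: "\<delta> > 0"
    \<comment> \<open>Used with \<open>u = 1 + h\<close> and \<open>u = 1 - h\<close>. The error
      term is taken as \<open>h\<^sup>2\<close>, so that after division by \<open>h\<close> it is
      still of order \<open>h\<close>; the bounds 1/2 and \<open>\<delta> / 4\<close> then keep the
      total error below \<open>\<delta>\<close>.\<close>
    define h where "h = min (1/2) (\<delta> / 4)"
    have h: "0 < h" "h \<le> 1/2" "h \<le> \<delta> / 4" using \<delta> by (auto simp: h_def)
    have hp: "h * p \<le> h" "h * h \<le> h / 2" using h p1 by auto
    have "eventually (\<lambda>n. e n * ln (1 + h) \<le> h * p + h\<^sup>2) F"
      "eventually (\<lambda>n. e n * ln (1 - h) \<le> - (h * p) + h\<^sup>2) F"
      using key[of "1 + h" "h\<^sup>2"] key[of "1 - h" "h\<^sup>2"] h by auto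
    thus "eventually (\<lambda>n. dist (e n) p < \<delta>) F"
    proof eventually_elim
      case (elim n)
      have l1: "ln (1 + h) \<ge> h / (1 + h)"
        using ln_le_minus_one[of "1 / (1 + h)"] h by (simp add: ln_div field_simps)
      have l2: "ln (1 - h) \<ge> - h / (1 - h)"
        using ln_le_minus_one[of "1 / (1 - h)"] h by (simp add: ln_div field_simps)
      have "e n * (h / (1 + h)) \<le> h * (p + h)"
        using elim(1) mult_left_mono[OF l1 e_nn[of n]] by (simp add: power2_eq_square algebra_simps)
      hence "h * (e n / (1 + h)) \<le> h * (p + h)" by (simp add: mult.commute)
      hence "e n / (1 + h) \<le> p + h" using h by (simp only: mult_le_cancel_left_pos)
      hence "e n \<le> (1 + h) * (p + h)" using h by (simp add: field_simps)
      also have "\<dots> = p + h + h * p + h * h" by (simp add: algebra_simps)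
      also have "\<dots> < p + \<delta>" using hp h \<delta> by linarith
      finally have 1: "e n < p + \<delta>" .
      have "e n * (- h / (1 - h)) \<le> - h * (p - h)"
        using elim(2) mult_left_mono[OF l2 e_nn[of n]] by (simp add: power2_eq_square algebra_simps)
      hence "h * (p - h) \<le> h * (e n / (1 - h))" by (simp add: mult.commute)
      hence "p - h \<le> e n / (1 - h)" using h by (simp only: mult_le_cancel_left_pos)
      hence "(1 - h) * (p - h) \<le> e n" using h by (simp add: field_simps)
      moreover have "(1 - h) * (p - h) = p - h - h * p + h * h" by (simp add: algebra_simps)
      moreover have "0 \<le> h * h" by simp
      ultimately have "e n > p - \<delta>" using hp(1) h \<delta> by linarith
      with 1 show ?case unfolding dist_real_def by linarith
    qed
  qed
  thus ?thesis by (simp add: e_def p_def)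
qed

section \<open>Proportion of boxes with a given content: zero radius of convergence\<close>

lemma fps_mult_nth_ge:
  assumes "0 \<preceq> F" "0 \<preceq> G"
  shows "F $ a * G $ b \<le> (F * G) $ (a + b)"
proof -
  have "F $ a * G $ (a + b - a) \<le> (\<Sum>i=0..a + b. F $ i * G $ (a + b - i))"
    using assms by (intro member_le_sum) (auto simp: fps_le_def)
  thus ?thesis by (simp add: fps_mult_nth)
qed

lemma fps_power_nth_ge:
  assumes "0 \<preceq> F"
  shows "(F $ k) ^ m \<le> (F ^ m) $ (m * k)"
proof (induction m)
  case (Suc m)
  have "F $ k * (F $ k) ^ m \<le> F $ k * (F ^ m) $ (m * k)"
    using Suc assms by (intro mult_left_mono) (auto simp: fps_le_def)
  also have "\<dots> \<le> (F * F ^ m) $ (k + m * k)"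
    by (intro fps_mult_nth_ge assms fps_nonneg_power)
  finally show ?case by simp
qed simp

text \<open>
  \<open>k q\<close> boxes containing \<open>j\<close> balls each are traded for \<open>j q\<close> boxes containing \<open>k\<close> balls each and
  \<open>(k - j) q\<close> empty boxes.
\<close>

lemma box_swap:
  fixes w :: "nat \<Rightarrow> real"
  assumes nn: "\<And>k. w k \<ge> 0" and w0: "w 0 > 0" and jk: "j < k"
    and \<eta>: "0 < \<eta>" "\<eta> \<le> 1" "w j ^ k * w 0 ^ j \<le> \<eta> ^ k * w k ^ j * w 0 ^ k"
    and i: "i \<le> n" "i * j \<le> s"
  shows "w j ^ i * (Abs_fps w ^ (n - i)) $ (s - i * j) \<le> \<eta> ^ i / \<eta> ^ k * (Abs_fps w ^ n) $ s"
proof -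
  let ?F = "Abs_fps w"
  \<comment> \<open>Only complete groups of \<open>k\<close> boxes are traded, \<open>q\<close>
    groups in all. The \<open>a < k\<close> boxes left over stay as they are, at the price of the
    factor \<open>1 / \<eta> ^ k\<close>.\<close>
  define q where "q = i div k"
  define a where "a = i mod k"
  have ia: "i = k * q + a" by (simp add: q_def a_def)
  have pos: "0 \<preceq> ?F ^ m" for m using nn by (intro fps_nonneg_power fps_nonneg_Abs) auto
  have F: "0 \<preceq> ?F" using nn by (intro fps_nonneg_Abs) auto
  have wp: "w l ^ m \<le> (?F ^ m) $ (m * l)" for l m
    using fps_power_nth_ge[OF F, of l m] by simp
  have c: "(\<eta> ^ k * w k ^ j * w 0 ^ (k - j)) ^ q = \<eta> ^ (k * q) * (w k ^ (j * q) * w 0 ^ ((k - j) * q))"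
    by (simp add: power_mult_distrib power_mult)
  have "w j ^ k * w 0 ^ j \<le> (\<eta> ^ k * w k ^ j * w 0 ^ (k - j)) * w 0 ^ j"
    using \<eta>(3) jk by (simp add: mult.assoc power_add[symmetric])
  hence "w j ^ k \<le> \<eta> ^ k * w k ^ j * w 0 ^ (k - j)" using w0 by simp
  hence "(w j ^ k) ^ q \<le> (\<eta> ^ k * w k ^ j * w 0 ^ (k - j)) ^ q"
    using nn by (intro power_mono) auto
  hence 1: "w j ^ (k * q) \<le> \<eta> ^ (k * q) * (w k ^ (j * q) * w 0 ^ ((k - j) * q))"
    unfolding c by (simp add: power_mult)
  have "w j ^ i * (?F ^ (n - i)) $ (s - i * j) =
      w j ^ (k * q) * (w j ^ a * (?F ^ (n - i)) $ (s - i * j))"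
    by (simp add: ia power_add)
  also have "w j ^ a * (?F ^ (n - i)) $ (s - i * j) \<le> (?F ^ a) $ (a * j) * (?F ^ (n - i)) $ (s - i * j)"
    using wp fps_leD[OF pos] by (intro mult_right_mono) auto
  also have "\<dots> \<le> (?F ^ a * ?F ^ (n - i)) $ (a * j + (s - i * j))"
    by (intro fps_mult_nth_ge pos)
  also have "?F ^ a * ?F ^ (n - i) = ?F ^ (n - k * q)"
    using i ia by (simp add: power_add[symmetric])
  also have "a * j + (s - i * j) = s - k * q * j"
    using i ia by (simp add: add_mult_distrib)
  also have "w j ^ (k * q) * (?F ^ (n - k * q)) $ (s - k * q * j) \<le>
      \<eta> ^ (k * q) * (w k ^ (j * q) * w 0 ^ ((k - j) * q)) * (?F ^ (n - k * q)) $ (s - k * q * j)"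
    using 1 fps_leD[OF pos] by (intro mult_right_mono) auto
  also have "w k ^ (j * q) * w 0 ^ ((k - j) * q) \<le> (?F ^ (j * q)) $ (j * q * k) * (?F ^ ((k - j) * q)) $ ((k - j) * q * 0)"
    using nn fps_leD[OF pos] by (intro mult_mono wp) auto
  also have "\<dots> \<le> (?F ^ (j * q) * ?F ^ ((k - j) * q)) $ (j * q * k + (k - j) * q * 0)"
    by (intro fps_mult_nth_ge pos)
  also have "?F ^ (j * q) * ?F ^ ((k - j) * q) = ?F ^ (k * q)"
    using jk by (simp add: power_add[symmetric] add_mult_distrib[symmetric])
  also have "\<eta> ^ (k * q) * (?F ^ (k * q)) $ (j * q * k + (k - j) * q * 0) * (?F ^ (n - k * q)) $ (s - k * q * j)
      = \<eta> ^ (k * q) * ((?F ^ (k * q)) $ (k * q * j) * (?F ^ (n - k * q)) $ (s - k * q * j))"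
    by (simp add: mult_ac)
  also have "(?F ^ (k * q)) $ (k * q * j) * (?F ^ (n - k * q)) $ (s - k * q * j) \<le>
      (?F ^ (k * q) * ?F ^ (n - k * q)) $ (k * q * j + (s - k * q * j))"
    by (intro fps_mult_nth_ge pos)
  also have "?F ^ (k * q) * ?F ^ (n - k * q) = ?F ^ n"
    using i ia by (simp add: power_add[symmetric])
  also have "k * q * j + (s - k * q * j) = s"
    using i ia by (simp add: add_mult_distrib)
  finally have "w j ^ i * (?F ^ (n - i)) $ (s - i * j) \<le> \<eta> ^ (k * q) * (?F ^ n) $ s"
    using nn \<eta> fps_leD[OF pos] by (simp add: mult_left_mono mult_right_mono)
  moreover have "\<eta> ^ (k * q) \<le> \<eta> ^ i / \<eta> ^ k"
  proof -
    have "a \<le> k" unfolding a_def using jk by (simp add: less_imp_le)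
    hence "\<eta> ^ (k * q + k) \<le> \<eta> ^ i"
      unfolding ia using \<eta> by (intro power_decreasing) auto
    thus ?thesis using \<eta> by (simp add: power_add field_simps)
  qed
  hence "\<eta> ^ (k * q) * (?F ^ n) $ s \<le> \<eta> ^ i / \<eta> ^ k * (?F ^ n) $ s"
    using fps_leD[OF pos[of n], of s] by (intro mult_right_mono) auto
  ultimately show ?thesis by linarith
qed

text \<open>If \<open>w k < M ^ k * (1 + w 0)\<close> held for all \<open>k > j\<close>, the series
  would converge at \<open>1 / (2 * M)\<close>, against the zero radius. The factor \<open>M\<close>
  makes up for \<open>w j / (w 0 * \<eta>)\<close>, the factor \<open>1 + w 0\<close> for
  \<open>w 0 ^ j\<close>.\<close>

lemma conv_radius_0_large_weight:
  fixes w :: "nat \<Rightarrow> real"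
  assumes nn: "\<And>k. w k \<ge> 0" and w0: "w 0 > 0" and R: "conv_radius w = 0" and j: "j \<ge> 1" and \<eta>: "\<eta> > 0"
  shows "\<exists>k>j. w j ^ k * w 0 ^ j \<le> \<eta> ^ k * w k ^ j * w 0 ^ k"
proof -
  define M where "M = max 1 (w j / (w 0 * \<eta>))"
  have M: "M \<ge> 1" "w j \<le> w 0 * \<eta> * M"
    using w0 \<eta> unfolding M_def by (auto simp: field_simps max_def)
  have "\<exists>k>j. w k \<ge> M ^ k * (1 + w 0)"
  proof (rule ccontr)
    assume "\<not> ?thesis"
    hence less: "w k < M ^ k * (1 + w 0)" if "k > j" for k using that by force
    have "summable (\<lambda>k. w k * (1 / (2 * M)) ^ k)"
    proof (rule summable_comparison_test_ev)
      show "summable (\<lambda>k. (1 + w 0) * (1 / 2) ^ k)"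
        by (intro summable_mult summable_geometric) auto
      show "eventually (\<lambda>k. norm (w k * (1 / (2 * M)) ^ k) \<le> (1 + w 0) * (1 / 2) ^ k) sequentially"
        using eventually_gt_at_top[of j]
      proof eventually_elim
        case (elim k)
        have "norm (w k * (1 / (2 * M)) ^ k) = w k * (1 / (2 * M)) ^ k"
          using nn M by simp
        also have "\<dots> \<le> M ^ k * (1 + w 0) * (1 / (2 * M)) ^ k"
          using less[OF elim] M by (intro mult_right_mono) auto
        also have "\<dots> = (1 + w 0) * (1 / 2) ^ k"
          using M by (simp add: power_divide power_mult_distrib field_simps)
        finally show ?case .
      qed
    qed
    from conv_radius_geI[OF this] show False using R M by (simp add: zero_ereal_def)
  qed
  then obtain k where k: "k > j" "w k \<ge> M ^ k * (1 + w 0)" by blast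
  have "w j ^ k * w 0 ^ j \<le> (w 0 * \<eta> * M) ^ k * w 0 ^ j"
    using M nn w0 by (intro mult_right_mono power_mono) auto
  also have "\<dots> = \<eta> ^ k * (M ^ k * w 0 ^ j) * w 0 ^ k" by (simp add: power_mult_distrib)
  also have "M ^ k * w 0 ^ j \<le> (M ^ k) ^ j * (1 + w 0) ^ j"
    using M w0 j by (intro mult_mono power_mono) (auto intro: self_le_power)
  also have "\<dots> \<le> w k ^ j"
    unfolding power_mult_distrib[symmetric] using k M w0 by (intro power_mono) auto
  finally have "w j ^ k * w 0 ^ j \<le> \<eta> ^ k * w k ^ j * w 0 ^ k"
    using \<eta> w0 by (simp add: mult_left_mono mult_right_mono)
  thus ?thesis using k by blast
qed

text \<open>Jensen with \<open>u = 2\<close> against a bound from trades: the doubled weight is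
  expanded by the number of marked boxes, each of which costs a factor \<open>\<eta>\<close> by
  \<open>box_swap\<close>, so the moment is at most \<open>(1 + \<eta>) ^ n / \<eta> ^ k\<close>.
  Hence \<open>e n * ln 2 \<le> \<eta> + O(1 / n)\<close>, with \<open>\<eta>\<close> arbitrarily
  small.\<close>

lemma box_ratio_tendsto_0:
  fixes w :: "nat \<Rightarrow> real" and s :: "nat \<Rightarrow> nat"
  assumes nn: "\<And>k. w k \<ge> 0" and w0: "w 0 > 0" and R: "conv_radius w = 0" and j1: "j \<ge> 1"
    and F: "F \<le> sequentially" and j: "eventually (\<lambda>n. j \<le> s n) F"
    and pos: "eventually (\<lambda>n. (Abs_fps w ^ n) $ s n > 0) F"
  shows "((\<lambda>n. w j * (Abs_fps w ^ (n - 1)) $ (s n - j) / (Abs_fps w ^ n) $ s n) \<longlongrightarrow> 0) F"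
proof -
  define e where "e = (\<lambda>n. w j * (Abs_fps w ^ (n - 1)) $ (s n - j) / (Abs_fps w ^ n) $ s n)"
  have "(e \<longlongrightarrow> 0) F"
  proof (rule tendstoI)
    fix \<epsilon> :: real assume \<epsilon>: "\<epsilon> > 0"
    define \<eta> where "\<eta> = min 1 (\<epsilon> / 4)"
    have \<eta>: "0 < \<eta>" "\<eta> \<le> 1" "\<eta> \<le> \<epsilon> / 4" using \<epsilon> by (auto simp: \<eta>_def)
    obtain k where k: "k > j" "w j ^ k * w 0 ^ j \<le> \<eta> ^ k * w k ^ j * w 0 ^ k"
      using conv_radius_0_large_weight[OF nn w0 R j1 \<eta>(1)] by blast
    have "(\<lambda>n. (- 2 * k * ln \<eta>) / real n) \<longlonglongrightarrow> 0" by (rule lim_const_over_n)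
    hence "eventually (\<lambda>n. (- 2 * k * ln \<eta>) / real n < \<epsilon> / 2) sequentially"
      using \<epsilon> by (intro order_tendstoD(2)[of _ 0]) auto
    hence "eventually (\<lambda>n. (- 2 * k * ln \<eta>) / real n < \<epsilon> / 2) F" "eventually (\<lambda>n. n > 0) F"
      using filter_leD[OF F] eventually_gt_at_top[of 0] by blast+
    thus "eventually (\<lambda>n. dist (e n) 0 < \<epsilon>) F" using j pos
    proof eventually_elim
      case (elim n)
      let ?x = "(Abs_fps w ^ n) $ s n"
      have "?x * 2 powr (real n * e n) \<le> (Abs_fps (w(j := w j + w j)) ^ n) $ s n"
        \<comment> \<open>\<open>num.Bit0 num.One\<close> is the numeral 2; \<open>mult_2\<close>
          brings the doubled weight into the form \<open>w j + v\<close> of the binomial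
          expansion.\<close>
        using box_count_jensen[OF nn elim(4) zero_less_numeral elim(3,2), of "num.Bit0 num.One"]
        unfolding mult_2 e_def .
      also have "\<dots> = (\<Sum>i\<le>n. real (n choose i) *
          (if i * j \<le> s n then w j ^ i * (Abs_fps w ^ (n - i)) $ (s n - i * j) else 0))"
        unfolding fps_power_upd_nth by (intro sum.cong) auto
      also have "\<dots> \<le> (\<Sum>i\<le>n. real (n choose i) * (\<eta> ^ i / \<eta> ^ k * ?x))"
      proof (intro sum_mono mult_left_mono)
        fix i assume "i \<in> {..n}"
        thus "(if i * j \<le> s n then w j ^ i * (Abs_fps w ^ (n - i)) $ (s n - i * j) else 0)
            \<le> \<eta> ^ i / \<eta> ^ k * ?x"
          using box_swap[OF nn w0 k(1) \<eta>(1,2) k(2), of i n "s n"] elim(4) \<eta> by simp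
      qed simp
      also have "\<dots> = (\<Sum>i\<le>n. real (n choose i) * \<eta> ^ i * 1 ^ (n - i)) / \<eta> ^ k * ?x"
        by (simp add: sum_distrib_right sum_divide_distrib mult.assoc)
      also have "(\<Sum>i\<le>n. real (n choose i) * \<eta> ^ i * 1 ^ (n - i)) = (\<eta> + 1) ^ n"
        by (simp only: binomial_ring)
      finally have "?x * 2 powr (real n * e n) \<le> ?x * ((1 + \<eta>) ^ n / \<eta> ^ k)"
        unfolding mult.commute[of ?x "_ / _"] add.commute[of 1 \<eta>] .
      hence "2 powr (real n * e n) \<le> (1 + \<eta>) ^ n / \<eta> ^ k"
        using elim(4) by (simp only: mult_le_cancel_left_pos)
      hence "ln (2 powr (real n * e n)) \<le> ln ((1 + \<eta>) ^ n / \<eta> ^ k)"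
        using \<eta> by (subst ln_le_cancel_iff) auto
      also have "\<dots> = real n * ln (1 + \<eta>) - k * ln \<eta>"
        using \<eta> by (simp add: ln_div ln_realpow)
      also have "\<dots> \<le> real n * \<eta> - k * ln \<eta>"
        using mult_left_mono[OF ln_add_one_self_le_self[of \<eta>], of "real n"] \<eta> by simp
      finally have "real n * (e n * ln 2) \<le> real n * (\<eta> + (- k * ln \<eta>) / real n)"
        using elim(2) by (simp add: ln_powr algebra_simps)
      hence "e n * ln 2 \<le> \<eta> + (- k * ln \<eta>) / real n"
        using elim(2) by (simp only: mult_le_cancel_left_pos of_nat_0_less_iff)
      moreover have e0: "e n \<ge> 0" using box_ratio_bounds[of w j n "s n"] nn by (simp add: e_def)
      hence "e n * (1 / 2) \<le> e n * ln 2" using ln2_ge_two_thirds by (intro mult_left_mono) auto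
      moreover have "(- 2 * k * ln \<eta>) / real n = 2 * ((- k * ln \<eta>) / real n)" by simp
      ultimately have "e n \<le> 2 * \<eta> + (- 2 * k * ln \<eta>) / real n" by linarith
      thus ?case using elim(1) \<eta> e0 \<epsilon> by (simp add: dist_real_def)
    qed
  qed
  thus ?thesis by (simp add: e_def)
qed

text \<open>For fixed \<open>n\<close> and \<open>s\<close> the ratios are the law of the content of
  one box, whose mean is \<open>s / n\<close> by symmetry.\<close>

lemma box_ratio_sum:
  fixes w :: "nat \<Rightarrow> real"
  assumes "(Abs_fps w ^ n) $ s > 0" "n > 0"
  shows "(\<Sum>d\<le>s. w d * (Abs_fps w ^ (n - 1)) $ (s - d) / (Abs_fps w ^ n) $ s) = 1"
    and "(\<Sum>d\<le>s. real d * (w d * (Abs_fps w ^ (n - 1)) $ (s - d) / (Abs_fps w ^ n) $ s)) = real s / real n"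
proof -
  obtain m where m: "n = Suc m" using assms(2) by (cases n) auto
  define x where "x = (Abs_fps w ^ n) $ s"
  have x: "x > 0" using assms(1) by (simp add: x_def)
  have 1: "(\<Sum>d\<le>s. w d * (Abs_fps w ^ (n - 1)) $ (s - d)) = x"
    unfolding x_def m fps_power_Suc_nth by simp
  have 2: "real n * (\<Sum>d\<le>s. real d * w d * (Abs_fps w ^ (n - 1)) $ (s - d)) = real s * x"
    using fps_power_Suc_nth_size_biased[of m w s] unfolding x_def m diff_Suc_1 .
  have "(\<Sum>d\<le>s. w d * (Abs_fps w ^ (n - 1)) $ (s - d) / x) = 1"
    unfolding sum_divide_distrib[symmetric] 1 using x by simp
  thus "(\<Sum>d\<le>s. w d * (Abs_fps w ^ (n - 1)) $ (s - d) / (Abs_fps w ^ n) $ s) = 1"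
    unfolding x_def .
  have "(\<Sum>d\<le>s. real d * (w d * (Abs_fps w ^ (n - 1)) $ (s - d) / x)) = real s / real n"
    unfolding times_divide_eq_right mult.assoc[symmetric] sum_divide_distrib[symmetric]
    using 2 x assms(2) by (simp add: field_simps)
  thus "(\<Sum>d\<le>s. real d * (w d * (Abs_fps w ^ (n - 1)) $ (s - d) / (Abs_fps w ^ n) $ s)) = real s / real n"
    unfolding x_def .
qed

text \<open>The mean content is at most 1, so contents above \<open>K\<close> have mass at most
  \<open>1 / K\<close>; those between 1 and \<open>K\<close> lose their mass in the limit, and only
  the empty box remains.\<close>

lemma box_ratio_0_tendsto_1:
  fixes w :: "nat \<Rightarrow> real" and s :: "nat \<Rightarrow> nat"
  assumes nn: "\<And>k. w k \<ge> 0" and w0: "w 0 > 0" and R: "conv_radius w = 0"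
    and F: "F \<le> sequentially" and sn: "\<And>n. s n \<le> n" and s: "filterlim s at_top F"
    and pos: "eventually (\<lambda>n. (Abs_fps w ^ n) $ s n > 0) F"
  shows "((\<lambda>n. w 0 * (Abs_fps w ^ (n - 1)) $ s n / (Abs_fps w ^ n) $ s n) \<longlongrightarrow> 1) F"
proof -
  define e where "e = (\<lambda>j n. w j * (Abs_fps w ^ (n - 1)) $ (s n - j) / (Abs_fps w ^ n) $ s n)"
  have e_nn: "e j n \<ge> 0" for j n
    using box_ratio_bounds[of w j n "s n"] nn by (simp add: e_def)
  have large: "eventually (\<lambda>n. j \<le> s n) F" for j
    using s by (simp add: filterlim_at_top)
  have e: "(e j \<longlongrightarrow> 0) F" if "j \<ge> 1" for j
    unfolding e_def using box_ratio_tendsto_0[OF nn w0 R that F large pos] .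
  have "(e 0 \<longlongrightarrow> 1) F"
  proof (rule tendstoI)
    fix \<epsilon> :: real assume \<epsilon>: "\<epsilon> > 0"
    obtain K where K: "K > 0" "1 / real K < \<epsilon> / 2"
      using \<epsilon> real_arch_inverse[of "\<epsilon> / 2"] by (auto simp: inverse_eq_divide)
    have "((\<lambda>n. \<Sum>j=1..K. e j n) \<longlongrightarrow> (\<Sum>j=1..K. 0)) F"
      using e by (intro tendsto_sum) auto
    hence "eventually (\<lambda>n. (\<Sum>j=1..K. e j n) < \<epsilon> / 2) F"
      using \<epsilon> by (intro order_tendstoD(2)[of _ 0]) auto
    moreover have "eventually (\<lambda>n. n > 0) F"
      using F eventually_gt_at_top[of 0] by (rule filter_leD)
    ultimately show "eventually (\<lambda>n. dist (e 0 n) 1 < \<epsilon>) F" using large[of K] pos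
    proof eventually_elim
      case (elim n)
      have 1: "(\<Sum>j\<le>s n. e j n) = 1" "(\<Sum>j\<le>s n. real j * e j n) = real (s n) / real n"
        using box_ratio_sum[OF elim(4,2)] by (auto simp: e_def)
      have s1: "real (s n) / real n \<le> 1" using sn[of n] elim(2) by simp
      have "{..s n} = insert 0 {1..K} \<union> {Suc K..s n}" using elim(3) by auto
      hence "1 = (\<Sum>j\<in>insert 0 {1..K}. e j n) + (\<Sum>j=Suc K..s n. e j n)"
        unfolding 1(1)[symmetric] by (simp only:) (rule sum.union_disjoint, auto)
      also have "(\<Sum>j\<in>insert 0 {1..K}. e j n) = e 0 n + (\<Sum>j=1..K. e j n)" by simp
      also have "(\<Sum>j=Suc K..s n. e j n) \<le> 1 / real K"
      proof -
        have "real K * (\<Sum>j=Suc K..s n. e j n) \<le> (\<Sum>j=Suc K..s n. real j * e j n)"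
          unfolding sum_distrib_left using e_nn by (intro sum_mono mult_right_mono) auto
        also have "\<dots> \<le> (\<Sum>j\<le>s n. real j * e j n)"
          using e_nn by (intro sum_mono2) auto
        also have "\<dots> \<le> 1" using 1(2) s1 by simp
        finally show ?thesis using K by (simp add: field_simps)
      qed
      finally have "1 - \<epsilon> < e 0 n" using elim(1) K by linarith
      moreover have "e 0 n \<le> 1"
        unfolding 1(1)[symmetric] using e_nn by (intro member_le_sum) auto
      ultimately show ?case by (simp add: dist_real_def)
    qed
  qed
  thus ?thesis by (simp add: e_def)
qed

section \<open>Exponential growth of the number of trees\<close>

text \<open>Adding \<open>M\<close> to the argument does not decrease \<open>f\<close>, so every
  positive value dominates the first positive value in its residue class modulo \<open>M\<close>,
  and there are finitely many classes.\<close>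

lemma supermultiplicative_lower_bound:
  fixes f :: "nat \<Rightarrow> real"
  assumes nn: "\<And>n. f n \<ge> 0" and super: "\<And>a b. f a * f b \<le> f (a + b)" and M: "M > 0" "f M \<ge> 1"
  shows "\<exists>c>0. \<forall>n. f n > 0 \<longrightarrow> c \<le> f n"
proof -
  have step: "f n \<le> f (n + j * M)" for n j
  proof (induction j)
    case (Suc j)
    have "f n * 1 \<le> f (n + j * M) * f M"
      using Suc M nn by (intro mult_mono) auto
    also have "\<dots> \<le> f (n + j * M + M)" by (rule super)
    finally show ?case by (simp add: algebra_simps)
  qed simp
  define R where "R = {r. r < M \<and> (\<exists>n. n mod M = r \<and> f n > 0)}"
  define n0 where "n0 = (\<lambda>r. LEAST n. n mod M = r \<and> f n > 0)"
  have n0: "n0 r mod M = r \<and> f (n0 r) > 0" if "r \<in> R" for r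
    unfolding n0_def by (rule LeastI_ex) (use that in \<open>auto simp: R_def\<close>)
  have R: "finite R" by (simp add: R_def)
  define c where "c = Min (insert 1 ((\<lambda>r. f (n0 r)) ` R))"
  have "c > 0" unfolding c_def using R n0 by (subst Min_gr_iff) auto
  moreover have "c \<le> f n" if n: "f n > 0" for n
  proof -
    have r: "n mod M \<in> R" using n M by (auto simp: R_def)
    have "n0 (n mod M) \<le> n" unfolding n0_def by (rule Least_le) (use n in auto)
    moreover have "n0 (n mod M) mod M = n mod M" using n0[OF r] by simp
    ultimately have "M dvd n - n0 (n mod M)" by (metis mod_eq_dvd_iff_nat)
    then obtain j where "n - n0 (n mod M) = M * j" by (rule dvdE)
    hence "n = n0 (n mod M) + j * M" using \<open>n0 (n mod M) \<le> n\<close> by (simp add: mult.commute)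
    hence "f (n0 (n mod M)) \<le> f n" using step[of "n0 (n mod M)" j] by simp
    moreover have "c \<le> f (n0 (n mod M))" unfolding c_def using R r by (intro Min_le) auto
    ultimately show ?thesis by simp
  qed
  ultimately show ?thesis by blast
qed

locale weights =
  fixes w :: "nat \<Rightarrow> real"
  assumes ws: "weight_sequence w"
begin

abbreviation "\<Phi> \<equiv> Abs_fps w"
abbreviation "A \<equiv> tree_fps w"
abbreviation "y \<equiv> tree_fps w 0"

lemma w_nonneg: "w k \<ge> 0" and w0_pos: "w 0 > 0"
  using ws by (auto simp: weight_sequence_def)

lemma tree_weight_nonneg: "tree_weight w T \<ge> 0"
  unfolding tree_weight_def using w_nonneg by (intro prod_nonneg) auto

lemma A_nonneg: "0 \<preceq> A k"
  using tree_weight_nonneg by (auto simp: fps_le_def tree_fps_def intro!: sum_nonneg)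

lemma \<Phi>_power_nonneg: "(\<Phi> ^ n) $ s \<ge> 0"
  using fps_leD[OF fps_nonneg_power[OF fps_nonneg_Abs[of w]]] w_nonneg by simp

lemma y_power_nonneg: "(y ^ r) $ n \<ge> 0"
  using fps_leD[OF fps_nonneg_power[OF A_nonneg]] by simp

lemma y_1: "y $ 1 = w 0"
  using tree_fps_Suc(1)[of w 0] by simp

lemma lagrange:
  assumes "1 \<le> r" "r \<le> n"
  shows "real n * (y ^ r) $ n = real r * (\<Phi> ^ n) $ (n - r)"
  using lagrange_inversion[OF tree_fps_0 tree_fps_Suc(1) assms] .

text \<open>
  The weights can be tilted at \<open>t\<close> to a probability distribution which is critical (\<open>V = w 0\<close>),
  or subcritical with \<open>t\<close> being the radius of convergence.
\<close>

definition tilt :: "real \<Rightarrow> real \<Rightarrow> bool" where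
  "tilt t \<phi> \<longleftrightarrow> t > 0 \<and> (\<lambda>k. w k * t ^ k) sums \<phi> \<and>
     (\<exists>V. (\<lambda>k. real (k - 1) * w k * t ^ k) sums V \<and>
       (V = w 0 \<or> V \<le> w 0 \<and> (\<forall>Y>t. \<not> summable (\<lambda>k. w k * Y ^ k))))"

lemma tilt_pos: "tilt t \<phi> \<Longrightarrow> \<phi> > 0"
  using suminf_pos2[of "\<lambda>k. w k * t ^ k" 0] w0_pos w_nonneg by (auto simp: tilt_def sums_iff)

text \<open>The tilt point minimises \<open>z \<mapsto> \<Phi>(z) / z\<close>. A tangent bound gives
  \<open>M \<ge> q * \<phi> + (q - 1) * (V - w 0)\<close> with \<open>q = Y / t\<close>; the
  correction vanishes in the critical case, and is a product of two nonpositive factors when the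
  series diverges beyond \<open>t\<close>.\<close>

lemma tilt_min:
  assumes tilt: "tilt t \<phi>" and Y: "Y > 0" and M: "(\<lambda>k. w k * Y ^ k) sums M"
  shows "\<phi> * Y \<le> M * t"
proof -
  obtain V where t: "t > 0" "(\<lambda>k. w k * t ^ k) sums \<phi>" "(\<lambda>k. real (k - 1) * w k * t ^ k) sums V"
    and V: "V = w 0 \<or> V \<le> w 0 \<and> (\<forall>Y>t. \<not> summable (\<lambda>k. w k * Y ^ k))"
    using tilt by (auto simp: tilt_def)
  define q where "q = Y / t"
  have q: "q > 0" using Y t by (simp add: q_def)
  \<comment> \<open>Truncated subtraction gives 0 instead of -1 at \<open>k = 0\<close>; subtracting
    \<open>w 0\<close> there restores the true factor \<open>real k - 1\<close>.\<close>
  have "(\<lambda>k. real (k - 1) * w k * t ^ k - (if k = 0 then w 0 else 0)) sums (V - w 0)"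
    using t(3) sums_single[of 0 "\<lambda>_. w 0"] by (intro sums_diff) auto
  also have "(\<lambda>k. real (k - 1) * w k * t ^ k - (if k = 0 then w 0 else 0)) =
      (\<lambda>k. (real k - 1) * (w k * t ^ k))"
    by (auto simp: of_nat_diff)
  finally have lower: "(\<lambda>k. q * (w k * t ^ k) + (q - 1) * ((real k - 1) * (w k * t ^ k))) sums
      (q * \<phi> + (q - 1) * (V - w 0))"
    using t(2) by (intro sums_add sums_mult)
  have "q * (w k * t ^ k) + (q - 1) * ((real k - 1) * (w k * t ^ k)) \<le> w k * Y ^ k" for k
  proof -
    \<comment> \<open>The left side is \<open>q + (q - 1) * (real k - 1)\<close>, the factor in the
      sum to be bounded.\<close>
    have "1 + real k * (q - 1) \<le> (1 + (q - 1)) ^ k"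
      using q by (intro Bernoulli_inequality) auto
    hence "w k * t ^ k * (1 + real k * (q - 1)) \<le> w k * t ^ k * q ^ k"
      using w_nonneg[of k] t by (intro mult_left_mono) auto
    also have "\<dots> = w k * Y ^ k"
      using t by (simp add: q_def power_divide)
    finally show ?thesis by (simp add: algebra_simps)
  qed
  hence "q * \<phi> + (q - 1) * (V - w 0) \<le> M" using lower M by (rule sums_le)
  moreover have "(q - 1) * (V - w 0) \<ge> 0"
  proof (cases "V = w 0")
    case False
    hence "Y \<le> t" "V \<le> w 0" using V M by (auto simp: sums_iff not_less[symmetric])
    thus ?thesis using t by (intro mult_nonpos_nonpos) (auto simp: q_def)
  qed simp
  ultimately have "q * \<phi> \<le> M" by linarith
  thus ?thesis using t by (simp add: q_def field_simps)
qed

lemma type_fun_sums: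
  assumes "t > 0" "type_fun w t < \<infinity>"
  obtains V where "(\<lambda>k. real (k - 1) * w k * t ^ k) sums V" "type_fun w t = ennreal V" "V \<ge> 0"
proof -
  let ?f = "\<lambda>k. real (k - 1) * w k * t ^ k"
  have nn: "?f k \<ge> 0" for k using w_nonneg assms by simp
  have s: "summable ?f"
    using assms nn unfolding type_fun_def by (intro summable_suminf_not_top) auto
  show ?thesis
    using that[of "suminf ?f"] s suminf_ennreal2[OF nn s] suminf_nonneg[OF s nn]
    unfolding type_fun_def by auto
qed

text \<open>Types I and II become one case: the tilt is critical in type I and sits at the radius of
  convergence in type II.\<close>

lemma offspring_cases:
  obtains (tilted) t \<phi> where "tilt t \<phi>" "\<And>k. pmf (offspring_pmf w) k = w k * t ^ k / \<phi>"
  | (trivial) "conv_radius w = 0" "offspring_pmf w = return_pmf 0"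
proof -
  consider t where "type_I_at w t" | t where "type_II_at w t" | "type_III w"
    using weight_sequence_types(1)[OF ws] by blast
  thus ?thesis
  proof cases
    case (1 t)
    hence t: "t > 0" "gen_fun w t < \<infinity>" "type_fun w t = ennreal (w 0)"
      using type_I_at_iff[OF ws] by (auto simp: type_I_at_def)
    note g = gen_fun_real[OF ws t(1,2)]
    have "type_fun w t < \<infinity>" using t(3) by simp
    then obtain V where V: "(\<lambda>k. real (k - 1) * w k * t ^ k) sums V" "type_fun w t = ennreal V" "V \<ge> 0"
      using type_fun_sums[OF t(1)] by metis
    hence "V = w 0" using t(3) w0_pos by simp
    hence "tilt t (\<Sum>k. w k * t ^ k)"
      using t g V by (auto simp: tilt_def summable_sums)
    moreover have "pmf (offspring_pmf w) k = w k * t ^ k / (\<Sum>k. w k * t ^ k)" for k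
      using offspring_pmf_type_I[OF ws 1, of k] g by simp
    ultimately show ?thesis by (rule tilted)
  next
    case (2 t)
    hence t: "t > 0" "gen_fun w t < \<infinity>" "type_fun w t < ennreal (w 0)" "conv_radius w = ereal t"
      using type_II_at_iff[OF ws] by (auto simp: type_II_at_def)
    note g = gen_fun_real[OF ws t(1,2)]
    have "type_fun w t < \<infinity>" using t(3) by (simp add: order_less_trans[OF _ ennreal_less_top])
    then obtain V where V: "(\<lambda>k. real (k - 1) * w k * t ^ k) sums V" "type_fun w t = ennreal V" "V \<ge> 0"
      using type_fun_sums[OF t(1)] by metis
    hence "V \<le> w 0" using t(3) by (simp add: ennreal_less_iff)
    moreover have "\<not> summable (\<lambda>k. w k * Y ^ k)" if "Y > t" for Y
      using conv_radius_geI[of w Y] that t by auto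
    ultimately have "tilt t (\<Sum>k. w k * t ^ k)"
      using t g V by (auto simp: tilt_def summable_sums)
    moreover have "pmf (offspring_pmf w) k = w k * t ^ k / (\<Sum>k. w k * t ^ k)" for k
      using offspring_pmf_type_II[OF ws 2, of k] g by simp
    ultimately show ?thesis by (rule tilted)
  next
    case 3
    thus ?thesis using offspring_pmf_type_III[OF ws 3] trivial by (simp add: type_III_def)
  qed
qed

text \<open>If \<open>y\<close> converged at some \<open>z > t / \<phi>\<close>, with value
  \<open>Y\<close>, then \<open>y = z \<Phi>(y)\<close> would give
  \<open>\<Phi>(Y) / Y \<le> 1 / z < \<phi> / t\<close>, below the minimum from
  \<open>tilt_min\<close>.\<close>

lemma y_conv_radius_le:
  assumes tilt: "tilt t \<phi>"
  shows "fps_conv_radius y \<le> ereal (t / \<phi>)"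
proof (rule ccontr)
  assume "\<not> ?thesis"
  hence "ereal (t / \<phi>) < fps_conv_radius y" by (simp only: not_le)
  then obtain z where "ereal (t / \<phi>) < ereal z" "ereal z < fps_conv_radius y"
    using ereal_dense2 by blast
  hence z: "t / \<phi> < z" "ereal z < fps_conv_radius y" by simp_all
  have t: "t > 0" "\<phi> > 0" using tilt tilt_pos by (auto simp: tilt_def)
  hence "0 < t / \<phi>" by simp
  hence z0: "z > 0" using z(1) by linarith
  define Y where "Y = eval_fps y z"
  have ev: "(\<lambda>n. (y ^ d) $ n * z ^ n) sums (Y ^ d)" for d
  proof -
    have "fps_conv_radius (y ^ d) > ereal z"
      using z(2) fps_conv_radius_power[of y d] by (rule less_le_trans)
    hence "(\<lambda>n. (y ^ d) $ n * z ^ n) sums eval_fps (y ^ d) z"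
      using z0 by (intro sums_eval_fps) auto
    thus ?thesis using z z0 by (simp add: eval_fps_power Y_def)
  qed
  have y_sums: "(\<lambda>n. y $ n * z ^ n) sums Y" using ev[of 1] by simp
  have Y: "Y > 0"
    using y_sums suminf_pos2[of "\<lambda>n. y $ n * z ^ n" 1] y_1 w0_pos z0 y_power_nonneg[of 1]
    by (auto simp: sums_iff)
  \<comment> \<open>Truncating at \<open>D\<close> permits a termwise comparison with
    \<open>y\<close>, without exchanging two infinite sums.\<close>
  have partial: "(\<Sum>d<D. w d * Y ^ d) \<le> Y / z" for D
  proof -
    have "(\<lambda>n. (\<Sum>d<D. w d * ((y ^ d) $ n * z ^ n)) * z) sums ((\<Sum>d<D. w d * Y ^ d) * z)"
      by (intro sums_mult2 sums_sum sums_mult ev)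
    moreover have "(\<lambda>n. y $ Suc n * z ^ Suc n) sums Y"
      using y_sums by (subst sums_Suc_iff) simp
    moreover have "(\<Sum>d<D. w d * ((y ^ d) $ n * z ^ n)) * z \<le> y $ Suc n * z ^ Suc n" for n
    proof -
      have "(\<Sum>d<D. w d * (y ^ d) $ n) \<le> (\<Sum>d\<in>{..<D} \<union> {..n}. w d * (y ^ d) $ n)"
        using w_nonneg y_power_nonneg by (intro sum_mono2) auto
      also have "\<dots> = (\<Sum>d\<le>n. w d * (y ^ d) $ n)"
        using fps_power_nth_eq_0[of y n] by (intro sum.mono_neutral_right) auto
      also have "\<dots> = y $ Suc n" by (simp add: tree_fps_Suc(1))
      finally have "(\<Sum>d<D. w d * (y ^ d) $ n) * z ^ Suc n \<le> y $ Suc n * z ^ Suc n"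
        using z0 by (intro mult_right_mono) auto
      moreover have "(\<Sum>d<D. w d * ((y ^ d) $ n * z ^ n)) * z = (\<Sum>d<D. w d * (y ^ d) $ n) * z ^ Suc n"
        by (simp add: sum_distrib_left sum_distrib_right mult_ac)
      ultimately show ?thesis by (simp only:)
    qed
    ultimately have "(\<Sum>d<D. w d * Y ^ d) * z \<le> Y" by (meson sums_le)
    thus ?thesis using z0 by (simp add: field_simps)
  qed
  have "summable (\<lambda>d. w d * Y ^ d)"
    using partial w_nonneg Y by (intro summableI_nonneg_bounded[of _ "Y / z"]) auto
  moreover from this have "(\<Sum>d. w d * Y ^ d) \<le> Y / z"
    using partial by (intro suminf_le_const)
  ultimately have "\<phi> * Y \<le> (Y / z) * t"
    using tilt_min[OF tilt Y] t by (meson summable_sums order_trans mult_right_mono less_imp_le)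
  hence "Y * \<phi> \<le> Y * (t / z)" by (simp add: mult_ac)
  hence "\<phi> \<le> t / z" using Y by (simp only: mult_le_cancel_left_pos)
  thus False using z(1) z0 t by (simp add: field_simps)
qed

text \<open>A root of degree \<open>d\<close> carries two arbitrary trees and \<open>d - 2\<close>
  single vertices of weight \<open>w 0\<close>.\<close>

lemma y_supermultiplicative:
  assumes d: "d \<ge> 2"
  shows "w d * w 0 ^ (d - 2) * (y $ a * y $ b) \<le> y $ (a + b + (d - 1))"
proof (cases "a = 0 \<or> b = 0")
  case True
  thus ?thesis using y_power_nonneg[of 1] by auto
next
  case False
  define n where "n = a + b + (d - 2)"
  have Sn: "a + b + (d - 1) = Suc n" using d by (simp add: n_def)
  have "w 0 ^ (d - 2) \<le> (y ^ (d - 2)) $ (d - 2)"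
    using fps_power_nth_ge[OF A_nonneg[of 0], of 1 "d - 2"] y_1 by simp
  hence "(y $ a * y $ b) * w 0 ^ (d - 2) \<le> (y * y) $ (a + b) * (y ^ (d - 2)) $ (d - 2)"
    using A_nonneg y_power_nonneg[of 1] w0_pos fps_nonneg_mult
    by (intro mult_mono fps_mult_nth_ge) (auto simp: fps_le_def)
  also have "\<dots> \<le> (y * y * y ^ (d - 2)) $ n"
    unfolding n_def by (intro fps_mult_nth_ge fps_nonneg_mult fps_nonneg_power A_nonneg)
  also have "y * y * y ^ (d - 2) = y ^ d"
    using d by (metis le_add_diff_inverse power2_eq_square power_add)
  finally have "w d * ((y $ a * y $ b) * w 0 ^ (d - 2)) \<le> w d * (y ^ d) $ n"
    using w_nonneg by (intro mult_left_mono)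
  also have "\<dots> \<le> (\<Sum>d\<le>n. w d * (y ^ d) $ n)"
    using False d w_nonneg y_power_nonneg by (intro member_le_sum) (auto simp: n_def)
  also have "\<dots> = y $ Suc n" by (simp add: tree_fps_Suc(1))
  finally show ?thesis unfolding Sn by (simp add: mult_ac)
qed

text \<open>By \<open>y_conv_radius_le\<close> the sequence \<open>y $ n * \<theta> ^ n\<close> is
  unbounded, so a rescaled version reaches 1, and supermultiplicativity keeps its positive values
  away from 0.\<close>

lemma y_lower_bound:
  assumes tilt: "tilt t \<phi>" and \<theta>: "\<theta> > t / \<phi>"
  obtains c where "c > 0" "\<And>n. y $ n > 0 \<Longrightarrow> c \<le> y $ n * \<theta> ^ n"
proof -
  have t: "t > 0" "\<phi> > 0" using tilt tilt_pos by (auto simp: tilt_def)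
  hence "0 < t / \<phi>" by simp
  hence \<theta>0: "\<theta> > 0" using \<theta> by linarith
  have y_nn: "y $ n \<ge> 0" for n using y_power_nonneg[of 1] by simp
  obtain d where d: "d \<ge> 2" "w d > 0" using ws by (auto simp: weight_sequence_def)
  define m where "m = d - 1"
  define \<kappa> where "\<kappa> = w d * w 0 ^ (d - 2)"
  have m: "m > 0" using d by (simp add: m_def)
  have \<kappa>: "\<kappa> > 0" using d w0_pos by (simp add: \<kappa>_def)
  \<comment> \<open>The shift by \<open>m\<close> accounts for the \<open>d - 1\<close> vertices
    added in \<open>y_supermultiplicative\<close>, the factor \<open>\<kappa>\<close> for their
    weights. For \<open>n \<le> m\<close> the value is 0, because \<open>y $ 0 = 0\<close>.\<close>
  define f where "f = (\<lambda>n. \<kappa> * y $ (n - m) * \<theta> ^ n)"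
  have f_nn: "f n \<ge> 0" for n using \<kappa> \<theta>0 y_nn by (simp add: f_def)
  have super: "f a * f b \<le> f (a + b)" for a b
  proof (cases "a \<le> m \<or> b \<le> m")
    case True
    hence "f a * f b = 0" by (auto simp: f_def)
    thus ?thesis using f_nn[of "a + b"] by linarith
  next
    case False
    hence "a - m + (b - m) + m = a + b - m" by simp
    hence "\<kappa> * (y $ (a - m) * y $ (b - m)) \<le> y $ (a + b - m)"
      using y_supermultiplicative[OF d(1), of "a - m" "b - m"] by (simp add: \<kappa>_def m_def)
    hence "\<kappa> * (y $ (a - m) * y $ (b - m)) * (\<kappa> * \<theta> ^ (a + b)) \<le> y $ (a + b - m) * (\<kappa> * \<theta> ^ (a + b))"
      using \<kappa> \<theta>0 by (intro mult_right_mono) auto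
    thus ?thesis by (simp add: f_def power_add mult_ac)
  qed
  have "\<exists>n. y $ n * \<theta> ^ n \<ge> 1 / (\<kappa> * \<theta> ^ m)"
  proof (rule ccontr)
    assume "\<not> ?thesis"
    hence bd: "y $ n * \<theta> ^ n \<le> 1 / (\<kappa> * \<theta> ^ m)" for n by (meson less_imp_le not_le)
    obtain z where z: "t / \<phi> < z" "z < \<theta>" using \<theta> dense by blast
    have "0 < t / \<phi>" using t by simp
    hence z0: "z > 0" using z(1) by linarith
    have "summable (\<lambda>n. y $ n * z ^ n)"
    proof (rule summable_comparison_test)
      show "summable (\<lambda>n. 1 / (\<kappa> * \<theta> ^ m) * (z / \<theta>) ^ n)"
        using z z0 \<theta>0 by (intro summable_mult summable_geometric) auto
      have "norm (y $ n * z ^ n) \<le> 1 / (\<kappa> * \<theta> ^ m) * (z / \<theta>) ^ n" for n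
      proof -
        have "norm (y $ n * z ^ n) = (y $ n * \<theta> ^ n) * (z / \<theta>) ^ n"
          using y_nn z0 \<theta>0 by (simp add: power_divide)
        also have "\<dots> \<le> 1 / (\<kappa> * \<theta> ^ m) * (z / \<theta>) ^ n"
          using z0 \<theta>0 by (intro mult_right_mono bd) auto
        finally show ?thesis .
      qed
      thus "\<exists>N. \<forall>n\<ge>N. norm (y $ n * z ^ n) \<le> 1 / (\<kappa> * \<theta> ^ m) * (z / \<theta>) ^ n" by blast
    qed
    from conv_radius_geI[OF this] have "ereal z \<le> fps_conv_radius y"
      using z0 by (simp add: fps_conv_radius_def)
    hence "ereal z \<le> ereal (t / \<phi>)" using y_conv_radius_le[OF tilt] by (rule order_trans)
    thus False using z by simp
  qed
  then obtain N where N: "y $ N * \<theta> ^ N \<ge> 1 / (\<kappa> * \<theta> ^ m)" by blast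
  have "f (N + m) = \<kappa> * \<theta> ^ m * (y $ N * \<theta> ^ N)" by (simp add: f_def power_add mult_ac)
  also have "\<dots> \<ge> \<kappa> * \<theta> ^ m * (1 / (\<kappa> * \<theta> ^ m))"
    using N \<kappa> \<theta>0 by (intro mult_left_mono) auto
  finally have "f (N + m) \<ge> 1" using \<kappa> \<theta>0 by simp
  then obtain c where c: "c > 0" "\<And>n. f n > 0 \<Longrightarrow> c \<le> f n"
    using supermultiplicative_lower_bound[OF f_nn super, of "N + m"] m by auto
  show ?thesis
  proof (rule that[of "c / (\<kappa> * \<theta> ^ m)"])
    show "c / (\<kappa> * \<theta> ^ m) > 0" using c \<kappa> \<theta>0 by simp
    fix n assume "y $ n > 0"
    hence "f (n + m) > 0" using \<kappa> \<theta>0 by (simp add: f_def)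
    hence "c \<le> \<kappa> * \<theta> ^ m * (y $ n * \<theta> ^ n)"
      using c(2)[of "n + m"] by (simp add: f_def power_add mult_ac)
    thus "c / (\<kappa> * \<theta> ^ m) \<le> y $ n * \<theta> ^ n" using \<kappa> \<theta>0 by (simp add: field_simps)
  qed
qed

text \<open>The mean content \<open>s / (n + 1)\<close> of a box is less than 1, so by symmetry some
  configuration of positive weight leaves the first box empty.\<close>

lemma box_remove_empty:
  assumes "(\<Phi> ^ Suc n) $ s > 0" "s \<le> n"
  shows "(\<Phi> ^ n) $ s > 0"
proof -
  let ?x = "(\<Phi> ^ Suc n) $ s"
  have "(\<Sum>d\<le>s. (1 - real d) * (w d * (\<Phi> ^ n) $ (s - d))) = ?x - real s * ?x / real (Suc n)"
    using fps_power_Suc_nth_size_biased[of n w s] unfolding fps_power_Suc_nth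
    by (simp add: left_diff_distrib sum_subtractf mult.assoc field_simps del: of_nat_Suc)
  also have "\<dots> > 0" using assms by (simp add: field_simps del: power_Suc of_nat_Suc)
  finally have pos: "0 < (\<Sum>d\<le>s. (1 - real d) * (w d * (\<Phi> ^ n) $ (s - d)))" .
  have "(\<Sum>d\<le>s. (1 - real d) * (w d * (\<Phi> ^ n) $ (s - d))) \<le> (\<Sum>d\<le>s. if d = 0 then w 0 * (\<Phi> ^ n) $ s else 0)"
    using w_nonneg \<Phi>_power_nonneg
    by (intro sum_mono) (auto intro!: mult_nonpos_nonneg mult_nonneg_nonneg)
  also have "\<dots> = w 0 * (\<Phi> ^ n) $ s" by simp
  finally have "0 < w 0 * (\<Phi> ^ n) $ s" using pos by linarith
  thus ?thesis using w0_pos by (simp add: zero_less_mult_iff)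
qed

text \<open>By Lagrange inversion these are, for \<open>r \<ge> 1\<close>, the \<open>n\<close> for
  which some forest of \<open>r\<close> trees with \<open>n\<close> vertices has positive
  weight.\<close>

definition forest_filter :: "nat \<Rightarrow> nat filter" where
  "forest_filter r = inf sequentially (principal {n. r \<le> n \<and> (\<Phi> ^ n) $ (n - r) > 0})"

lemma forest_filter_le: "forest_filter r \<le> sequentially"
  by (simp add: forest_filter_def)

lemma eventually_forest_filter:
  "eventually P (forest_filter r) \<longleftrightarrow>
     eventually (\<lambda>n. r \<le> n \<longrightarrow> (\<Phi> ^ n) $ (n - r) > 0 \<longrightarrow> P n) sequentially"
  by (simp add: forest_filter_def eventually_inf_principal imp_conjL)

lemma eventually_forest_filterI: "eventually P sequentially \<Longrightarrow> eventually P (forest_filter r)"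
  by (rule filter_leD[OF forest_filter_le])

lemma eventually_forest_filter_pos: "eventually (\<lambda>n. r \<le> n \<and> (\<Phi> ^ n) $ (n - r) > 0) (forest_filter r)"
  unfolding eventually_forest_filter by simp

text \<open>Removing \<open>r - 1\<close> empty boxes leaves \<open>N = n - r + 1\<close> boxes with
  \<open>N - 1\<close> balls, of weight \<open>N\<close> times \<open>y $ N\<close>. There
  \<open>y_lower_bound\<close> applies, and putting the empty boxes back brings the constant factor
  \<open>w 0 ^ (r - 1)\<close>.\<close>

lemma forest_weight_lower_bound:
  assumes tilt: "tilt t \<phi>" and r: "r \<ge> 1" and \<epsilon>: "\<epsilon> > 0"
  shows "eventually (\<lambda>n. (\<Phi> ^ n) $ (n - r) * t ^ (n - r) \<ge> \<phi> ^ n * exp (- \<epsilon> * real n)) (forest_filter r)"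
proof -
  have t: "t > 0" "\<phi> > 0" using tilt tilt_pos by (auto simp: tilt_def)
  define \<theta> where "\<theta> = t / \<phi> * exp (\<epsilon> / 2)"
  have "t / \<phi> * 1 < t / \<phi> * exp (\<epsilon> / 2)"
    using t \<epsilon> by (intro mult_strict_left_mono) auto
  hence \<theta>: "\<theta> > t / \<phi>" "\<theta> > 0" using t by (simp_all add: \<theta>_def)
  obtain c where c: "c > 0" "\<And>n. y $ n > 0 \<Longrightarrow> c \<le> y $ n * \<theta> ^ n"
    using y_lower_bound[OF tilt \<theta>(1)] by blast
  have x_ge: "w 0 ^ (r - 1) * (c / \<theta> ^ (n - r + 1)) \<le> (\<Phi> ^ n) $ (n - r)"
    if n: "r \<le> n" "(\<Phi> ^ n) $ (n - r) > 0" for n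
  proof -
    define N where "N = n - r + 1"
    have pos: "(\<Phi> ^ (n - j)) $ (n - r) > 0" if "j < r" for j
      using that
    proof (induction j)
      case (Suc j)
      have e: "n - j = Suc (n - Suc j)" and le: "n - r \<le> n - Suc j"
        using Suc.prems n(1) by arith+
      have "(\<Phi> ^ (n - j)) $ (n - r) > 0" using Suc.prems by (intro Suc.IH) simp
      thus ?case unfolding e by (rule box_remove_empty[OF _ le])
    qed (use n in simp)
    have "n - (r - 1) = N" using r n by (simp add: N_def)
    hence posN: "(\<Phi> ^ N) $ (N - 1) > 0" using pos[of "r - 1"] r by (simp add: N_def)
    have lag: "real N * y $ N = (\<Phi> ^ N) $ (N - 1)"
      using lagrange[of 1 N] by (simp add: N_def)
    hence "y $ N > 0" using posN using lag y_power_nonneg[of 1 N] by (cases "y $ N = 0") auto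
    hence "c \<le> y $ N * \<theta> ^ N" by (rule c)
    also have "\<dots> \<le> (real N * y $ N) * \<theta> ^ N"
      using \<open>y $ N > 0\<close> \<theta> by (intro mult_right_mono) (auto simp: N_def)
    finally have "c / \<theta> ^ N \<le> (\<Phi> ^ N) $ (N - 1)" using \<theta> lag by (simp add: field_simps)
    hence "w 0 ^ (r - 1) * (c / \<theta> ^ N) \<le> w 0 ^ (r - 1) * (\<Phi> ^ N) $ (N - 1)"
      using w0_pos by (intro mult_left_mono) auto
    hence "w 0 ^ (r - 1) * (c / \<theta> ^ N) \<le> (\<Phi> ^ (r - 1)) $ 0 * (\<Phi> ^ N) $ (N - 1)"
      by (simp only: fps_nth_power_0 fps_nth_Abs_fps)
    also have "\<dots> \<le> (\<Phi> ^ (r - 1) * \<Phi> ^ N) $ (0 + (N - 1))"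
      by (intro fps_mult_nth_ge fps_nonneg_power fps_nonneg_Abs w_nonneg)
    also have "\<Phi> ^ (r - 1) * \<Phi> ^ N = \<Phi> ^ n"
    proof -
      have "r - 1 + N = n" using n(1) r by (simp add: N_def)
      thus ?thesis by (simp only: power_add[symmetric])
    qed
    finally show ?thesis by (simp add: N_def)
  qed
  \<comment> \<open>All factors independent of \<open>n\<close>. One half of
    \<open>\<epsilon>\<close> has gone into \<open>\<theta>\<close>; the other half makes
    \<open>exp (- \<epsilon> / 2 * real n)\<close> fall below \<open>C\<close>.\<close>
  define C where "C = w 0 ^ (r - 1) * c * (\<phi> / t) / \<phi> ^ r * exp (\<epsilon> / 2) ^ (r - 1)"
  have C: "C > 0" using w0_pos c t by (simp add: C_def)
  have "((\<lambda>n. exp (- \<epsilon> / 2 * real n)) \<longlongrightarrow> 0) sequentially"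
    using \<epsilon> by real_asymp
  hence "eventually (\<lambda>n. exp (- \<epsilon> / 2 * real n) < C) sequentially"
    using C by (intro order_tendstoD(2)[of _ 0])
  thus ?thesis unfolding eventually_forest_filter
  proof eventually_elim
    case (elim n)
    show ?case
    proof (intro impI)
      assume n: "r \<le> n" "(\<Phi> ^ n) $ (n - r) > 0"
      have th: "\<theta> ^ (n - r + 1) * (\<phi> / t) = t ^ (n - r) / \<phi> ^ (n - r) * exp (\<epsilon> / 2) ^ (n - r + 1)"
        using t by (simp add: \<theta>_def power_mult_distrib power_divide)
      have "\<phi> ^ n * exp (- \<epsilon> * real n) = \<phi> ^ n * exp (- \<epsilon> / 2 * real n) * exp (- \<epsilon> / 2 * real n)"
        by (simp add: mult.assoc flip: exp_add)
      also have "\<dots> \<le> \<phi> ^ n * exp (- \<epsilon> / 2 * real n) * C"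
        using elim t by (intro mult_left_mono) auto
      also have "\<dots> = w 0 ^ (r - 1) * (c / \<theta> ^ (n - r + 1)) * t ^ (n - r)"
      proof -
        have "\<phi> ^ n = \<phi> ^ (n - r) * \<phi> ^ r" using n by (simp flip: power_add)
        moreover have "exp (- \<epsilon> / 2 * real n) = inverse (exp (\<epsilon> / 2) ^ (n - r + 1)) * inverse (exp (\<epsilon> / 2) ^ (r - 1))"
        proof -
          have "exp (- \<epsilon> / 2 * real n) = inverse (exp (\<epsilon> / 2) ^ n)"
            by (simp add: exp_minus flip: exp_of_nat2_mult)
          also have "exp (\<epsilon> / 2) ^ n = exp (\<epsilon> / 2) ^ (n - r + 1) * exp (\<epsilon> / 2) ^ (r - 1)"
          proof -
            have "n - r + 1 + (r - 1) = n" using n(1) r by simp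
            thus ?thesis by (simp only: power_add[symmetric])
          qed
          finally show ?thesis by (simp only: inverse_mult_distrib)
        qed
        moreover have "c / \<theta> ^ (n - r + 1) * t ^ (n - r) =
            c * (\<phi> / t) * \<phi> ^ (n - r) * inverse (exp (\<epsilon> / 2) ^ (n - r + 1))"
        proof -
          have "t ^ (n - r) = \<theta> ^ (n - r + 1) * (\<phi> / t) * \<phi> ^ (n - r) * inverse (exp (\<epsilon> / 2) ^ (n - r + 1))"
            unfolding th using t by (simp add: field_simps)
          thus ?thesis using \<theta> by simp
        qed
        moreover have "P * R * (inverse E * inverse E') * (w 0 ^ (r - 1) * c * (\<phi> / t) / R * E') =
            w 0 ^ (r - 1) * (c * (\<phi> / t) * P * inverse E)" if "R \<noteq> 0" "E' \<noteq> 0" for P R E E' :: real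
          using that by (simp add: field_simps)
        ultimately show ?thesis using t unfolding C_def mult.assoc[of "w 0 ^ (r - 1)" "c / _" "_ ^ _"]
          by simp
      qed
      also have "\<dots> \<le> (\<Phi> ^ n) $ (n - r) * t ^ (n - r)"
        using x_ge[OF n] t by (intro mult_right_mono) auto
      finally show "\<phi> ^ n * exp (- \<epsilon> * real n) \<le> (\<Phi> ^ n) $ (n - r) * t ^ (n - r)" .
    qed
  qed
qed

theorem box_ratio_tendsto:
  assumes r: "r \<ge> 1"
  shows "((\<lambda>n. w d * (\<Phi> ^ (n - 1)) $ (n - r - d) / (\<Phi> ^ n) $ (n - r)) \<longlongrightarrow> pmf (offspring_pmf w) d)
    (forest_filter r)"
proof -
  have top: "filterlim (\<lambda>n. n - r) at_top (forest_filter r)"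
    by (rule filterlim_mono[OF _ order_refl forest_filter_le]) real_asymp
  hence large: "eventually (\<lambda>n. d \<le> n - r) (forest_filter r)"
    by (simp add: filterlim_at_top)
  have pos: "eventually (\<lambda>n. (\<Phi> ^ n) $ (n - r) > 0) (forest_filter r)"
    using eventually_forest_filter_pos by (rule eventually_mono) auto
  show ?thesis
  proof (cases rule: offspring_cases)
    case (tilted t \<phi>)
    hence t: "t > 0" "(\<lambda>k. w k * t ^ k) sums \<phi>" by (auto simp: tilt_def)
    show ?thesis unfolding tilted(2)
      using box_ratio_tendsto_tilted[OF w_nonneg t tilt_pos[OF tilted(1)] forest_filter_le large
          forest_weight_lower_bound[OF tilted(1) r]] .
  next
    case trivial
    show ?thesis
    proof (cases "d = 0")
      case True
      have "((\<lambda>n. w 0 * (\<Phi> ^ (n - 1)) $ (n - r) / (\<Phi> ^ n) $ (n - r)) \<longlongrightarrow> 1) (forest_filter r)"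
        by (rule box_ratio_0_tendsto_1[OF w_nonneg w0_pos trivial(1) forest_filter_le _ top pos]) simp
      thus ?thesis using True trivial by simp
    next
      case False
      have "((\<lambda>n. w d * (\<Phi> ^ (n - 1)) $ (n - r - d) / (\<Phi> ^ n) $ (n - r)) \<longlongrightarrow> 0) (forest_filter r)"
        using False by (intro box_ratio_tendsto_0[OF w_nonneg w0_pos trivial(1) _ forest_filter_le large pos]) simp
      thus ?thesis using False trivial by simp
    qed
  qed
qed

end

section \<open>Forests without leaves near the roots\<close>

context weights
begin

abbreviation "p \<equiv> pmf (offspring_pmf w)"

lemma p0_pos: "p 0 > 0"
  by (cases rule: offspring_cases) (use w0_pos tilt_pos in auto)

lemma p0_p1_le: "p 0 + p 1 \<le> 1"
proof -
  have "measure_pmf.prob (offspring_pmf w) {0, 1} = p 0 + p 1"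
    by (subst measure_measure_pmf_finite) auto
  thus ?thesis by (metis measure_pmf.prob_le_1)
qed

section \<open>Limits of the coefficient ratios of unrestricted forests\<close>

lemma y_power_nth_eq_0: "n < d \<Longrightarrow> (y ^ d) $ n = 0"
  by (rule fps_power_nth_eq_0) simp

lemma y_power_pos_iff:
  assumes "r \<ge> 1"
  shows "(y ^ r) $ n > 0 \<longleftrightarrow> r \<le> n \<and> (\<Phi> ^ n) $ (n - r) > 0"
proof (cases "r \<le> n")
  case True
  hence "real n > 0" "real r > 0" using assms by auto
  thus ?thesis using lagrange[OF assms True] True by (metis zero_less_mult_pos mult_pos_pos)
qed (use y_power_nth_eq_0 in auto)

lemma eventually_y_power_pos: "r \<ge> 1 \<Longrightarrow> eventually (\<lambda>n. (y ^ r) $ n > 0) (forest_filter r)"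
  using eventually_forest_filter_pos y_power_pos_iff by simp

text \<open>The limit is \<open>p d * (d / r) + p d * ((r - 1) / r)\<close>: with probability
  \<open>1 / r\<close> the first tree is the large one and its root degree is size-biased, otherwise
  its root has an ordinary offspring number.\<close>

lemma forest_ratio_tendsto:
  assumes r: "r \<ge> 1"
  shows "((\<lambda>n. w d * (y ^ (r - 1 + d)) $ (n - 1) / (y ^ r) $ n) \<longlongrightarrow> p d * real (r - 1 + d) / real r)
    (forest_filter r)"
proof -
  let ?r' = "r - 1 + d"
  have "((\<lambda>n. real ?r' / real r * (real n / real (n - 1)) *
      (w d * (\<Phi> ^ (n - 1)) $ (n - r - d) / (\<Phi> ^ n) $ (n - r))) \<longlongrightarrow> real ?r' / real r * 1 * p d) (forest_filter r)"
  proof (intro tendsto_mult tendsto_const box_ratio_tendsto r)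
    have "(\<lambda>n. real n / real (n - 1)) \<longlonglongrightarrow> 1" by real_asymp
    thus "((\<lambda>n. real n / real (n - 1)) \<longlongrightarrow> 1) (forest_filter r)"
      using forest_filter_le by (rule tendsto_mono[rotated])
  qed
  moreover have "eventually (\<lambda>n. real ?r' / real r * (real n / real (n - 1)) *
      (w d * (\<Phi> ^ (n - 1)) $ (n - r - d) / (\<Phi> ^ n) $ (n - r)) = w d * (y ^ ?r') $ (n - 1) / (y ^ r) $ n)
      (forest_filter r)"
    using eventually_forest_filterI[OF eventually_gt_at_top[of "r + d + 1"]]
  proof eventually_elim
    case (elim n)
    have 1: "(y ^ r) $ n = real r / real n * (\<Phi> ^ n) $ (n - r)"
      using lagrange[of r n] r elim by (simp add: field_simps)
    have 2: "(y ^ ?r') $ (n - 1) = real ?r' / real (n - 1) * (\<Phi> ^ (n - 1)) $ (n - r - d)"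
    proof (cases "?r' = 0")
      case True
      hence "(y ^ ?r') $ (n - 1) = 0" using elim by simp
      thus ?thesis using True by simp
    next
      case False
      have "n - 1 - ?r' = n - r - d" using r by simp
      thus ?thesis using lagrange[of ?r' "n - 1"] False elim by (simp add: field_simps)
    qed
    show ?case unfolding 1 2
      by (simp only: divide_inverse inverse_mult_distrib inverse_inverse_eq mult_ac)
  qed
  ultimately have "((\<lambda>n. w d * (y ^ ?r') $ (n - 1) / (y ^ r) $ n) \<longlongrightarrow> real ?r' / real r * 1 * p d) (forest_filter r)"
    by (rule Lim_transform_eventually)
  thus ?thesis by (simp add: mult.commute)
qed

lemma y_power_Suc:
  assumes "r \<ge> 1"
  shows "(y ^ r) $ Suc n = (\<Sum>d\<le>n. w d * (y ^ (r - 1 + d)) $ n)"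
proof -
  obtain r' where r: "r = Suc r'" using assms by (cases r) auto
  show ?thesis
    using fps_peel_root[OF tree_fps_0 tree_fps_0 tree_fps_Suc(1), of w "y ^ r'" n]
    unfolding r power_add[symmetric] by (simp add: add.commute)
qed

lemma forest_ratio_le_1:
  assumes "r \<ge> 1"
  shows "w d * (y ^ (r - 1 + d)) $ (n - 1) / (y ^ r) $ n \<le> 1"
proof (cases "(y ^ r) $ n > 0")
  case True
  then obtain m where n: "n = Suc m" using assms y_power_nth_eq_0[of 0 r] by (cases n) auto
  have "w d * (y ^ (r - 1 + d)) $ m \<le> (y ^ r) $ Suc m"
  proof (cases "d \<le> m")
    case True
    thus ?thesis unfolding y_power_Suc[OF assms]
      using w_nonneg y_power_nonneg by (intro member_le_sum) auto
  next
    case False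
    thus ?thesis using y_power_nth_eq_0[of m "r - 1 + d"] y_power_nonneg by simp
  qed
  thus ?thesis using True n by simp
next
  case False
  thus ?thesis using y_power_nonneg[of r n] by simp
qed

lemma A_antimono: "k \<le> l \<Longrightarrow> A l \<preceq> A k"
  unfolding fps_le_def tree_fps_def
  using tree_weight_nonneg no_leaf_below_mono by (auto intro!: sum_mono)

lemma A_le_y: "A k \<preceq> y"
  by (rule A_antimono) simp

lemma A_peel:
  "(A (Suc k) * F) $ Suc n = (\<Sum>d\<le>n. (w(0 := 0)) d * (A k ^ d * F) $ n)"
  by (rule fps_peel_root) (simp_all add: tree_fps_Suc)

text \<open>Only the single vertex has a leaf at height 0.\<close>

lemma A_1: "A 1 = y - fps_const (w 0) * fps_X"
proof (rule fps_ext)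
  fix n
  show "A 1 $ n = (y - fps_const (w 0) * fps_X) $ n"
  proof (cases n)
    case (Suc m)
    have "(\<Sum>d\<le>m. (w(0 := 0)) d * (y ^ d) $ m) = (\<Sum>d\<le>m. w d * (y ^ d) $ m - (if d = 0 then w 0 * 1 $ m else 0))"
      by (intro sum.cong) auto
    also have "\<dots> = y $ Suc m - w 0 * 1 $ m"
      by (simp add: sum_subtractf tree_fps_Suc(1))
    finally show ?thesis using tree_fps_Suc(2)[of w 0 m] Suc by (auto simp: fps_X_def)
  qed simp
qed

text \<open>Without leaves below height \<open>k\<close> a finite tree reaches height
  \<open>k\<close>, so it has at least \<open>k + 1\<close> vertices.\<close>

lemma A_nth_eq_0: "n \<le> k \<Longrightarrow> A k $ n = 0"
proof (induction k arbitrary: n)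
  case (Suc k)
  show ?case
  proof (cases n)
    case (Suc m)
    have "(w(0 := 0)) d * (A k ^ d) $ m = 0" for d
    proof (cases d)
      case (Suc e)
      have "(A k ^ Suc e) $ m = 0"
        using Suc.IH[of _] \<open>n \<le> Suc k\<close> \<open>n = Suc m\<close> by (auto simp: fps_mult_nth)
      thus ?thesis using Suc by simp
    qed simp
    thus ?thesis unfolding Suc tree_fps_Suc(2) by (intro sum.neutral ballI)
  qed simp
qed simp

text \<open>\<open>g m\<close> is the probability that the first tree of a random pair with
  \<open>m\<close> vertices is a single vertex. Its limit \<open>p 0 / 2\<close> is positive, and
  the finitely many remaining values are positive by \<open>box_remove_empty\<close>.\<close>

lemma leaf_in_pair:
  obtains c where "c > 0" "\<And>m. m \<ge> 3 \<Longrightarrow> c * (y ^ 2) $ m \<le> w 0 * y $ (m - 1)"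
proof -
  define g where "g = (\<lambda>m. w 0 * y $ (m - 1) / (y ^ 2) $ m)"
  have "(g \<longlongrightarrow> p 0 / 2) (forest_filter 2)"
    using forest_ratio_tendsto[of 2 0] by (simp add: g_def)
  hence "eventually (\<lambda>m. g m > p 0 / 4) (forest_filter 2)"
    using p0_pos by (intro order_tendstoD(1)[of _ "p 0 / 2"]) auto
  then obtain M where M: "\<And>m. m \<ge> M \<Longrightarrow> (y ^ 2) $ m > 0 \<Longrightarrow> g m > p 0 / 4"
    unfolding eventually_forest_filter eventually_sequentially using y_power_pos_iff[of 2] by auto
  define S where "S = {m. m < M \<and> m \<ge> 3 \<and> (y ^ 2) $ m > 0}"
  have S: "finite S" by (simp add: S_def)
  have gpos: "g m > 0" if "m \<ge> 3" "(y ^ 2) $ m > 0" for m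
  proof -
    have "(\<Phi> ^ Suc (m - 1)) $ (m - 2) > 0" using that y_power_pos_iff[of 2 m] by simp
    hence "(\<Phi> ^ (m - 1)) $ (m - 2) > 0" by (rule box_remove_empty) simp
    moreover have "m - 1 - 1 = m - 2" by simp
    ultimately have "(y ^ 1) $ (m - 1) > 0" using that by (subst y_power_pos_iff) auto
    thus ?thesis using that w0_pos by (simp add: g_def)
  qed
  define c where "c = Min (insert (p 0 / 4) (g ` S))"
  have "c > 0" unfolding c_def using S gpos p0_pos by (subst Min_gr_iff) (auto simp: S_def)
  moreover have "c * (y ^ 2) $ m \<le> w 0 * y $ (m - 1)" if m: "m \<ge> 3" for m
  proof (cases "(y ^ 2) $ m > 0")
    case True
    have "c \<le> g m"
    proof (cases "m < M")
      case mM: True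
      show ?thesis unfolding c_def using S True m mM by (intro Min_le) (auto simp: S_def)
    next
      case False
      have "c \<le> p 0 / 4" unfolding c_def using S by (intro Min_le) auto
      thus ?thesis using M[of m] False True by simp
    qed
    thus ?thesis using True by (simp add: g_def field_simps)
  next
    case False
    hence "(y ^ 2) $ m = 0" using y_power_nonneg[of 2 m] by linarith
    thus ?thesis using w0_pos y_power_nonneg[of 1 "m - 1"] by simp
  qed
  ultimately show ?thesis by (rule that)
qed

text \<open>
  Grouping the trees of a forest in pairs turns \<open>leaf_in_pair\<close> into a bound which is uniform in
  the number of vertices.
\<close>

lemma A_1_power_bound:
  obtains \<sigma> where "0 < \<sigma>" "\<sigma> < 1" "\<And>d n. (A 1 ^ d) $ n \<le> \<sigma> ^ (d - 1) * (y ^ d) $ n"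
proof -
  obtain c0 where c0: "c0 > 0" "\<And>m. m \<ge> 3 \<Longrightarrow> c0 * (y ^ 2) $ m \<le> w 0 * y $ (m - 1)"
    using leaf_in_pair by blast
  \<comment> \<open>The cut at 1/4 keeps \<open>\<delta> = 1 - 2 * c\<close> positive; the factor 2
    arises because either tree of a pair may be the single vertex.\<close>
  define c where "c = min c0 (1 / 4)"
  have c: "c > 0" "c \<le> 1 / 4" using c0 by (auto simp: c_def)
  have cm: "c * (y ^ 2) $ m \<le> w 0 * y $ (m - 1)" if "m \<ge> 3" for m
  proof -
    have "c \<le> c0" by (simp add: c_def)
    from mult_right_mono[OF this y_power_nonneg[of 2 m]] show ?thesis using c0(2)[OF that] by linarith
  qed
  define \<delta> where "\<delta> = 1 - 2 * c"
  have \<delta>: "0 < \<delta>" "\<delta> < 1" using c by (auto simp: \<delta>_def)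
  have pair: "A 1 ^ 2 \<preceq> fps_const \<delta> * y ^ 2"
    unfolding fps_le_def
  proof
    fix m
    show "(A 1 ^ 2) $ m \<le> (fps_const \<delta> * y ^ 2) $ m"
    proof (cases "m \<ge> 3")
      case True
      have "A 1 ^ 2 = y ^ 2 - fps_const (2 * w 0) * (fps_X * y) + fps_const (w 0 ^ 2) * fps_X ^ 2"
      proof -
        have "fps_const (2 * w 0) = 2 * fps_const (w 0)" by (simp add: fps_const_mult[symmetric] numeral_fps_const del: fps_const_mult)
        thus ?thesis unfolding A_1 by (simp add: power2_eq_square algebra_simps fps_const_mult[symmetric] del: fps_const_mult)
      qed
      hence "(A 1 ^ 2) $ m = (y ^ 2) $ m - 2 * (w 0 * y $ (m - 1))"
        using True by (simp add: fps_X_power_nth)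
      also have "\<dots> \<le> \<delta> * (y ^ 2) $ m" using cm[OF True] by (simp add: \<delta>_def algebra_simps)
      finally show ?thesis by simp
    next
      case False
      hence "m = 0 \<or> m = 1 \<or> m = 2" by auto
      hence "(A 1 ^ 2) $ m = 0"
        using A_nth_eq_0[of 0 1] A_nth_eq_0[of 1 1]
        by (auto simp: power2_eq_square fps_mult_nth numeral_2_eq_2)
      thus ?thesis using \<delta> y_power_nonneg[of 2 m] by simp
    qed
  qed
  \<comment> \<open>Each pair contributes \<open>\<delta> = \<sigma> ^ 2\<close>; for odd
    \<open>d\<close> one tree stays unpaired, hence the exponent \<open>d - 1\<close>.\<close>
  define \<sigma> where "\<sigma> = sqrt \<delta>"
  have \<sigma>: "0 < \<sigma>" "\<sigma> < 1" using \<delta> by (auto simp: \<sigma>_def)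
  have "(A 1 ^ d) $ n \<le> \<sigma> ^ (d - 1) * (y ^ d) $ n" for d n
  proof -
    define q e where "q = d div 2" and "e = d mod 2"
    have d: "d = 2 * q + e" by (simp add: q_def e_def)
    have "(A 1 ^ 2) ^ q * A 1 ^ e \<preceq> (fps_const \<delta> * y ^ 2) ^ q * y ^ e"
      using \<delta> by (intro fps_le_mult fps_le_power pair A_le_y A_nonneg fps_nonneg_power fps_nonneg_mult)
        (auto simp: fps_le_def)
    hence "A 1 ^ d \<preceq> fps_const (\<delta> ^ q) * y ^ d"
      by (simp add: d power_add power_mult power_mult_distrib fps_const_power mult.assoc)
    hence "(A 1 ^ d) $ n \<le> \<delta> ^ q * (y ^ d) $ n" by (auto dest: fps_leD[of _ _ n])
    also have "\<delta> ^ q = \<sigma> ^ (2 * q)" using \<delta> by (simp add: \<sigma>_def power_mult)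
    also have "\<sigma> ^ (2 * q) \<le> \<sigma> ^ (d - 1)"
      using \<sigma> by (intro power_decreasing) (auto simp: q_def)
    finally show ?thesis using y_power_nonneg by (simp add: mult_right_mono)
  qed
  with \<sigma> show ?thesis by (rule that)
qed

text \<open>In the recursion for \<open>A 2\<close>, root degrees \<open>d \<ge> 2\<close> gain a
  factor \<open>\<sigma>\<close> from \<open>A_1_power_bound\<close>, but degree 1 gains nothing.
  Since \<open>p 1 < 1\<close>, degree 1 has probability less than \<open>\<pi> < 1\<close> for
  large \<open>n\<close>, and small \<open>n\<close> are excluded by the height.\<close>

lemma A_decay:
  obtains k0 \<rho> where "k0 > 0" "0 < \<rho>" "\<rho> < 1" "\<And>j. A (j + k0) \<preceq> fps_const \<rho> * A j"
proof -
  obtain \<sigma> where \<sigma>: "0 < \<sigma>" "\<sigma> < 1" "\<And>d n. (A 1 ^ d) $ n \<le> \<sigma> ^ (d - 1) * (y ^ d) $ n"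
    using A_1_power_bound by blast
  \<comment> \<open>Midpoint between \<open>p 1\<close> and 1, where \<open>p 1 < 1\<close> follows
    from \<open>p 0 > 0\<close>.\<close>
  define \<pi> where "\<pi> = (1 + p 1) / 2"
  have \<pi>: "0 < \<pi>" "\<pi> < 1" "p 1 < \<pi>" using p0_p1_le p0_pos by (auto simp: \<pi>_def add_pos_nonneg)
  \<comment> \<open>Convex combination \<open>\<pi> * 1 + (1 - \<pi>) * \<sigma>\<close> of the
    factors for degree 1 and for larger degrees.\<close>
  define \<rho> where "\<rho> = \<sigma> + (1 - \<sigma>) * \<pi>"
  have "(1 - \<sigma>) * \<pi> < (1 - \<sigma>) * 1" using \<pi> \<sigma> by (intro mult_strict_left_mono) auto
  hence "(1 - \<sigma>) * \<pi> < 1 - \<sigma>" by (simp only: mult_1_right)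
  hence \<rho>1: "\<rho> < 1" unfolding \<rho>_def by linarith
  have \<rho>: "0 < \<rho>" unfolding \<rho>_def using \<sigma>(1,2) \<pi>(1) by (intro add_pos_pos mult_pos_pos) auto
  note \<rho> = \<rho> \<rho>1
  have "((\<lambda>n. w 1 * y $ (n - 1) / y $ n) \<longlongrightarrow> p 1) (forest_filter 1)"
    using forest_ratio_tendsto[of 1 1] by simp
  hence "eventually (\<lambda>n. w 1 * y $ (n - 1) / y $ n < \<pi>) (forest_filter 1)"
    using \<pi> by (intro order_tendstoD(2)[of _ "p 1"])
  then obtain N where N: "\<And>n. n \<ge> N \<Longrightarrow> y $ n > 0 \<Longrightarrow> w 1 * y $ (n - 1) / y $ n < \<pi>"
    unfolding eventually_forest_filter eventually_sequentially using y_power_pos_iff[of 1] by auto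
  \<comment> \<open>Coefficients up to \<open>k0\<close> vanish, so that only \<open>n > N\<close>
    remains; \<open>k0 \<ge> 2\<close> allows the comparison with \<open>A 2\<close>.\<close>
  define k0 where "k0 = N + 2"
  have base: "A k0 $ n \<le> \<rho> * y $ n" for n
  proof (cases "n \<le> k0")
    case True
    thus ?thesis using A_nth_eq_0 \<rho> y_power_nonneg[of 1 n] by simp
  next
    case False
    then obtain m where n: "n = Suc m" "m \<ge> 1" by (cases n) (auto simp: k0_def)
    have "A k0 $ n \<le> A 2 $ n" using A_antimono[of 2 k0] by (auto simp: k0_def dest: fps_leD)
    also have "\<dots> = (\<Sum>d\<le>m. (w(0 := 0)) d * (A 1 ^ d) $ m)"
      using tree_fps_Suc(2)[of w 1 m] n by (simp add: numeral_2_eq_2)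
    also have "\<dots> \<le> (\<Sum>d\<le>m. \<sigma> * (w d * (y ^ d) $ m) + (if d = 1 then (1 - \<sigma>) * (w 1 * y $ m) else 0))"
    proof (intro sum_mono)
      fix d :: nat
      consider "d = 0" | "d = 1" | "d \<ge> 2" by linarith
      thus "(w(0 := 0)) d * (A 1 ^ d) $ m \<le>
          \<sigma> * (w d * (y ^ d) $ m) + (if d = 1 then (1 - \<sigma>) * (w 1 * y $ m) else 0)"
      proof cases
        case 1
        thus ?thesis using \<sigma> w_nonneg[of 0] y_power_nonneg[of 0 m] by simp
      next
        case 2
        thus ?thesis using mult_left_mono[OF fps_leD[OF A_le_y[of 1], of m] w_nonneg[of 1]]
          by (simp add: algebra_simps)
      next
        case 3
        have "(A 1 ^ d) $ m \<le> \<sigma> ^ (d - 1) * (y ^ d) $ m" by (rule \<sigma>(3))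
        also have "\<sigma> ^ (d - 1) \<le> \<sigma> ^ 1" using \<sigma> 3 by (intro power_decreasing) auto
        finally have "w d * (A 1 ^ d) $ m \<le> w d * (\<sigma> * (y ^ d) $ m)"
          using w_nonneg y_power_nonneg by (intro mult_left_mono) (auto simp: mult_right_mono)
        thus ?thesis using 3 by (simp add: mult_ac)
      qed
    qed
    also have "\<dots> = \<sigma> * y $ n + (1 - \<sigma>) * (w 1 * y $ m)"
      using n by (simp add: sum.distrib sum_distrib_left[symmetric] tree_fps_Suc(1))
    finally have *: "A k0 $ n \<le> \<sigma> * y $ n + (1 - \<sigma>) * (w 1 * y $ m)" .
    show ?thesis
    proof (cases "y $ n > 0")
      case True
      hence "w 1 * y $ m \<le> \<pi> * y $ n" using N[of n] False n by (simp add: k0_def field_simps)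
      hence "(1 - \<sigma>) * (w 1 * y $ m) \<le> (1 - \<sigma>) * (\<pi> * y $ n)" using \<sigma> by (intro mult_left_mono) auto
      thus ?thesis using * by (simp add: \<rho>_def algebra_simps)
    next
      case False
      thus ?thesis using fps_leD[OF A_le_y[of k0], of n] y_power_nonneg[of 1 n] by simp
    qed
  qed
  have "A (j + k0) \<preceq> fps_const \<rho> * A j" for j
  proof (induction j)
    case 0
    show ?case using base by (simp add: fps_le_def)
  next
    case (Suc j)
    show ?case unfolding fps_le_def
    proof
      fix n
      show "A (Suc j + k0) $ n \<le> (fps_const \<rho> * A (Suc j)) $ n"
      proof (cases n)
        case n: (Suc m)
        have "A (Suc j + k0) $ n = (\<Sum>d\<le>m. (w(0 := 0)) d * (A (j + k0) ^ d) $ m)"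
          using n tree_fps_Suc(2)[of w "j + k0" m] by simp
        also have "\<dots> \<le> (\<Sum>d\<le>m. \<rho> * ((w(0 := 0)) d * (A j ^ d) $ m))"
        proof (intro sum_mono)
          fix d
          show "(w(0 := 0)) d * (A (j + k0) ^ d) $ m \<le> \<rho> * ((w(0 := 0)) d * (A j ^ d) $ m)"
          proof (cases "d = 0")
            case False
            have "(A (j + k0) ^ d) $ m \<le> ((fps_const \<rho> * A j) ^ d) $ m"
              by (intro fps_leD fps_le_power A_nonneg Suc.IH)
            also have "\<dots> = \<rho> ^ d * (A j ^ d) $ m"
              by (simp add: power_mult_distrib fps_const_power)
            \<comment> \<open>One factor \<open>\<rho>\<close> survives because
              \<open>d \<ge> 1\<close>: degree 0 is excluded by the height bound.\<close>
            also have "\<rho> ^ d \<le> \<rho> ^ 1" using \<rho> False by (intro power_decreasing) auto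
            finally have "(A (j + k0) ^ d) $ m \<le> \<rho> * (A j ^ d) $ m"
              using fps_leD[OF fps_nonneg_power[OF A_nonneg]] by (simp add: mult_right_mono)
            from mult_left_mono[OF this w_nonneg[of d]] show ?thesis using False by (simp add: mult_ac)
          qed simp
        qed
        also have "\<dots> = \<rho> * A (Suc j) $ n"
          using n tree_fps_Suc(2)[of w j m] by (simp add: sum_distrib_left)
        finally show ?thesis by simp
      qed simp
    qed
  qed
  thus ?thesis using that[of k0 \<rho>] \<rho> by (simp add: k0_def)
qed

lemma A_tail_bound:
  obtains C \<rho> where "C > 0" "0 < \<rho>" "\<rho> < 1" "\<And>k n. A k $ n \<le> C * \<rho> ^ k * y $ n"
proof -
  obtain k0 \<rho> where k0: "k0 > 0" "0 < \<rho>" "\<rho> < 1" "\<And>j. A (j + k0) \<preceq> fps_const \<rho> * A j"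
    using A_decay by blast
  have it: "A (i * k0) $ n \<le> \<rho> ^ i * y $ n" for i n
  proof (induction i)
    case (Suc i)
    have "A (Suc i * k0) $ n \<le> \<rho> * A (i * k0) $ n"
      using fps_leD[OF k0(4)[of "i * k0"], of n] by (simp add: add.commute)
    also have "\<dots> \<le> \<rho> * (\<rho> ^ i * y $ n)" using Suc.IH k0(2) by (intro mult_left_mono) auto
    also have "\<dots> = \<rho> ^ Suc i * y $ n" by simp
    finally show ?case .
  qed simp
  \<comment> \<open>The decay rate per level; the constant \<open>1 / \<sigma> ^ k0\<close> pays for
    rounding \<open>k\<close> down to a multiple of \<open>k0\<close>.\<close>
  define \<sigma> where "\<sigma> = root k0 \<rho>"
  have \<sigma>: "0 < \<sigma>" "\<sigma> < 1" using k0 by (auto simp: \<sigma>_def)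
  have \<rho>_eq: "\<rho> = \<sigma> ^ k0" using k0 by (simp add: \<sigma>_def real_root_pow_pos)
  show ?thesis
  proof (rule that[of "1 / \<sigma> ^ k0" \<sigma>])
    fix k n
    have "k mod k0 < k0" using k0 by simp
    have k: "(k div k0) * k0 \<le> k" by simp
    have "A k $ n \<le> A (k div k0 * k0) $ n" using A_antimono[OF k] by (rule fps_leD)
    also have "\<dots> \<le> \<rho> ^ (k div k0) * y $ n" by (rule it)
    also have "\<rho> ^ (k div k0) = \<sigma> ^ (k0 * (k div k0))" by (simp add: \<rho>_eq power_mult)
    also have "\<sigma> ^ (k0 * (k div k0)) \<le> 1 / \<sigma> ^ k0 * \<sigma> ^ k"
    proof -
      have "k \<le> k0 * (k div k0) + k0"
        using \<open>k mod k0 < k0\<close> mult_div_mod_eq[of k0 k] by linarith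
      hence "\<sigma> ^ (k0 * (k div k0) + k0) \<le> \<sigma> ^ k" using \<sigma> by (intro power_decreasing) auto
      thus ?thesis using \<sigma> by (simp add: power_add field_simps)
    qed
    finally show "A k $ n \<le> 1 / \<sigma> ^ k0 * \<sigma> ^ k * y $ n"
      using y_power_nonneg[of 1 n] by (simp add: mult_right_mono)
  qed (use \<sigma> in auto)
qed

end

section \<open>The limit of the coefficient ratios\<close>

text \<open>
  \<open>alive p k\<close> is the probability that a Galton--Watson tree with offspring law \<open>p\<close> has no leaf at
  height less than \<open>k\<close>, and \<open>spine p k\<close> is the same probability for the limit tree. A root with
  infinitely many children almost surely has a leaf among them, so that it contributes to
  \<open>spine p k\<close> only if \<open>k \<le> 1\<close>; this is why \<open>k = 1\<close> is a separate case.
\<close>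

primrec alive :: "nat pmf \<Rightarrow> nat \<Rightarrow> real" where
  "alive p 0 = 1"
| "alive p (Suc k) = (\<Sum>d. (if d = 0 then 0 else pmf p d) * alive p k ^ d)"

fun spine :: "nat pmf \<Rightarrow> nat \<Rightarrow> real" where
  "spine p 0 = 1"
| "spine p (Suc 0) = 1"
| "spine p (Suc (Suc k)) = (\<Sum>d. real d * pmf p d * alive p (Suc k) ^ (d - 1)) * spine p (Suc k)"

lemma pmf_nat_sums: "pmf (p :: nat pmf) sums 1"
proof -
  have "(\<Sum>d. ennreal (pmf p d)) = 1"
    using nn_integral_pmf_eq_1[of p] by (simp add: nn_integral_count_space_nat)
  moreover from this have "summable (pmf p)"
    by (intro summable_suminf_not_top) auto
  ultimately show ?thesis by (simp add: suminf_ennreal2 sums_iff)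
qed

lemma pmf_pos_sums: "(\<lambda>d. if d = 0 then 0 else pmf p d) sums (1 - pmf p 0)"
proof -
  have "(\<lambda>d. pmf p d - (if d = 0 then pmf p 0 else 0)) sums (1 - pmf p 0)"
    using sums_single[of 0 "\<lambda>_. pmf p 0"] by (intro sums_diff pmf_nat_sums) auto
  also have "(\<lambda>d. pmf p d - (if d = 0 then pmf p 0 else 0)) = (\<lambda>d. if d = 0 then 0 else pmf p d)"
    by auto
  finally show ?thesis .
qed

lemma pmf_pos_mult_power_le:
  assumes "0 \<le> x" "x \<le> 1"
  shows "(if d = 0 then 0 else pmf p d) * x ^ d \<le> (if d = 0 then 0 else pmf p d)"
  using mult_left_mono[OF power_le_one[OF assms, of d], of "if d = 0 then 0 else pmf p d"] by simp

lemma alive_bounds: "0 \<le> alive p k \<and> alive p k \<le> 1 \<and>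
  (\<lambda>d. (if d = 0 then 0 else pmf p d) * alive p k ^ d) sums alive p (Suc k)"
proof (induction k)
  case 0
  show ?case using pmf_pos_sums[of p] by (simp add: sums_iff)
next
  case (Suc k)
  hence IH: "0 \<le> alive p k" "alive p k \<le> 1"
    "(\<lambda>d. (if d = 0 then 0 else pmf p d) * alive p k ^ d) sums alive p (Suc k)" by auto
  have 0: "0 \<le> alive p (Suc k)"
    using IH(1) by (intro sums_le[OF _ sums_zero IH(3)]) auto
  have "alive p (Suc k) \<le> 1 - pmf p 0"
    using IH by (intro sums_le[OF pmf_pos_mult_power_le IH(3) pmf_pos_sums])
  hence 1: "alive p (Suc k) \<le> 1" using pmf_nonneg[of p 0] by linarith
  have "summable (\<lambda>d. (if d = 0 then 0 else pmf p d) * alive p (Suc k) ^ d)"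
  proof (rule summable_comparison_test')
    show "summable (\<lambda>d. if d = 0 then 0 else pmf p d)" using pmf_pos_sums by (rule sums_summable)
    fix d :: nat
    show "norm ((if d = 0 then 0 else pmf p d) * alive p (Suc k) ^ d) \<le> (if d = 0 then 0 else pmf p d)"
      using pmf_pos_mult_power_le[OF 0 1, of d p] 0 by (simp add: abs_mult)
  qed
  thus ?case using 0 1 by (simp add: summable_sums)
qed

lemma alive_nonneg: "0 \<le> alive p k" and alive_le_1: "alive p k \<le> 1"
  and alive_sums: "(\<lambda>d. (if d = 0 then 0 else pmf p d) * alive p k ^ d) sums alive p (Suc k)"
  using alive_bounds by blast+

lemma alive_Suc_le: "alive p (Suc k) \<le> 1 - pmf p 0"
  by (rule sums_le[OF pmf_pos_mult_power_le[OF alive_nonneg alive_le_1] alive_sums pmf_pos_sums])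

text \<open>The law \<open>p\<close> is arbitrary here and may have infinite mean, so convergence is
  drawn from the derivative of the geometric series at \<open>alive p k < 1\<close>.\<close>

lemma summable_alive_deriv:
  assumes "alive p k < 1"
  shows "summable (\<lambda>d. real d * pmf p d * alive p k ^ (d - 1))"
proof (subst summable_Suc_iff[symmetric], rule summable_comparison_test')
  show "summable (\<lambda>d. real (Suc d) * alive p k ^ d)"
    using geometric_deriv_sums[of "alive p k"] assms alive_nonneg[of p k] by (auto simp: sums_iff)
  fix d :: nat
  have "real (Suc d) * alive p k ^ d * pmf p (Suc d) \<le> real (Suc d) * alive p k ^ d * 1"
    using alive_nonneg[of p k] by (intro mult_left_mono pmf_le_1) auto
  thus "norm (real (Suc d) * pmf p (Suc d) * alive p k ^ (Suc d - 1)) \<le> real (Suc d) * alive p k ^ d"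
    using alive_nonneg[of p k] by (simp add: mult_ac)
qed

context weights
begin

abbreviation "\<xi> \<equiv> offspring_pmf w"

lemma fps_le_y_power_nth_eq_0:
  assumes "0 \<preceq> F" "F \<preceq> y ^ r" "n < r"
  shows "F $ n = 0"
  using fps_leD[OF assms(1), of n] fps_leD[OF assms(2), of n] y_power_nth_eq_0[OF assms(3)] by simp

lemma A_mixed_nonneg: "0 \<preceq> A k ^ i * A l ^ j"
  by (intro fps_nonneg_mult fps_nonneg_power A_nonneg)

lemma A_mixed_le: "A k ^ i * A l ^ j \<preceq> y ^ (i + j)"
  unfolding power_add
  by (intro fps_le_mult fps_le_power A_le_y A_nonneg fps_nonneg_power)

lemma filterlim_forest_filter_pred:
  assumes "r \<ge> 1" "r' \<ge> 1" "eventually (\<lambda>n. (y ^ r') $ (n - 1) > 0) (forest_filter r)"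
  shows "filterlim (\<lambda>n. n - 1) (forest_filter r') (forest_filter r)"
  unfolding forest_filter_def[of r'] filterlim_inf filterlim_principal
proof
  have "filterlim (\<lambda>n::nat. n - 1) sequentially sequentially" by real_asymp
  thus "filterlim (\<lambda>n. n - 1) sequentially (forest_filter r)"
    by (rule filterlim_mono[OF _ order_refl forest_filter_le])
  show "eventually (\<lambda>n. n - 1 \<in> {n. r' \<le> n \<and> (\<Phi> ^ n) $ (n - r') > 0}) (forest_filter r)"
    using assms(3) y_power_pos_iff[OF assms(2)] by simp
qed

text \<open>If \<open>p d > 0\<close>, the ratio \<open>q\<close> is eventually positive, so forests
  of \<open>r'\<close> trees with \<open>n - 1\<close> vertices exist and \<open>lim\<close> may be
  read at \<open>n - 1\<close>. If \<open>p d = 0\<close>, such forests may be missing, but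
  \<open>q\<close> tends to 0 and dominates.\<close>

lemma peeled_ratio_tendsto:
  assumes r: "r \<ge> 1" and r': "r' = r - 1 + d" "r' \<ge> 1" and F: "0 \<preceq> F" "F \<preceq> y ^ r'"
    and lim: "((\<lambda>n. real r' * F $ n / (y ^ r') $ n) \<longlongrightarrow> v) (forest_filter r')"
  shows "((\<lambda>n. real r * (w d * F $ (n - 1)) / (y ^ r) $ n) \<longlongrightarrow> p d * v) (forest_filter r)"
proof -
  define q where "q = (\<lambda>n. w d * (y ^ r') $ (n - 1) / (y ^ r) $ n)"
  have q: "(q \<longlongrightarrow> p d * real r' / real r) (forest_filter r)"
    using forest_ratio_tendsto[OF r, of d] by (simp add: q_def r'(1))
  have F0: "F $ n \<ge> 0" "F $ n \<le> (y ^ r') $ n" for n using F by (auto simp: fps_le_def)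
  show ?thesis
  proof (cases "p d = 0")
    case True
    have h: "((\<lambda>n. real r * q n) \<longlongrightarrow> 0) (forest_filter r)"
      using tendsto_mult[OF tendsto_const q, of "real r"] True by simp
    have u: "real r * (w d * F $ (n - 1)) / (y ^ r) $ n \<le> real r * q n" for n
    proof -
      have "w d * F $ (n - 1) / (y ^ r) $ n \<le> w d * (y ^ r') $ (n - 1) / (y ^ r) $ n"
        using w_nonneg F0 y_power_nonneg by (intro divide_right_mono mult_left_mono) auto
      from mult_left_mono[OF this, of "real r"] show ?thesis by (simp add: q_def)
    qed
    have l: "0 \<le> real r * (w d * F $ (n - 1)) / (y ^ r) $ n" for n
      using w_nonneg F0 y_power_nonneg by (intro divide_nonneg_nonneg mult_nonneg_nonneg) auto
    have "((\<lambda>n. real r * (w d * F $ (n - 1)) / (y ^ r) $ n) \<longlongrightarrow> 0) (forest_filter r)"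
      using l u by (intro tendsto_sandwich[OF _ _ tendsto_const h] always_eventually allI)
    thus ?thesis using True by simp
  next
    case False
    hence "p d * real r' / real r > 0" using r r' by (simp add: pmf_nonneg less_le)
    hence "eventually (\<lambda>n. q n > 0) (forest_filter r)" using q by (rule order_tendstoD(1)[rotated])
    hence pos: "eventually (\<lambda>n. (y ^ r') $ (n - 1) > 0) (forest_filter r)"
    proof (rule eventually_mono)
      fix n assume "q n > 0"
      hence "(y ^ r') $ (n - 1) \<noteq> 0" by (auto simp: q_def)
      thus "(y ^ r') $ (n - 1) > 0" using y_power_nonneg[of r' "n - 1"] by simp
    qed
    have "((\<lambda>n. real r' * F $ (n - 1) / (y ^ r') $ (n - 1)) \<longlongrightarrow> v) (forest_filter r)"
      using filterlim_compose[OF lim filterlim_forest_filter_pred[OF r r'(2) pos]] .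
    hence "((\<lambda>n. real r / real r' * q n * (real r' * F $ (n - 1) / (y ^ r') $ (n - 1))) \<longlongrightarrow>
        real r / real r' * (p d * real r' / real r) * v) (forest_filter r)"
      using q by (intro tendsto_mult tendsto_const)
    moreover have "eventually (\<lambda>n. real r / real r' * q n * (real r' * F $ (n - 1) / (y ^ r') $ (n - 1)) =
        real r * (w d * F $ (n - 1)) / (y ^ r) $ n) (forest_filter r)"
      using pos
    proof eventually_elim
      case (elim n)
      show ?case using r r' elim by (simp add: q_def)
    qed
    ultimately have "((\<lambda>n. real r * (w d * F $ (n - 1)) / (y ^ r) $ n) \<longlongrightarrow>
        real r / real r' * (p d * real r' / real r) * v) (forest_filter r)"
      by (rule Lim_transform_eventually)
    moreover have "real r / real r' * (p d * real r' / real r) = p d" using r r'(2) by simp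
    ultimately show ?thesis by (simp only:)
  qed
qed

text \<open>The product rule for \<open>alive \<xi> (Suc k) ^ i * alive \<xi> k ^ j\<close>, with
  \<open>spine\<close> in place of the derivative of \<open>alive\<close>: the one large tree,
  uniform among the \<open>i + j\<close> trees, contributes \<open>spine\<close>, every other tree
  \<open>alive\<close>. Multiplying the ratios by \<open>i + j\<close> cancels the probability of
  the choice.\<close>

definition mixed_limit :: "nat \<Rightarrow> nat \<Rightarrow> nat \<Rightarrow> real" where
  "mixed_limit k i j = real i * alive \<xi> (Suc k) ^ (i - 1) * spine \<xi> (Suc k) * alive \<xi> k ^ j
     + real j * alive \<xi> k ^ (j - 1) * spine \<xi> k * alive \<xi> (Suc k) ^ i"

definition mixed_ratio_converges :: "nat \<Rightarrow> nat \<Rightarrow> nat \<Rightarrow> bool" where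
  "mixed_ratio_converges k i j \<longleftrightarrow>
     ((\<lambda>n. real (i + j) * (A (Suc k) ^ i * A k ^ j) $ n / (y ^ (i + j)) $ n) \<longlongrightarrow> mixed_limit k i j)
       (forest_filter (i + j))"

text \<open>\<open>A 1 = y - w 0 z\<close> is applied to one factor at a time, which reduces the
  exponent \<open>i\<close> to forests whose limits are known.\<close>

lemma mixed_ratio_converges_0:
  assumes "i + j \<ge> 1"
  shows "mixed_ratio_converges 0 i j"
  using assms
proof (induction i arbitrary: j)
  case 0
  have "eventually (\<lambda>n. real j = real j * (y ^ j) $ n / (y ^ j) $ n) (forest_filter j)"
    using eventually_y_power_pos[of j] 0 by (auto elim: eventually_mono)
  hence "((\<lambda>n. real j * (y ^ j) $ n / (y ^ j) $ n) \<longlongrightarrow> real j) (forest_filter j)"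
    by (intro Lim_transform_eventually[OF tendsto_const])
  thus ?case by (simp add: mixed_ratio_converges_def mixed_limit_def)
next
  case (Suc i)
  define r where "r = Suc (i + j)"
  let ?F = "A 1 ^ i * y ^ j"
  have 1: "((\<lambda>n. real r * (A 1 ^ i * y ^ Suc j) $ n / (y ^ r) $ n) \<longlongrightarrow> mixed_limit 0 i (Suc j)) (forest_filter r)"
    using Suc.IH[of "Suc j"] unfolding mixed_ratio_converges_def r_def by (simp del: power_Suc)
  have 2: "((\<lambda>n. real r * (w 0 * ?F $ (n - 1)) / (y ^ r) $ n) \<longlongrightarrow> p 0 * mixed_limit 0 i j) (forest_filter r)"
  proof (cases "i + j = 0")
    case True
    have "eventually (\<lambda>n. 0 = real r * (w 0 * ?F $ (n - 1)) / (y ^ r) $ n) (forest_filter r)"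
      using eventually_forest_filterI[OF eventually_gt_at_top[of 1]] by eventually_elim (use True in simp)
    hence "((\<lambda>n. real r * (w 0 * ?F $ (n - 1)) / (y ^ r) $ n) \<longlongrightarrow> 0) (forest_filter r)"
      by (rule Lim_transform_eventually[OF tendsto_const])
    thus ?thesis using True by (simp add: mixed_limit_def)
  next
    case False
    show ?thesis
    proof (rule peeled_ratio_tendsto[where r' = "i + j"])
      show "((\<lambda>n. real (i + j) * ?F $ n / (y ^ (i + j)) $ n) \<longlongrightarrow> mixed_limit 0 i j) (forest_filter (i + j))"
        using Suc.IH[of j] False by (simp add: mixed_ratio_converges_def)
      show "0 \<preceq> ?F" by (rule A_mixed_nonneg)
      show "?F \<preceq> y ^ (i + j)" by (rule A_mixed_le)
    qed (use False in \<open>auto simp: r_def\<close>)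
  qed
  have A1: "A 1 ^ Suc i * y ^ j = A 1 ^ i * y ^ Suc j - fps_const (w 0) * (fps_X * ?F)"
    unfolding power_Suc by (subst (1) A_1) (simp add: algebra_simps)
  have "((\<lambda>n. real r * (A 1 ^ i * y ^ Suc j) $ n / (y ^ r) $ n - real r * (w 0 * ?F $ (n - 1)) / (y ^ r) $ n) \<longlongrightarrow>
      mixed_limit 0 i (Suc j) - p 0 * mixed_limit 0 i j) (forest_filter r)"
    using 1 2 by (rule tendsto_diff)
  moreover have "eventually (\<lambda>n. real r * (A 1 ^ i * y ^ Suc j) $ n / (y ^ r) $ n - real r * (w 0 * ?F $ (n - 1)) / (y ^ r) $ n =
      real r * (A 1 ^ Suc i * y ^ j) $ n / (y ^ r) $ n) (forest_filter r)"
    using eventually_forest_filterI[OF eventually_gt_at_top[of 0]]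
  proof eventually_elim
    case (elim n)
    have "(A 1 ^ Suc i * y ^ j) $ n = (A 1 ^ i * y ^ Suc j) $ n - w 0 * ?F $ (n - 1)"
      unfolding A1 using elim by simp
    thus ?case by (simp only: right_diff_distrib diff_divide_distrib)
  qed
  ultimately have "((\<lambda>n. real r * (A 1 ^ Suc i * y ^ j) $ n / (y ^ r) $ n) \<longlongrightarrow>
      mixed_limit 0 i (Suc j) - p 0 * mixed_limit 0 i j) (forest_filter r)"
    by (rule Lim_transform_eventually)
  moreover have "mixed_limit 0 i (Suc j) - p 0 * mixed_limit 0 i j = mixed_limit 0 (Suc i) j"
  proof -
    have a1: "alive \<xi> (Suc 0) = 1 - p 0" using pmf_pos_sums[of \<xi>] by (simp add: sums_iff)
    show ?thesis
      unfolding mixed_limit_def a1 by (cases i) (simp_all add: algebra_simps)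
  qed
  ultimately show ?case by (simp add: mixed_ratio_converges_def r_def del: power_Suc)
qed

text \<open>The product rule splits \<open>(j + d) * a ^ (j + d - 1)\<close> into a part without and
  a part with the factor \<open>d\<close>. The first sums up by the recursion of
  \<open>alive\<close>; the second gives the series \<open>D\<close>, and
  \<open>D * spine \<xi> (Suc k)\<close> is the next value of \<open>spine\<close>.\<close>

lemma mixed_limit_Suc_sums:
  "(\<lambda>d. if d = 0 then 0 else p d * mixed_limit (Suc k) i (j + d)) sums mixed_limit (Suc k) (Suc i) j"
proof -
  define a a' b b' where "a = alive \<xi> (Suc k)" and "a' = alive \<xi> (Suc (Suc k))"
    and "b = spine \<xi> (Suc k)" and "b' = spine \<xi> (Suc (Suc k))"
  define D where "D = (\<Sum>d. real d * pmf \<xi> d * a ^ (d - 1))"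
  have "a < 1" using alive_Suc_le[of \<xi> k] p0_pos by (simp add: a_def)
  hence D: "(\<lambda>d. real d * pmf \<xi> d * a ^ (d - 1)) sums D"
    unfolding D_def a_def by (intro summable_sums summable_alive_deriv)
  have a': "(\<lambda>d. (if d = 0 then 0 else p d) * a ^ d) sums a'"
    unfolding a_def a'_def by (rule alive_sums)
  have b': "b' = D * b" by (simp add: b'_def D_def b_def a_def)
  have "(\<lambda>d. real i * a' ^ (i - 1) * b' * a ^ j * ((if d = 0 then 0 else p d) * a ^ d)
      + real j * a ^ (j - 1) * b * a' ^ i * ((if d = 0 then 0 else p d) * a ^ d)
      + a ^ j * b * a' ^ i * (real d * p d * a ^ (d - 1))) sums
      (real i * a' ^ (i - 1) * b' * a ^ j * a' + real j * a ^ (j - 1) * b * a' ^ i * a' + a ^ j * b * a' ^ i * D)"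
    by (intro sums_add sums_mult a' D)
  also have "(\<lambda>d. real i * a' ^ (i - 1) * b' * a ^ j * ((if d = 0 then 0 else p d) * a ^ d)
      + real j * a ^ (j - 1) * b * a' ^ i * ((if d = 0 then 0 else p d) * a ^ d)
      + a ^ j * b * a' ^ i * (real d * p d * a ^ (d - 1))) =
    (\<lambda>d. if d = 0 then 0 else p d * mixed_limit (Suc k) i (j + d))"
  proof
    fix d :: nat
    show "real i * a' ^ (i - 1) * b' * a ^ j * ((if d = 0 then 0 else p d) * a ^ d)
      + real j * a ^ (j - 1) * b * a' ^ i * ((if d = 0 then 0 else p d) * a ^ d)
      + a ^ j * b * a' ^ i * (real d * p d * a ^ (d - 1)) =
      (if d = 0 then 0 else p d * mixed_limit (Suc k) i (j + d))"
    proof (cases d)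
      case (Suc e)
      have "real (j + d) * a ^ (j + d - 1) = real j * a ^ (j - 1) * a ^ d + real d * a ^ j * a ^ (d - 1)"
        unfolding Suc by (cases j) (simp_all add: power_add algebra_simps)
      hence "mixed_limit (Suc k) i (j + d) = real i * a' ^ (i - 1) * b' * a ^ (j + d) +
          (real j * a ^ (j - 1) * a ^ d + real d * a ^ j * a ^ (d - 1)) * b * a' ^ i"
        unfolding mixed_limit_def a_def[symmetric] a'_def[symmetric] b_def[symmetric] b'_def[symmetric] by simp
      thus ?thesis using Suc by (simp add: power_add algebra_simps)
    qed simp
  qed
  also have "real i * a' ^ (i - 1) * b' * a ^ j * a' + real j * a ^ (j - 1) * b * a' ^ i * a' + a ^ j * b * a' ^ i * D
      = mixed_limit (Suc k) (Suc i) j"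
    unfolding mixed_limit_def a_def[symmetric] a'_def[symmetric] b_def[symmetric] b'_def[symmetric]
    by (cases i) (simp_all add: b' algebra_simps)
  finally show ?thesis .
qed

text \<open>Dominated convergence over the root degree \<open>d\<close> of one tree. The majorant
  \<open>r * \<sigma> ^ (d - 1)\<close> exists because the \<open>d\<close> trees attached to that
  root have height bound at least 1, so that \<open>A_1_power_bound\<close> applies to them.\<close>

lemma mixed_ratio_converges_Suc:
  assumes IH: "\<And>d. mixed_ratio_converges (Suc k) i (j + Suc d)"
  shows "mixed_ratio_converges (Suc k) (Suc i) j"
proof (cases "forest_filter (Suc i + j) = bot")
  \<comment> \<open>Tannery's theorem asks for a nontrivial filter; along the trivial one every
    limit holds.\<close>
  case True
  thus ?thesis by (simp add: mixed_ratio_converges_def)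
next
  case False
  define r where "r = Suc i + j"
  define G where "G = (\<lambda>d. A (Suc (Suc k)) ^ i * A (Suc k) ^ (j + d))"
  define f where "f = (\<lambda>d n. if d = 0 then 0 else real r * (w d * G d $ (n - 1)) / (y ^ r) $ n)"
  obtain \<sigma> where \<sigma>: "0 < \<sigma>" "\<sigma> < 1" "\<And>d n. (A 1 ^ d) $ n \<le> \<sigma> ^ (d - 1) * (y ^ d) $ n"
    using A_1_power_bound by blast
  have G: "0 \<preceq> G d" "G d \<preceq> y ^ (i + j + d)" for d
    using A_mixed_nonneg A_mixed_le[of "Suc (Suc k)" i "Suc k" "j + d"] by (auto simp: G_def add.assoc)
  have lim: "(f d \<longlongrightarrow> (if d = 0 then 0 else p d * mixed_limit (Suc k) i (j + d))) (forest_filter r)" for d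
  proof (cases d)
    case (Suc e)
    have "((\<lambda>n. real r * (w d * G d $ (n - 1)) / (y ^ r) $ n) \<longlongrightarrow> p d * mixed_limit (Suc k) i (j + d)) (forest_filter r)"
    proof (rule peeled_ratio_tendsto[where r' = "i + j + d"])
      show "((\<lambda>n. real (i + j + d) * G d $ n / (y ^ (i + j + d)) $ n) \<longlongrightarrow> mixed_limit (Suc k) i (j + d))
          (forest_filter (i + j + d))"
        using IH[of e] Suc unfolding mixed_ratio_converges_def G_def by (simp add: add.assoc)
      show "G d \<preceq> y ^ (i + j + d)" by (rule G(2))
    qed (use G(1) Suc in \<open>auto simp: r_def\<close>)
    thus ?thesis using Suc by (simp add: f_def)
  qed (simp add: f_def)
  have bound: "norm (f d n) \<le> real r * \<sigma> ^ (d - 1)" for d n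
  proof (cases "d = 0")
    case False
    have le: "G d \<preceq> y ^ (i + j) * A 1 ^ d"
    proof -
      have "A (Suc (Suc k)) ^ i * A (Suc k) ^ j * A (Suc k) ^ d \<preceq> y ^ (i + j) * A 1 ^ d"
        by (intro fps_le_mult A_mixed_le fps_le_power A_nonneg A_antimono fps_nonneg_power) auto
      thus ?thesis by (simp add: G_def power_add mult.assoc)
    qed
    have "y ^ (i + j) * A 1 ^ d \<preceq> y ^ (i + j) * (fps_const (\<sigma> ^ (d - 1)) * y ^ d)"
      using \<sigma>(3)[of d] by (intro fps_le_mult fps_le_refl fps_nonneg_power A_nonneg) (simp add: fps_le_def)
    with le have "G d \<preceq> y ^ (i + j) * (fps_const (\<sigma> ^ (d - 1)) * y ^ d)" by (rule fps_le_trans)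
    hence "G d \<preceq> fps_const (\<sigma> ^ (d - 1)) * y ^ (r - 1 + d)"
      by (simp add: r_def power_add mult_ac)
    from fps_leD[OF this, of "n - 1"]
    have "G d $ (n - 1) \<le> \<sigma> ^ (d - 1) * (y ^ (r - 1 + d)) $ (n - 1)" by simp
    hence "w d * G d $ (n - 1) / (y ^ r) $ n \<le> w d * (\<sigma> ^ (d - 1) * (y ^ (r - 1 + d)) $ (n - 1)) / (y ^ r) $ n"
      using w_nonneg y_power_nonneg by (intro divide_right_mono mult_left_mono) auto
    also have "\<dots> = \<sigma> ^ (d - 1) * (w d * (y ^ (r - 1 + d)) $ (n - 1) / (y ^ r) $ n)" by simp
    also have "\<dots> \<le> \<sigma> ^ (d - 1) * 1"
      using \<sigma> by (intro mult_left_mono forest_ratio_le_1) (auto simp: r_def)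
    finally have "w d * G d $ (n - 1) / (y ^ r) $ n \<le> \<sigma> ^ (d - 1)" by simp
    from mult_left_mono[OF this, of "real r"]
    have "f d n \<le> real r * \<sigma> ^ (d - 1)" using False by (simp add: f_def)
    moreover have "f d n \<ge> 0"
      using w_nonneg y_power_nonneg fps_leD[OF G(1)]
      by (auto simp: f_def intro!: divide_nonneg_nonneg mult_nonneg_nonneg)
    ultimately show ?thesis by simp
  qed (use \<sigma> in \<open>simp add: f_def\<close>)
  have M: "summable (\<lambda>d. real r * \<sigma> ^ (d - 1))"
    by (subst summable_Suc_iff[symmetric]) (use \<sigma> in \<open>simp add: summable_geometric summable_mult\<close>)
  have "eventually (\<lambda>(d, n). norm (f d n) \<le> real r * \<sigma> ^ (d - 1)) (at_top \<times>\<^sub>F forest_filter r)"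
    using bound by (intro always_eventually) auto
  from tannerys_theorem[OF lim this M]
  have "((\<lambda>n. \<Sum>d. f d n) \<longlongrightarrow> (\<Sum>d. if d = 0 then 0 else p d * mixed_limit (Suc k) i (j + d))) (forest_filter r)"
    using False by (simp add: r_def)
  also have "(\<Sum>d. if d = 0 then 0 else p d * mixed_limit (Suc k) i (j + d)) = mixed_limit (Suc k) (Suc i) j"
    using mixed_limit_Suc_sums by (rule sums_unique[symmetric])
  finally have "((\<lambda>n. \<Sum>d. f d n) \<longlongrightarrow> mixed_limit (Suc k) (Suc i) j) (forest_filter r)" .
  moreover have "eventually (\<lambda>n. (\<Sum>d. f d n) =
      real r * (A (Suc (Suc k)) ^ Suc i * A (Suc k) ^ j) $ n / (y ^ r) $ n) (forest_filter r)"
    using eventually_forest_filterI[OF eventually_gt_at_top[of 0]]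
  proof eventually_elim
    case (elim n)
    then obtain m where n: "n = Suc m" by (cases n) auto
    have "(\<Sum>d. f d n) = (\<Sum>d\<le>m. f d n)"
    proof (rule suminf_finite)
      fix d assume "d \<notin> {..m}"
      hence "G d $ m = 0" by (intro fps_le_y_power_nth_eq_0[OF G]) simp
      thus "f d n = 0" by (simp add: f_def n)
    qed simp
    also have "\<dots> = real r * (\<Sum>d\<le>m. (w(0 := 0)) d * G d $ m) / (y ^ r) $ n"
      unfolding sum_distrib_left sum_divide_distrib
      by (intro sum.cong refl) (simp add: f_def n)
    also have "(\<Sum>d\<le>m. (w(0 := 0)) d * G d $ m) = (A (Suc (Suc k)) * (A (Suc (Suc k)) ^ i * A (Suc k) ^ j)) $ Suc m"
      unfolding A_peel G_def by (intro sum.cong refl) (simp add: power_add mult_ac)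
    finally show ?case by (simp add: n mult.assoc)
  qed
  ultimately have "((\<lambda>n. real r * (A (Suc (Suc k)) ^ Suc i * A (Suc k) ^ j) $ n / (y ^ r) $ n) \<longlongrightarrow>
      mixed_limit (Suc k) (Suc i) j) (forest_filter r)"
    by (rule Lim_transform_eventually)
  thus ?thesis by (simp add: mixed_ratio_converges_def r_def del: power_Suc)
qed

text \<open>Outer induction on the height, inner induction on \<open>i\<close>; for
  \<open>i = 0\<close> the product \<open>A (Suc k) ^ j\<close> already occurs at the preceding
  height, with exponents \<open>j\<close> and 0.\<close>

lemma mixed_ratio_converges:
  "i + j \<ge> 1 \<Longrightarrow> mixed_ratio_converges k i j"
proof (induction k arbitrary: i j)
  case 0
  thus ?case by (rule mixed_ratio_converges_0)
next
  case (Suc k)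
  show ?case using Suc.prems
  proof (induction i arbitrary: j)
    case 0
    hence "mixed_ratio_converges k j 0" by (intro Suc.IH) simp
    thus ?case by (simp add: mixed_ratio_converges_def mixed_limit_def)
  next
    case (Suc i)
    show ?case by (rule mixed_ratio_converges_Suc) (rule Suc.IH, simp)
  qed
qed

theorem tree_ratio_tendsto:
  "((\<lambda>n. A k $ n / y $ n) \<longlongrightarrow> spine \<xi> k) (forest_filter 1)"
  using mixed_ratio_converges[of 0 1 k] by (simp add: mixed_ratio_converges_def mixed_limit_def)

end

section \<open>The limit tree\<close>

text \<open>Recursion from the root, so that a branch is the tree of the shifted offspring numbers;
  \<open>limit_tree\<close> grows at the end of the word instead.\<close>

primrec in_tree :: "(nat list \<Rightarrow> enat) \<Rightarrow> nat list \<Rightarrow> bool" where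
  "in_tree c [] = True"
| "in_tree c (i # u) = (enat i < c [] \<and> in_tree (\<lambda>v. c (i # v)) u)"

definition offspring_tree :: "(nat list \<Rightarrow> enat) \<Rightarrow> nat list set" where
  "offspring_tree c = {u. in_tree c u}"

lemma offspring_tree_snoc: "u @ [i] \<in> offspring_tree c \<longleftrightarrow> u \<in> offspring_tree c \<and> enat i < c u"
  unfolding offspring_tree_def by (induction u arbitrary: c) auto

lemma limit_tree_eq: "limit_tree l = offspring_tree (offspring_number l)"
proof (intro set_eqI)
  fix u
  show "u \<in> limit_tree l \<longleftrightarrow> u \<in> offspring_tree (offspring_number l)"
    by (induction u rule: rev_induct)
      (auto simp: limit_tree_snoc offspring_tree_snoc limit_tree_Nil, auto simp: offspring_tree_def)
qed

lemma plane_tree_offspring_tree: "plane_tree (offspring_tree c)"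
  unfolding plane_tree_def offspring_tree_snoc
  by (auto intro: order_less_trans[rotated] simp: offspring_tree_def)

lemma singleton_in_offspring_tree: "[i] \<in> offspring_tree c \<longleftrightarrow> enat i < c []"
  by (simp add: offspring_tree_def)

lemma branch_offspring_tree:
  "enat i < c [] \<Longrightarrow> branch (offspring_tree c) i = offspring_tree (\<lambda>v. c (i # v))"
  by (simp add: branch_def offspring_tree_def)

lemma no_leaf_below_offspring_tree_Suc:
  "no_leaf_below (Suc k) (offspring_tree c) \<longleftrightarrow>
     c [] \<noteq> 0 \<and> (\<forall>i. enat i < c [] \<longrightarrow> no_leaf_below k (offspring_tree (\<lambda>v. c (i # v))))"
  unfolding no_leaf_below_Suc[OF plane_tree_offspring_tree] singleton_in_offspring_tree
  by (auto simp: branch_offspring_tree zero_enat_def[symmetric])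

text \<open>Survival as an event about the labels, recursive through the shifted labellings
  \<open>\<lambda>u. l (i # u)\<close>, whose independence gives the recursions of
  \<open>alive\<close> and \<open>spine\<close>.\<close>

primrec normal_alive :: "nat \<Rightarrow> labelling \<Rightarrow> bool" where
  "normal_alive 0 l = True"
| "normal_alive (Suc k) l = (fst (l []) \<noteq> 0 \<and> (\<forall>i. i < fst (l []) \<longrightarrow> normal_alive k (\<lambda>u. l (i # u))))"

text \<open>With infinitely many children the third label is 0 by convention; the test for
  \<open>\<infinity>\<close> keeps child number 0 from being taken for special.\<close>

primrec special_alive :: "nat \<Rightarrow> labelling \<Rightarrow> bool" where
  "special_alive 0 l = True"
| "special_alive (Suc k) l = (fst (snd (l [])) \<noteq> 0 \<and>
     (\<forall>i. enat i < fst (snd (l [])) \<longrightarrow>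
        (if i = snd (snd (l [])) \<and> fst (snd (l [])) \<noteq> \<infinity> then special_alive k (\<lambda>u. l (i # u))
         else normal_alive k (\<lambda>u. l (i # u)))))"

lemma normal_alive_iff: "no_leaf_below k (offspring_tree (\<lambda>u. enat (fst (l u)))) \<longleftrightarrow> normal_alive k l"
proof (induction k arbitrary: l)
  case (Suc k)
  show ?case
    unfolding no_leaf_below_offspring_tree_Suc normal_alive.simps Suc.IH[of "\<lambda>u. l (_ # u)"]
    by (simp add: zero_enat_def)
qed (simp add: no_leaf_below_0)

text \<open>\<open>special\<close> extends the spine at its last vertex; read from the first step,
  the rest of the spine is that of a shifted labelling.\<close>

lemma special_Cons:
  "special l (i # u) \<longleftrightarrow> i = snd (snd (l [])) \<and> fst (snd (l [])) \<noteq> \<infinity> \<and> special (\<lambda>v. l (i # v)) u"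
proof (induction u rule: rev_induct)
  case Nil
  have "special l ([] @ [i]) \<longleftrightarrow> i = snd (snd (l [])) \<and> fst (snd (l [])) \<noteq> \<infinity>"
    unfolding special_snoc by (cases "l []") (auto simp: special_Nil)
  thus ?case by (simp add: special_Nil)
next
  case (snoc j u)
  have "special l ((i # u) @ [j]) \<longleftrightarrow>
      i = snd (snd (l [])) \<and> fst (snd (l [])) \<noteq> \<infinity> \<and> special (\<lambda>v. l (i # v)) (u @ [j])"
    unfolding special_snoc snoc by simp
  thus ?case by simp
qed

lemma special_alive_iff: "no_leaf_below k (limit_tree l) \<longleftrightarrow> special_alive k l"
proof (induction k arbitrary: l)
  case (Suc k)
  have root: "offspring_number l [] = fst (snd (l []))"
    by (simp add: offspring_number_def special_Nil split: prod.splits)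
  have sub: "offspring_number l (i # u) =
      (if i = snd (snd (l [])) \<and> fst (snd (l [])) \<noteq> \<infinity> then offspring_number (\<lambda>v. l (i # v)) u
       else enat (fst (l (i # u))))" for i u
    by (auto simp: offspring_number_def special_Cons split: prod.splits)
  have "no_leaf_below k (offspring_tree (\<lambda>u. offspring_number l (i # u))) \<longleftrightarrow>
      (if i = snd (snd (l [])) \<and> fst (snd (l [])) \<noteq> \<infinity> then special_alive k (\<lambda>u. l (i # u))
         else normal_alive k (\<lambda>u. l (i # u)))" for i
  proof (cases "i = snd (snd (l [])) \<and> fst (snd (l [])) \<noteq> \<infinity>")
    case True
    hence "(\<lambda>u. offspring_number l (i # u)) = offspring_number (\<lambda>v. l (i # v))"
      unfolding sub by (simp only: simp_thms if_True)
    thus ?thesis using Suc.IH[of "\<lambda>u. l (i # u)"] True by (simp only: limit_tree_eq simp_thms if_True)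
  next
    case False
    hence "(\<lambda>u. offspring_number l (i # u)) = (\<lambda>u. enat (fst (l (i # u))))"
      unfolding sub by (simp only: if_False)
    thus ?thesis using normal_alive_iff[of k "\<lambda>u. l (i # u)"] False by (simp only: if_False)
  qed
  thus ?case
    unfolding limit_tree_eq no_leaf_below_offspring_tree_Suc root special_alive.simps by simp
qed (simp add: no_leaf_below_0)

section \<open>Independence of the labels and survival probabilities\<close>

lemma space_labelling_space [simp]: "space (labelling_space p) = UNIV"
  by (simp add: labelling_space_def space_PiM)

lemma label_measurable: "(\<lambda>l. l u) \<in> measurable (labelling_space p) (measure_pmf (label_pmf p))"
  unfolding labelling_space_def by (rule measurable_component_singleton) simp

lemma label_pred_measurable: "Measurable.pred (labelling_space p) (\<lambda>l. P (l u))"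
proof (rule measurable_compose[OF label_measurable, where g = P])
  show "P \<in> measurable (measure_pmf (label_pmf p)) (count_space UNIV)" by simp
qed

lemma shift_measurable: "(\<lambda>l u. l (i # u)) \<in> measurable (labelling_space p) (labelling_space p)"
proof -
  have "(\<lambda>l. \<lambda>u\<in>UNIV. l (i # u)) \<in> measurable (labelling_space p) (Pi\<^sub>M UNIV (\<lambda>_. measure_pmf (label_pmf p)))"
    using label_measurable by (rule measurable_restrict)
  thus ?thesis by (simp add: labelling_space_def[symmetric] restrict_UNIV)
qed

lemma distr_shift: "distr (labelling_space p) (labelling_space p) (\<lambda>l u. l (i # u)) = labelling_space p"
proof -
  have "distr (Pi\<^sub>M UNIV (\<lambda>_. measure_pmf (label_pmf p))) (Pi\<^sub>M UNIV (\<lambda>_. measure_pmf (label_pmf p)))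
      (\<lambda>l. \<lambda>u\<in>UNIV. l (i # u)) = Pi\<^sub>M UNIV (\<lambda>_. measure_pmf (label_pmf p))"
    by (rule distr_PiM_reindex) (auto simp: measure_pmf.prob_space_axioms inj_on_def)
  thus ?thesis by (simp add: labelling_space_def restrict_UNIV)
qed

text \<open>The root and the blocks \<open>range ((#) i)\<close> are disjoint sets of words, so the
  labels on them are independent, and each shifted block has the law of the whole labelling. In
  \<open>K\<close>, \<open>None\<close> stands for the root block.\<close>

lemma prob_labelling_root_shifts:
  assumes B: "\<And>i. i \<in> I \<Longrightarrow> B i \<in> sets (labelling_space p)" and I: "finite I"
  shows "measure (labelling_space p) {l. l [] \<in> S \<and> (\<forall>i\<in>I. (\<lambda>u. l (i # u)) \<in> B i)} =
    measure_pmf.prob (label_pmf p) S * (\<Prod>i\<in>I. measure (labelling_space p) (B i))"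
proof -
  let ?M = "labelling_space p" and ?L = "measure_pmf (label_pmf p)"
  interpret prob_space ?M by (rule prob_space_labelling_space)
  have eq: "distr ?M ?L (\<lambda>l. l u) = ?L" for u
    unfolding labelling_space_def by (rule distr_PiM_component) (auto simp: measure_pmf.prob_space_axioms)
  have ind: "indep_vars (\<lambda>_. ?L) (\<lambda>u l. l u) UNIV"
    unfolding indep_vars_iff_distr_eq_PiM[OF UNIV_not_empty label_measurable] eq restrict_UNIV
      labelling_space_def[symmetric] by (simp add: distr_id2)
  define K :: "nat option \<Rightarrow> nat list set" where "K = case_option {[]} (\<lambda>i. range ((#) i))"
  define C where "C = case_option {f \<in> space (Pi\<^sub>M {[]} (\<lambda>_. ?L)). f [] \<in> S}
    (\<lambda>i. {f \<in> space (Pi\<^sub>M (range ((#) i)) (\<lambda>_. ?L)). (\<lambda>u. f (i # u)) \<in> B i})"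
  have ind': "indep_vars (\<lambda>j. Pi\<^sub>M (K j) (\<lambda>_. ?L)) (\<lambda>j l. restrict (\<lambda>u. l u) (K j)) UNIV"
    by (rule indep_vars_restrict[OF ind]) (auto simp: K_def disjoint_family_on_def split: option.splits)
  have shift: "(\<lambda>f u. f (i # u)) \<in> measurable (Pi\<^sub>M (range ((#) i)) (\<lambda>_. ?L)) ?M" for i
  proof -
    have "(\<lambda>f. \<lambda>u\<in>UNIV. f (i # u)) \<in> measurable (Pi\<^sub>M (range ((#) i)) (\<lambda>_. ?L)) (Pi\<^sub>M UNIV (\<lambda>_. ?L))"
      by (intro measurable_restrict measurable_component_singleton) auto
    thus ?thesis by (simp add: labelling_space_def[symmetric] restrict_UNIV)
  qed
  have C_sets: "C j \<in> sets (Pi\<^sub>M (K j) (\<lambda>_. ?L))" if "j \<in> insert None (Some ` I)" for j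
  proof (cases j)
    case None
    have "(\<lambda>f. f []) -` S \<inter> space (Pi\<^sub>M {[] :: nat list} (\<lambda>_. ?L)) \<in> sets (Pi\<^sub>M {[]} (\<lambda>_. ?L))"
      by (rule measurable_sets[OF measurable_component_singleton]) auto
    moreover have "(\<lambda>f. f []) -` S \<inter> space (Pi\<^sub>M {[]} (\<lambda>_. ?L)) = C j"
      using None by (auto simp: C_def)
    ultimately show ?thesis unfolding None K_def by (simp only: option.case)
  next
    case (Some i)
    hence "(\<lambda>f u. f (i # u)) -` B i \<inter> space (Pi\<^sub>M (range ((#) i)) (\<lambda>_. ?L)) \<in> sets (Pi\<^sub>M (range ((#) i)) (\<lambda>_. ?L))"
      using that B by (intro measurable_sets[OF shift]) auto
    moreover have "(\<lambda>f u. f (i # u)) -` B i \<inter> space (Pi\<^sub>M (range ((#) i)) (\<lambda>_. ?L)) = C j"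
      using Some by (auto simp: C_def)
    ultimately show ?thesis unfolding Some K_def by (simp only: option.case)
  qed
  have vim_None: "(\<lambda>l. restrict (\<lambda>u. l u) (K None)) -` C None \<inter> space ?M = (\<lambda>l. l []) -` S \<inter> space ?M"
    by (auto simp: C_def K_def space_PiM)
  have vim_Some: "(\<lambda>l. restrict (\<lambda>u. l u) (K (Some i))) -` C (Some i) \<inter> space ?M =
      (\<lambda>l u. l (i # u)) -` B i \<inter> space ?M" for i
    by (auto simp: C_def K_def space_PiM)
  have "prob (\<Inter>j\<in>insert None (Some ` I). (\<lambda>l. restrict (\<lambda>u. l u) (K j)) -` C j \<inter> space ?M) =
      (\<Prod>j\<in>insert None (Some ` I). prob ((\<lambda>l. restrict (\<lambda>u. l u) (K j)) -` C j \<inter> space ?M))"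
    using I C_sets by (intro indep_varsD[OF ind']) auto
  also have "(\<Inter>j\<in>insert None (Some ` I). (\<lambda>l. restrict (\<lambda>u. l u) (K j)) -` C j \<inter> space ?M) =
      {l. l [] \<in> S \<and> (\<forall>i\<in>I. (\<lambda>u. l (i # u)) \<in> B i)}"
    unfolding INT_insert vim_None by (auto simp: vim_Some[simplified])
  also have "(\<Prod>j\<in>insert None (Some ` I). prob ((\<lambda>l. restrict (\<lambda>u. l u) (K j)) -` C j \<inter> space ?M)) =
      prob ((\<lambda>l. l []) -` S \<inter> space ?M) * (\<Prod>i\<in>I. prob ((\<lambda>l u. l (i # u)) -` B i \<inter> space ?M))"
    using I by (subst prod.insert) (auto simp: prod.reindex vim_None vim_Some simp del: space_labelling_space)
  also have "prob ((\<lambda>l. l []) -` S \<inter> space ?M) = measure ?L S"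
    using measure_distr[OF label_measurable, of S p "[]"] by (simp add: eq)
  also have "(\<Prod>i\<in>I. prob ((\<lambda>l u. l (i # u)) -` B i \<inter> space ?M)) = (\<Prod>i\<in>I. prob (B i))"
    using B by (intro prod.cong refl) (simp add: measure_distr[OF shift_measurable, symmetric] distr_shift del: space_labelling_space)
  finally show ?thesis .
qed

lemma normal_alive_measurable: "Measurable.pred (labelling_space p) (normal_alive k)"
proof (induction k)
  case (Suc k)
  have "Measurable.pred (labelling_space p) (\<lambda>l. normal_alive k (\<lambda>u. l (i # u)))" for i
    by (rule measurable_compose[OF shift_measurable Suc])
  thus ?case
    unfolding normal_alive.simps
    by (intro pred_intros_logic pred_intros_countable label_pred_measurable)
      (simp_all add: label_pred_measurable[where P = "\<lambda>x. _ < fst x"])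
qed simp

lemma special_alive_measurable: "Measurable.pred (labelling_space p) (special_alive k)"
proof (induction k)
  case (Suc k)
  have 1: "Measurable.pred (labelling_space p) (\<lambda>l. normal_alive k (\<lambda>u. l (i # u)))" for i
    by (rule measurable_compose[OF shift_measurable normal_alive_measurable])
  have 2: "Measurable.pred (labelling_space p) (\<lambda>l. special_alive k (\<lambda>u. l (i # u)))" for i
    by (rule measurable_compose[OF shift_measurable Suc])
  have 3: "special_alive (Suc k) = (\<lambda>l. fst (snd (l [])) \<noteq> 0 \<and>
     (\<forall>i. enat i < fst (snd (l [])) \<longrightarrow>
        (i = snd (snd (l [])) \<and> fst (snd (l [])) \<noteq> \<infinity> \<longrightarrow> special_alive k (\<lambda>u. l (i # u))) \<and>
        (\<not> (i = snd (snd (l [])) \<and> fst (snd (l [])) \<noteq> \<infinity>) \<longrightarrow> normal_alive k (\<lambda>u. l (i # u)))))"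
    by (auto simp: fun_eq_iff)
  show ?case
    unfolding 3
    by (intro pred_intros_logic pred_intros_countable 1 2
        label_pred_measurable[where P = "\<lambda>x. fst (snd x) = _"] label_pred_measurable[where P = "\<lambda>x. fst (snd x) = \<infinity>"]
        label_pred_measurable[where P = "\<lambda>x. _ < fst (snd x)"] label_pred_measurable[where P = "\<lambda>x. _ = snd (snd x)"])
qed simp

lemma prob_normal_alive: "measure (labelling_space p) {l. normal_alive k l} = alive p k"
proof (induction k)
  case 0
  interpret prob_space "labelling_space p" by (rule prob_space_labelling_space)
  show ?case using prob_space by simp
next
  case (Suc k)
  let ?M = "labelling_space p"
  interpret prob_space ?M by (rule prob_space_labelling_space)
  have N: "{l. normal_alive k l} \<in> sets ?M"
    using normal_alive_measurable[of k p] by (simp add: pred_def)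
  \<comment> \<open>The empty set at \<open>d = 0\<close> matches the coefficient 0 in
    \<open>alive\<close>: a root without children is a leaf.\<close>
  define E where "E = (\<lambda>d. {l. l [] \<in> (if d = 0 then {} else {x. fst x = d}) \<and> (\<forall>i\<in>{..<d}. (\<lambda>u. l (i # u)) \<in> {l. normal_alive k l})})"
  have E_sets: "E d \<in> sets ?M" for d
  proof -
    have "Measurable.pred ?M (\<lambda>l. l [] \<in> (if d = 0 then {} else {x. fst x = d}) \<and> (\<forall>i\<in>{..<d}. normal_alive k (\<lambda>u. l (i # u))))"
      by (intro pred_intros_logic pred_intros_finite label_pred_measurable
          measurable_compose[OF shift_measurable normal_alive_measurable]) simp
    thus ?thesis by (simp add: E_def pred_def)
  qed
  have "(\<lambda>d. prob (E d)) sums prob (\<Union>d. E d)"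
    using E_sets by (intro finite_measure_UNION) (auto simp: disjoint_family_on_def E_def split: if_splits)
  moreover have "prob (E d) = (if d = 0 then 0 else pmf p d) * alive p k ^ d" for d
  proof -
    have "prob (E d) = measure_pmf.prob (label_pmf p) (if d = 0 then {} else {x. fst x = d}) * (\<Prod>i\<in>{..<d}. alive p k)"
      unfolding E_def Suc[symmetric] by (rule prob_labelling_root_shifts) (use N in auto)
    moreover have "measure_pmf.prob (label_pmf p) {x. fst x = d} = measure_pmf.prob (map_pmf fst (label_pmf p)) {d}"
      by (simp add: vimage_def)
    moreover have "\<dots> = pmf p d" by (simp add: label_pmf_def map_fst_pair_pmf measure_pmf_single)
    ultimately show ?thesis by simp
  qed
  moreover have "(\<Union>d. E d) = {l. normal_alive (Suc k) l}"
    by (auto simp: E_def split: if_splits)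
  ultimately have "(\<lambda>d. (if d = 0 then 0 else pmf p d) * alive p k ^ d) sums prob {l. normal_alive (Suc k) l}" by simp
  thus ?case using alive_sums sums_unique2 by blast
qed

lemma pmf_bind_map_Pair:
  "pmf (bind_pmf A (\<lambda>k. map_pmf (Pair k) (q k))) (a, b) = pmf A a * pmf (q a) b"
proof -
  have "pmf (map_pmf (Pair k) (q k)) (a, b) = indicator {a} k * pmf (q a) b" for k
  proof (cases "k = a")
    case True
    have "inj (Pair a)" by (rule injI) (rule Pair_inject)
    from pmf_map_inj'[OF this, of "q a" b] show ?thesis unfolding True by simp
  next
    case False
    hence "(a, b) \<notin> set_pmf (map_pmf (Pair k) (q k))" by auto
    hence "pmf (map_pmf (Pair k) (q k)) (a, b) = 0" by (simp only: set_pmf_iff) simp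
    thus ?thesis using False by simp
  qed
  thus ?thesis by (simp add: pmf_bind measure_pmf_single)
qed

lemma pmf_special_label:
  "pmf (special_label_pmf p) (a, b) = pmf (size_biased_pmf p) a *
     pmf (case a of enat j \<Rightarrow> pmf_of_set {..<j} | \<infinity> \<Rightarrow> return_pmf 0) b"
  unfolding special_label_pmf_def by (rule pmf_bind_map_Pair)

context
  fixes p :: "nat pmf"
  assumes mean: "integrable (measure_pmf p) real" "measure_pmf.expectation p real \<le> 1"
    and leaf: "pmf p 0 > 0"
begin

text \<open>The size-biased law has no mass at 0, which also rules out a uniform choice from the
  empty set.\<close>

lemma special_label_support:
  assumes "x \<in> set_pmf (label_pmf p)"
  shows "fst (snd x) \<noteq> 0" and "fst (snd x) = enat d \<Longrightarrow> snd (snd x) < d"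
proof -
  have s: "snd x \<in> set_pmf (special_label_pmf p)" using assms by (auto simp: label_pmf_def)
  hence "pmf (special_label_pmf p) (fst (snd x), snd (snd x)) \<noteq> 0" by (simp add: set_pmf_iff)
  hence 1: "pmf (size_biased_pmf p) (fst (snd x)) \<noteq> 0"
    and 2: "pmf (case fst (snd x) of enat j \<Rightarrow> pmf_of_set {..<j} | \<infinity> \<Rightarrow> return_pmf 0) (snd (snd x)) \<noteq> 0"
    unfolding pmf_special_label by auto
  show *: "fst (snd x) \<noteq> 0"
    using 1 pmf_size_biased_pmf(1)[OF mean, of 0] by (auto simp: zero_enat_def)
  assume d: "fst (snd x) = enat d"
  hence "d \<noteq> 0" using * by (simp add: zero_enat_def)
  hence "finite {..<d}" "{..<d} \<noteq> {}" by auto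
  thus "snd (snd x) < d" using 2 d by (auto simp: indicator_def split: if_splits)
qed

lemma AE_special_label:
  "AE l in labelling_space p. fst (snd (l [])) \<noteq> 0 \<and> (\<forall>d. fst (snd (l [])) = enat d \<longrightarrow> snd (snd (l [])) < d)"
proof -
  have "AE x in measure_pmf (label_pmf p). fst (snd x) \<noteq> 0 \<and> (\<forall>d. fst (snd x) = enat d \<longrightarrow> snd (snd x) < d)"
    using special_label_support by (auto simp: AE_measure_pmf_iff)
  thus ?thesis
    unfolding labelling_space_def
    by (intro AE_PiM_component[where i = "[]"]) (auto simp: measure_pmf.prob_space_axioms)
qed

text \<open>The first \<open>n\<close> branches are independent and each survives with probability
  \<open>alive p (Suc k) \<le> 1 - pmf p 0 < 1\<close>; then \<open>n\<close> tends to
  infinity.\<close>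

lemma prob_infinite_normal_alive:
  "measure (labelling_space p) {l. \<forall>i. normal_alive (Suc k) (\<lambda>u. l (i # u))} = 0"
proof -
  let ?M = "labelling_space p"
  interpret prob_space ?M by (rule prob_space_labelling_space)
  have N: "{l. normal_alive (Suc k) l} \<in> sets ?M"
    using normal_alive_measurable[of "Suc k" p] by (simp add: pred_def del: normal_alive.simps)
  let ?E = "{l. \<forall>i. normal_alive (Suc k) (\<lambda>u. l (i # u))}"
  let ?a = "alive p (Suc k)"
  have a: "0 \<le> ?a" "?a < 1" using alive_nonneg alive_Suc_le[of p k] leaf by (auto simp del: alive.simps)
  have "prob ?E \<le> ?a ^ n" for n
  proof -
    let ?F = "{l. l [] \<in> UNIV \<and> (\<forall>i\<in>{..<n}. (\<lambda>u. l (i # u)) \<in> {l. normal_alive (Suc k) l})}"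
    have "Measurable.pred ?M (\<lambda>l. l [] \<in> UNIV \<and> (\<forall>i\<in>{..<n}. normal_alive (Suc k) (\<lambda>u. l (i # u))))"
      by (intro pred_intros_logic pred_intros_finite label_pred_measurable
          measurable_compose[OF shift_measurable normal_alive_measurable]) simp
    hence "?F \<in> sets ?M" by (simp add: pred_def del: normal_alive.simps)
    hence "prob ?E \<le> prob ?F" by (intro finite_measure_mono) (auto simp del: normal_alive.simps)
    also have "\<dots> = measure_pmf.prob (label_pmf p) UNIV * (\<Prod>i\<in>{..<n}. ?a)"
      unfolding prob_normal_alive[symmetric] by (rule prob_labelling_root_shifts) (use N in auto)
    finally show ?thesis by simp
  qed
  moreover have "(\<lambda>n. ?a ^ n) \<longlonglongrightarrow> 0" using a by (intro LIMSEQ_power_zero) simp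
  ultimately have "prob ?E \<le> 0" by (intro LIMSEQ_le_const) auto
  thus ?thesis using measure_nonneg[of ?M ?E] by linarith
qed


text \<open>Disjoint events over the root degree \<open>d\<close> and the position \<open>j\<close>
  of the special child. The size-biased weight \<open>d * pmf p d\<close> times the uniform
  probability \<open>1 / d\<close> leaves \<open>pmf p d\<close> for each pair, and the
  \<open>d\<close> positions restore the factor \<open>d\<close> in \<open>spine\<close>. Beyond the
  first level, infinite degree contributes a null set.\<close>

lemma prob_special_alive: "measure (labelling_space p) {l. special_alive k l} = spine p k"
proof -
  let ?M = "labelling_space p"
  interpret prob_space ?M by (rule prob_space_labelling_space)
  have S: "{l. special_alive k l} \<in> sets ?M" for k
    using special_alive_measurable[of k p] by (simp add: pred_def)
  have N: "{l. normal_alive k l} \<in> sets ?M" for k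
    using normal_alive_measurable[of k p] by (simp add: pred_def)
  show ?thesis
  proof (induction k)
    case 0
    show ?case using prob_space by simp
  next
    case (Suc k)
    show ?case
    proof (cases k)
      case 0
      have "AE l in ?M. l \<in> {l. special_alive (Suc 0) l}"
        using AE_special_label by eventually_elim simp
      hence "prob {l. special_alive (Suc 0) l} = 1" unfolding prob_eq_1[OF S[of "Suc 0"]] .
      thus ?thesis using 0 by (simp del: special_alive.simps)
    next
      case k: (Suc m)
      let ?a = "alive p k"
      define E where "E = (\<lambda>d j. {l. l [] \<in> {x. snd x = (enat d, j)} \<and>
        (\<forall>i\<in>{..<d}. (\<lambda>u. l (i # u)) \<in> (if i = j then {l. special_alive k l} else {l. normal_alive k l}))})"
      have shifted: "Measurable.pred ?M (\<lambda>l. if i = j then special_alive k (\<lambda>u. l (i # u)) else normal_alive k (\<lambda>u. l (i # u)))"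
        for i j
        using measurable_compose[OF shift_measurable normal_alive_measurable[of k p], of i]
          measurable_compose[OF shift_measurable special_alive_measurable[of k p], of i]
        by (cases "i = j") simp_all
      have E_sets: "E d j \<in> sets ?M" for d j
      proof -
        have "Measurable.pred ?M (\<lambda>l. snd (l []) = (enat d, j) \<and>
            (\<forall>i\<in>{..<d}. if i = j then special_alive k (\<lambda>u. l (i # u)) else normal_alive k (\<lambda>u. l (i # u))))"
          by (intro pred_intros_logic pred_intros_finite label_pred_measurable[where P = "\<lambda>x. snd x = _"] shifted)
            simp
        also have "(\<lambda>l. snd (l []) = (enat d, j) \<and>
            (\<forall>i\<in>{..<d}. if i = j then special_alive k (\<lambda>u. l (i # u)) else normal_alive k (\<lambda>u. l (i # u)))) =
            (\<lambda>l. l \<in> E d j)"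
          by (auto simp: E_def fun_eq_iff)
        finally show ?thesis by (simp add: pred_def)
      qed
      have E_prob: "prob (E d j) = pmf p d * (?a ^ (d - 1) * spine p k)" if "j < d" for d j
      proof -
        have "prob (E d j) = measure_pmf.prob (label_pmf p) {x. snd x = (enat d, j)} *
            (\<Prod>i\<in>{..<d}. prob (if i = j then {l. special_alive k l} else {l. normal_alive k l}))"
          unfolding E_def by (rule prob_labelling_root_shifts) (use S N in auto)
        also have "(\<Prod>i\<in>{..<d}. prob (if i = j then {l. special_alive k l} else {l. normal_alive k l})) =
            (\<Prod>i\<in>{..<d}. if i = j then spine p k else ?a)"
          using Suc by (intro prod.cong refl) (simp add: prob_normal_alive)
        also have "\<dots> = spine p k * (\<Prod>i\<in>{..<d} - {j}. ?a)"
        proof -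
          have "(\<Prod>i\<in>{..<d} - {j}. if i = j then spine p k else ?a) = (\<Prod>i\<in>{..<d} - {j}. ?a)"
            by (rule prod.cong) auto
          thus ?thesis using that prod.remove[of "{..<d}" j "\<lambda>i. if i = j then spine p k else ?a"] by simp
        qed
        also have "(\<Prod>i\<in>{..<d} - {j}. ?a) = ?a ^ (d - 1)" using that by simp
        also have "measure_pmf.prob (label_pmf p) {x. snd x = (enat d, j)} =
            measure_pmf.prob (map_pmf snd (label_pmf p)) {(enat d, j)}"
          by (simp add: vimage_def)
        also have "\<dots> = pmf (special_label_pmf p) (enat d, j)"
          by (simp add: label_pmf_def map_snd_pair_pmf measure_pmf_single)
        also have "\<dots> = real d * pmf p d * (1 / real d)"
          using that by (subst pmf_special_label) (auto simp: pmf_size_biased_pmf(1)[OF mean] lessThan_empty_iff)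
        finally show ?thesis using that by simp
      qed
      define U where "U = (\<lambda>d. \<Union>j<d. E d j)"
      have U_sets: "U d \<in> sets ?M" for d
        unfolding U_def using E_sets by (intro sets.finite_UN) auto
      have U_prob: "prob (U d) = real d * pmf p d * ?a ^ (d - 1) * spine p k" for d
      proof -
        have "disjoint_family_on (E d) {..<d}" by (auto simp: disjoint_family_on_def E_def)
        hence "prob (U d) = (\<Sum>j<d. prob (E d j))"
          unfolding U_def using E_sets by (intro finite_measure_finite_Union) auto
        thus ?thesis by (simp add: E_prob)
      qed
      have "disjoint_family U" by (auto simp: disjoint_family_on_def U_def E_def)
      hence "(\<lambda>d. prob (U d)) sums prob (\<Union>d. U d)"
        using U_sets by (intro finite_measure_UNION) auto
      hence sums: "(\<lambda>d. real d * pmf p d * ?a ^ (d - 1) * spine p k) sums prob (\<Union>d. U d)"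
        unfolding U_prob .
      have "AE l in ?M. \<not> (\<forall>i. normal_alive k (\<lambda>u. l (i # u)))"
      proof (rule AE_I')
        have "{l. \<forall>i. normal_alive k (\<lambda>u. l (i # u))} \<in> sets ?M"
        proof -
          have "Measurable.pred ?M (\<lambda>l. \<forall>i. normal_alive k (\<lambda>u. l (i # u)))"
            by (intro pred_intros_countable measurable_compose[OF shift_measurable normal_alive_measurable])
          thus ?thesis by (simp add: pred_def)
        qed
        thus "{l. \<forall>i. normal_alive k (\<lambda>u. l (i # u))} \<in> null_sets ?M"
          using prob_infinite_normal_alive[of m] k by (simp add: null_sets_def emeasure_eq_measure)
      qed auto
      with AE_special_label have "AE l in ?M. l \<in> {l. special_alive (Suc k) l} \<longleftrightarrow> l \<in> (\<Union>d. U d)"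
      proof eventually_elim
        case (elim l)
        obtain a b j where l: "l [] = (a, b, j)" by (cases "l []")
        show ?case
        proof (cases b)
          case (enat d)
          hence "j < d" "d \<noteq> 0" using elim l by (auto simp: zero_enat_def)
          thus ?thesis using l enat by (auto simp: U_def E_def zero_enat_def)
        next
          case infinity
          thus ?thesis using elim l by (auto simp: U_def E_def)
        qed
      qed
      hence 1: "prob {l. special_alive (Suc k) l} = prob (\<Union>d. U d)"
        using S[of "Suc k"] U_sets by (intro measure_eq_AE) auto
      have 2: "spine p (Suc k) = (\<Sum>d. real d * pmf p d * ?a ^ (d - 1)) * spine p k"
        using k by (simp del: alive.simps)
      have 3: "(\<lambda>d. real d * pmf p d * ?a ^ (d - 1) * spine p k) sums
          ((\<Sum>d. real d * pmf p d * ?a ^ (d - 1)) * spine p k)"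
      proof (intro sums_mult2 summable_sums summable_alive_deriv)
        show "?a < 1" using alive_Suc_le[of p m] leaf k by simp
      qed
      show ?thesis unfolding 1 2 by (rule sums_unique2[OF sums 3])
    qed
  qed
qed

theorem prob_border_dist_limit_tree:
  "measure (labelling_space p) {l. enat k \<le> border_dist (limit_tree l)} = spine p k"
  using prob_special_alive[of k] by (simp add: border_dist_ge_iff special_alive_iff)

end

section \<open>Convergence of the border distance\<close>

lemma enat_borel: "A \<in> sets (borel :: enat measure)"
proof -
  have "(\<Union>x\<in>A. {x}) \<in> sets borel" by (intro sets.countable_UN') auto
  thus ?thesis by simp
qed

text \<open>Vanishing tails exclude mass at infinity, so that integrals become series over the
  differences of consecutive tails.\<close>

locale enat_law = prob_space M for M :: "enat measure" +
  assumes sets_eq: "sets M = sets borel"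
    and tail_0: "(\<lambda>k. measure M {x. enat k \<le> x}) \<longlonglongrightarrow> 0"
begin

abbreviation "tail k \<equiv> measure M {x. enat k \<le> x}"

lemma enat_sets: "A \<in> sets M"
  unfolding sets_eq by (rule enat_borel)

lemma tail_decreasing: "tail (Suc k) \<le> tail k"
  by (intro finite_measure_mono enat_sets) (auto simp: Suc_ile_eq less_imp_le)

lemma prob_point: "prob {enat k} = tail k - tail (Suc k)"
proof -
  have "{x. enat k \<le> x} = {enat k} \<union> {x. enat (Suc k) \<le> x}"
    by (auto simp: Suc_ile_eq)
  hence "tail k = prob {enat k} + tail (Suc k)"
    using finite_measure_Union[of "{enat k}" "{x. enat (Suc k) \<le> x}"] enat_sets by simp
  thus ?thesis by simp
qed

lemma AE_finite: "AE x in M. x \<noteq> \<infinity>"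
proof (rule AE_I')
  have "prob {\<infinity>} \<le> tail k" for k by (intro finite_measure_mono enat_sets) auto
  hence "prob {\<infinity>} \<le> 0" using tail_0 by (intro LIMSEQ_le_const) auto
  hence "prob {\<infinity>} = 0" using measure_nonneg[of M "{\<infinity>}"] by linarith
  thus "{\<infinity>} \<in> null_sets M" using enat_sets by (simp add: null_sets_def emeasure_eq_measure)
qed auto

lemma nn_integral_eq:
  fixes g :: "enat \<Rightarrow> ennreal"
  shows "(\<integral>\<^sup>+x. g x \<partial>M) = (\<Sum>k. g (enat k) * ennreal (tail k - tail (Suc k)))"
proof -
  have "(\<integral>\<^sup>+x. g x \<partial>M) = (\<integral>\<^sup>+x. (\<Sum>k. g (enat k) * indicator {enat k} x) \<partial>M)"
  proof (rule nn_integral_cong_AE, use AE_finite in eventually_elim)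
    fix x :: enat assume "x \<noteq> \<infinity>"
    then obtain k where k: "x = enat k" by auto
    have "(\<Sum>i. g (enat i) * indicator {enat i} x) = (\<Sum>i\<in>{k}. g (enat i) * indicator {enat i} x)"
      by (rule suminf_finite) (auto simp: k)
    thus "g x = (\<Sum>i. g (enat i) * indicator {enat i} x)" by (simp add: k)
  qed
  also have "\<dots> = (\<Sum>k. \<integral>\<^sup>+x. g (enat k) * indicator {enat k} x \<partial>M)"
    by (intro nn_integral_suminf borel_measurable_times_ennreal borel_measurable_indicator enat_sets) auto
  also have "\<dots> = (\<Sum>k. g (enat k) * ennreal (tail k - tail (Suc k)))"
    by (simp add: nn_integral_cmult_indicator enat_sets emeasure_eq_measure prob_point)
  finally show ?thesis .
qed

lemma integral_eq:
  fixes f :: "enat \<Rightarrow> real"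
  assumes "bounded (range f)"
  shows "(\<integral>x. f x \<partial>M) = (\<Sum>k. f (enat k) * (tail k - tail (Suc k)))"
proof -
  obtain B where B: "\<And>x. norm (f x) \<le> B" using assms by (auto simp: bounded_iff)
  have telescope: "(\<lambda>k. tail k - tail (Suc k)) sums (tail 0 - 0)"
    using tail_0 by (rule telescope_sums')
  have "(\<integral>x. f x \<partial>M) = (\<integral>x. (\<Sum>k. f (enat k) * indicator {enat k} x) \<partial>M)"
  proof (rule integral_cong_AE)
    show "f \<in> borel_measurable M" "(\<lambda>x. \<Sum>k. f (enat k) * indicator {enat k} x) \<in> borel_measurable M"
      by (auto intro!: measurableI enat_sets)
    show "AE x in M. f x = (\<Sum>k. f (enat k) * indicator {enat k} x)"
      using AE_finite
    proof eventually_elim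
      case (elim x)
      then obtain k where k: "x = enat k" by auto
      have "(\<Sum>i. f (enat i) * indicator {enat i} x) = (\<Sum>i\<in>{k}. f (enat i) * indicator {enat i} x)"
        by (rule suminf_finite) (auto simp: k)
      thus ?case by (simp add: k)
    qed
  qed
  also have "\<dots> = (\<Sum>k. \<integral>x. f (enat k) * indicator {enat k} x \<partial>M)"
  proof (rule integral_suminf)
    show "integrable M (\<lambda>x. f (enat k) * indicator {enat k} x)" for k
      using enat_sets by (intro integrable_mult_right integrable_real_indicator) (auto simp: emeasure_eq_measure)
    show "AE x in M. summable (\<lambda>k. norm (f (enat k) * indicator {enat k} x))"
    proof (rule AE_I2)
      fix x :: enat
      show "summable (\<lambda>k. norm (f (enat k) * indicator {enat k} x))"
      proof (cases x)
        case (enat k)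
        thus ?thesis by (intro summable_finite[of "{k}"]) auto
      qed simp
    qed
    show "summable (\<lambda>k. \<integral>x. norm (f (enat k) * indicator {enat k} x) \<partial>M)"
    proof (rule summable_comparison_test')
      show "summable (\<lambda>k. B * (tail k - tail (Suc k)))"
        using telescope by (intro summable_mult) (rule sums_summable)
      fix k
      have "(\<integral>x. norm (f (enat k) * indicator {enat k} x) \<partial>M) = norm (f (enat k)) * prob {enat k}"
        using enat_sets by (simp add: abs_mult)
      also have "\<dots> \<le> B * prob {enat k}" using B by (intro mult_right_mono) auto
      finally show "norm (\<integral>x. norm (f (enat k) * indicator {enat k} x) \<partial>M) \<le> B * (tail k - tail (Suc k))"
        by (simp add: prob_point)
    qed
  qed
  also have "\<dots> = (\<Sum>k. f (enat k) * (tail k - tail (Suc k)))"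
    using enat_sets by (simp add: prob_point)
  finally show ?thesis .
qed

end

text \<open>One factor of \<open>\<rho> ^ k = \<sigma> ^ k * \<sigma> ^ k\<close> absorbs the power
  of \<open>k\<close>, the other is summable.\<close>

lemma summable_powr_geometric:
  assumes "0 < \<rho>" "\<rho> < (1 :: real)"
  shows "summable (\<lambda>k. real k powr q * \<rho> ^ k)"
proof -
  define \<sigma> where "\<sigma> = sqrt \<rho>"
  have \<sigma>: "0 < \<sigma>" "\<sigma> < 1" "\<rho> = \<sigma> * \<sigma>" using assms by (auto simp: \<sigma>_def)
  have "(\<lambda>k. real k powr q * \<sigma> ^ k) \<longlonglongrightarrow> 0" using \<sigma>(1,2) by real_asymp
  hence "eventually (\<lambda>k. real k powr q * \<sigma> ^ k < 1) sequentially" by (rule order_tendstoD) simp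
  hence "eventually (\<lambda>k. norm (real k powr q * \<rho> ^ k) \<le> \<sigma> ^ k) sequentially"
  proof eventually_elim
    case (elim k)
    have "(real k powr q * \<sigma> ^ k) * \<sigma> ^ k \<le> 1 * \<sigma> ^ k" using elim \<sigma> by (intro mult_right_mono) auto
    thus ?case using \<sigma> by (simp add: power_mult_distrib mult.assoc)
  qed
  thus ?thesis by (rule summable_comparison_test_ev) (use \<sigma> in \<open>simp add: summable_geometric\<close>)
qed

context weights
begin

section \<open>Tails of the border distance and passage to the limit\<close>

lemma y_nth: "y $ n = (\<Sum>T\<in>plane_trees n. tree_weight w T)"
  by (simp add: tree_fps_def no_leaf_below_0)

lemma sgt_defined_iff: "sgt_defined w n \<longleftrightarrow> y $ n > 0"
proof
  assume "sgt_defined w n"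
  thus "y $ n > 0" unfolding y_nth sgt_defined_def
    using tree_weight_nonneg finite_plane_trees by (meson sum_pos2)
next
  assume "y $ n > 0"
  thus "sgt_defined w n" unfolding y_nth sgt_defined_def by (meson not_le sum_nonpos)
qed

lemma sgt_filter_eq: "sgt_filter w = forest_filter 1"
  unfolding sgt_filter_def forest_filter_def sgt_defined_iff using y_power_pos_iff[of 1] by simp

lemma eventually_sgt_defined: "eventually (sgt_defined w) (sgt_filter w)"
  by (simp add: sgt_filter_def eventually_inf_principal)

text \<open>With \<open>w d > 0\<close>, a tree gains \<open>d\<close> vertices when it is attached
  to a new root of degree \<open>d\<close> next to \<open>d - 1\<close> single vertices, so sizes
  \<open>1 + j * d\<close> all occur.\<close>

lemma sgt_filter_nontrivial: "sgt_filter w \<noteq> bot"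
proof
  assume "sgt_filter w = bot"
  then obtain N where N: "\<And>n. n \<ge> N \<Longrightarrow> \<not> y $ n > 0"
    using eventually_bot[of "\<lambda>_. False"]
    unfolding sgt_filter_def sgt_defined_iff
    by (metis (no_types, lifting) eventually_inf_principal eventually_sequentially mem_Collect_eq)
  obtain d where d: "d \<ge> 2" "w d > 0" using ws by (auto simp: weight_sequence_def)
  have "y $ (1 + j * d) > 0" for j
  proof (induction j)
    case 0
    show ?case using y_1 w0_pos by simp
  next
    case (Suc j)
    have "0 < w d * w 0 ^ (d - 2) * (y $ (1 + j * d) * y $ 1)"
      using Suc d w0_pos y_1 by simp
    also have "\<dots> \<le> y $ (1 + j * d + 1 + (d - 1))" by (rule y_supermultiplicative[OF d(1)])
    also have "1 + j * d + 1 + (d - 1) = 1 + Suc j * d" using d by simp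
    finally show ?case .
  qed
  moreover have "N * 1 \<le> N * d" using d by (intro mult_le_mono2) simp
  hence "1 + N * d \<ge> N" by linarith
  ultimately show False using N by blast
qed

lemma sgt_tail:
  assumes "sgt_defined w n"
  shows "measure (sgt_border_law w n) {x. enat k \<le> x} = A k $ n / y $ n"
proof -
  have S: "finite (plane_trees n \<inter> {T. no_leaf_below k T})" using finite_plane_trees by simp
  have "measure (sgt_border_law w n) {x. enat k \<le> x} =
      measure_pmf.prob (simply_generated_tree w n) {T. no_leaf_below k T}"
    unfolding sgt_border_law_def
    by (subst measure_distr[OF _ enat_borel]) (simp_all add: border_dist_ge_iff vimage_def)
  also have "\<dots> = measure_pmf.prob (simply_generated_tree w n) (plane_trees n \<inter> {T. no_leaf_below k T})"
    by (intro measure_prob_cong_0) (auto simp: pmf_simply_generated_tree[OF ws assms])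
  also have "\<dots> = (\<Sum>T\<in>plane_trees n \<inter> {T. no_leaf_below k T}. tree_weight w T / y $ n)"
    unfolding measure_measure_pmf_finite[OF S] y_nth
    by (intro sum.cong refl) (simp add: pmf_simply_generated_tree[OF ws assms])
  also have "\<dots> = A k $ n / y $ n"
    using finite_plane_trees
    by (simp add: sum_divide_distrib[symmetric] tree_fps_def sum.inter_restrict)
  finally show ?thesis .
qed

lemma limit_tail: "measure (limit_border_law w) {x. enat k \<le> x} = spine \<xi> k"
  unfolding limit_border_law_def
  using prob_border_dist_limit_tree[OF offspring_pmf_mean[OF ws] p0_pos, of k]
  by (subst measure_distr[OF border_dist_limit_tree_measurable enat_borel]) (simp add: vimage_def)

lemma tail_tendsto:
  "((\<lambda>n. measure (sgt_border_law w n) {x. enat k \<le> x}) \<longlongrightarrow> measure (limit_border_law w) {x. enat k \<le> x})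
    (sgt_filter w)"
  unfolding limit_tail
proof (rule Lim_transform_eventually)
  show "((\<lambda>n. A k $ n / y $ n) \<longlongrightarrow> spine \<xi> k) (sgt_filter w)"
    unfolding sgt_filter_eq by (rule tree_ratio_tendsto)
  show "eventually (\<lambda>n. A k $ n / y $ n = measure (sgt_border_law w n) {x. enat k \<le> x}) (sgt_filter w)"
    using eventually_sgt_defined by eventually_elim (simp add: sgt_tail)
qed

text \<open>The limit law inherits the bound through \<open>tail_tendsto\<close>, since the filter
  is nontrivial.\<close>

lemma tail_bound:
  obtains C \<rho> where "C > 0" "0 < \<rho>" "\<rho> < 1"
    "\<And>k n. sgt_defined w n \<Longrightarrow> measure (sgt_border_law w n) {x. enat k \<le> x} \<le> C * \<rho> ^ k"
    "\<And>k. measure (limit_border_law w) {x. enat k \<le> x} \<le> C * \<rho> ^ k"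
proof -
  obtain C \<rho> where C: "C > 0" "0 < \<rho>" "\<rho> < 1" "\<And>k n. A k $ n \<le> C * \<rho> ^ k * y $ n"
    using A_tail_bound by blast
  have 1: "measure (sgt_border_law w n) {x. enat k \<le> x} \<le> C * \<rho> ^ k" if "sgt_defined w n" for k n
    unfolding sgt_tail[OF that] using that C(4)[of k n] by (simp add: sgt_defined_iff field_simps)
  have "measure (limit_border_law w) {x. enat k \<le> x} \<le> C * \<rho> ^ k" for k
    using eventually_mono[OF eventually_sgt_defined 1]
    by (intro tendsto_upperbound[OF tail_tendsto _ sgt_filter_nontrivial])
  with 1 C show ?thesis by (intro that) auto
qed

lemma enat_lawI:
  assumes "prob_space M" "sets M = sets borel" "0 < \<rho>" "\<rho> < 1" "\<And>k. measure M {x. enat k \<le> x} \<le> C * \<rho> ^ k"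
  shows "enat_law M"
proof -
  interpret prob_space M by fact
  have "(\<lambda>k. C * \<rho> ^ k) \<longlonglongrightarrow> C * 0"
    using assms(3,4) by (intro tendsto_mult tendsto_const LIMSEQ_power_zero) simp
  hence "(\<lambda>k. C * \<rho> ^ k) \<longlonglongrightarrow> 0" by simp
  hence "(\<lambda>k. measure M {x. enat k \<le> x}) \<longlonglongrightarrow> 0"
    by (rule tendsto_sandwich[OF _ _ tendsto_const, rotated 2]) (auto simp: assms(5))
  thus ?thesis using assms(2) by unfold_locales
qed

lemma prob_space_laws: "prob_space (sgt_border_law w n)" "prob_space (limit_border_law w)"
  unfolding sgt_border_law_def limit_border_law_def
  by (auto intro!: prob_space.prob_space_distr measure_pmf.prob_space_axioms
      prob_space_labelling_space border_dist_limit_tree_measurable)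

text \<open>Tannery's theorem for the point probabilities \<open>m\<close>, which are dominated by
  the tails. Bounded \<open>f\<close> yields weak convergence, \<open>f k = real k powr q\<close>
  the moments.\<close>

lemma series_tendsto:
  fixes f :: "nat \<Rightarrow> real"
  assumes f: "summable (\<lambda>k. norm (f k) * \<rho> ^ k)" and \<rho>: "\<rho> > 0"
    and bound: "\<And>k n. sgt_defined w n \<Longrightarrow> measure (sgt_border_law w n) {x. enat k \<le> x} \<le> C * \<rho> ^ k"
  defines "m \<equiv> \<lambda>M k. measure M {x. enat k \<le> x} - measure M {x. enat (Suc k) \<le> x}"
  shows "((\<lambda>n. \<Sum>k. f k * m (sgt_border_law w n) k) \<longlongrightarrow> (\<Sum>k. f k * m (limit_border_law w) k)) (sgt_filter w)"
proof -
  have "eventually (\<lambda>n. \<forall>k. norm (f k * m (sgt_border_law w n) k) \<le> C * (norm (f k) * \<rho> ^ k)) (sgt_filter w)"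
    using eventually_sgt_defined
  proof eventually_elim
    case (elim n)
    interpret prob_space "sgt_border_law w n" by (rule prob_space_laws)
    show ?case
    proof
      fix k
      have "prob {x. enat (Suc k) \<le> x} \<le> prob {x. enat k \<le> x}"
        by (intro finite_measure_mono) (auto simp: Suc_ile_eq less_imp_le sgt_border_law_def enat_borel)
      hence "0 \<le> m (sgt_border_law w n) k" by (simp add: m_def)
      moreover have "m (sgt_border_law w n) k \<le> C * \<rho> ^ k"
        using bound[OF elim, of k] measure_nonneg[of "sgt_border_law w n" "{x. enat (Suc k) \<le> x}"]
        unfolding m_def by linarith
      ultimately have "norm (f k) * \<bar>m (sgt_border_law w n) k\<bar> \<le> norm (f k) * (C * \<rho> ^ k)"
        by (intro mult_left_mono) auto
      thus "norm (f k * m (sgt_border_law w n) k) \<le> C * (norm (f k) * \<rho> ^ k)"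
        by (simp add: abs_mult mult_ac)
    qed
  qed
  hence "eventually (\<lambda>(j :: nat, n). \<forall>k. norm (f k * m (sgt_border_law w n) k) \<le> C * (norm (f k) * \<rho> ^ k))
      (at_top \<times>\<^sub>F sgt_filter w)"
    by (subst eventually_prod2) auto
  hence ev: "eventually (\<lambda>(k, n). norm (f k * m (sgt_border_law w n) k) \<le> C * (norm (f k) * \<rho> ^ k))
      (at_top \<times>\<^sub>F sgt_filter w)"
    by (rule eventually_mono) auto
  have lim: "((\<lambda>n. f k * m (sgt_border_law w n) k) \<longlongrightarrow> f k * m (limit_border_law w) k) (sgt_filter w)" for k
    unfolding m_def by (intro tendsto_mult tendsto_const tendsto_diff tail_tendsto)
  show ?thesis
    using tannerys_theorem[OF lim ev summable_mult[OF f] sgt_filter_nontrivial] by simp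
qed

theorem border_dist_converges:
  "conv_in_distribution (sgt_border_law w) (limit_border_law w) (sgt_filter w)"
  "\<And>q. (\<integral>\<^sup>+x. enat_powr x q \<partial>limit_border_law w) < \<infinity>"
  "\<And>q. ((\<lambda>n. \<integral>\<^sup>+x. enat_powr x q \<partial>sgt_border_law w n) \<longlongrightarrow>
      (\<integral>\<^sup>+x. enat_powr x q \<partial>limit_border_law w)) (sgt_filter w)"
proof -
  define m where "m = (\<lambda>M k. measure M {x. enat k \<le> x} - measure M {x. enat (Suc k) \<le> x})"
  obtain C \<rho> where C: "C > 0" "0 < \<rho>" "\<rho> < 1"
    "\<And>k n. sgt_defined w n \<Longrightarrow> measure (sgt_border_law w n) {x. enat k \<le> x} \<le> C * \<rho> ^ k"
    "\<And>k. measure (limit_border_law w) {x. enat k \<le> x} \<le> C * \<rho> ^ k"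
    using tail_bound by blast
  have law: "enat_law (sgt_border_law w n)" if "sgt_defined w n" for n
    by (rule enat_lawI[OF prob_space_laws(1) _ C(2,3) C(4)[OF that]]) (simp add: sgt_border_law_def)
  have law': "enat_law (limit_border_law w)"
    by (rule enat_lawI[OF prob_space_laws(2) _ C(2,3,5)]) (simp add: limit_border_law_def)
  show "conv_in_distribution (sgt_border_law w) (limit_border_law w) (sgt_filter w)"
    unfolding conv_in_distribution_def
  proof (intro allI impI)
    fix f :: "enat \<Rightarrow> real" assume f: "bounded (range f)"
    obtain B where B: "\<And>x. norm (f x) \<le> B" using f by (auto simp: bounded_iff)
    have sm: "summable (\<lambda>k. norm (f (enat k)) * \<rho> ^ k)"
    proof (rule summable_comparison_test')
      show "summable (\<lambda>k. B * \<rho> ^ k)" using C by (intro summable_mult summable_geometric) simp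
      show "norm (norm (f (enat k)) * \<rho> ^ k) \<le> B * \<rho> ^ k" for k
        using C(2) B[of "enat k"] by (simp add: mult_right_mono)
    qed
    have "((\<lambda>n. \<Sum>k. f (enat k) * m (sgt_border_law w n) k) \<longlongrightarrow> (\<integral>x. f x \<partial>limit_border_law w)) (sgt_filter w)"
      unfolding enat_law.integral_eq[OF law' f] m_def by (rule series_tendsto[OF sm C(2,4)])
    moreover have "eventually (\<lambda>n. (\<Sum>k. f (enat k) * m (sgt_border_law w n) k) = (\<integral>x. f x \<partial>sgt_border_law w n)) (sgt_filter w)"
      using eventually_sgt_defined by eventually_elim (simp add: enat_law.integral_eq[OF law f] m_def)
    ultimately show "((\<lambda>n. \<integral>x. f x \<partial>sgt_border_law w n) \<longlongrightarrow> (\<integral>x. f x \<partial>limit_border_law w)) (sgt_filter w)"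
      by (rule Lim_transform_eventually)
  qed
  have moment: "summable (\<lambda>k. real k powr q * m M k) \<and>
      (\<integral>\<^sup>+x. enat_powr x q \<partial>M) = ennreal (\<Sum>k. real k powr q * m M k)"
    if M: "enat_law M" and bd: "\<And>k. measure M {x. enat k \<le> x} \<le> C * \<rho> ^ k" for M q
  proof -
    interpret enat_law M by fact
    have m: "0 \<le> m M k" "m M k \<le> C * \<rho> ^ k" for k
      using tail_decreasing[of k] bd[of k] measure_nonneg[of M "{x. enat (Suc k) \<le> x}"]
      unfolding m_def by linarith+
    have nn: "0 \<le> real k powr q * m M k" for k using m by simp
    have sm: "summable (\<lambda>k. real k powr q * m M k)"
    proof (rule summable_comparison_test')
      show "summable (\<lambda>k. C * (real k powr q * \<rho> ^ k))"
        by (intro summable_mult summable_powr_geometric C)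
      fix k
      have "real k powr q * m M k \<le> real k powr q * (C * \<rho> ^ k)" using m by (intro mult_left_mono) auto
      thus "norm (real k powr q * m M k) \<le> C * (real k powr q * \<rho> ^ k)" using nn[of k] by (simp add: mult_ac)
    qed
    have "(\<integral>\<^sup>+x. enat_powr x q \<partial>M) = (\<Sum>k. ennreal (real k powr q * m M k))"
      unfolding nn_integral_eq using m by (intro suminf_cong) (simp add: enat_powr_def m_def ennreal_mult)
    thus ?thesis using sm suminf_ennreal2[OF nn sm] by simp
  qed
  show "(\<integral>\<^sup>+x. enat_powr x q \<partial>limit_border_law w) < \<infinity>" for q
    using moment[OF law' C(5), of q] by simp
  show "((\<lambda>n. \<integral>\<^sup>+x. enat_powr x q \<partial>sgt_border_law w n) \<longlongrightarrow>
      (\<integral>\<^sup>+x. enat_powr x q \<partial>limit_border_law w)) (sgt_filter w)" for q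
  proof -
    have sm: "summable (\<lambda>k. norm (real k powr q) * \<rho> ^ k)"
      using summable_powr_geometric[OF C(2,3)] by simp
    have "((\<lambda>n. ennreal (\<Sum>k. real k powr q * m (sgt_border_law w n) k)) \<longlongrightarrow>
        (\<integral>\<^sup>+x. enat_powr x q \<partial>limit_border_law w)) (sgt_filter w)"
      unfolding moment[OF law' C(5), THEN conjunct2] m_def
      by (intro tendsto_ennrealI series_tendsto[OF sm C(2,4)])
    moreover have "eventually (\<lambda>n. ennreal (\<Sum>k. real k powr q * m (sgt_border_law w n) k) =
        (\<integral>\<^sup>+x. enat_powr x q \<partial>sgt_border_law w n)) (sgt_filter w)"
      using eventually_sgt_defined by eventually_elim (simp add: moment[OF law C(4)])
    ultimately show ?thesis by (rule Lim_transform_eventually)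
  qed
qed

end

theorem theorem2:
  fixes w :: "nat \<Rightarrow> real"
  assumes "weight_sequence w"
  shows "conv_in_distribution (sgt_border_law w) (limit_border_law w) (sgt_filter w) \<and>
         (\<forall>p::real. p \<ge> 1 \<longrightarrow>
            (\<integral>\<^sup>+x. enat_powr x p \<partial>limit_border_law w) < \<infinity> \<and>
            ((\<lambda>n. \<integral>\<^sup>+x. enat_powr x p \<partial>sgt_border_law w n) \<longlongrightarrow>
               (\<integral>\<^sup>+x. enat_powr x p \<partial>limit_border_law w)) (sgt_filter w))"
proof -
  interpret weights w using assms by unfold_locales
  show ?thesis using border_dist_converges by blast
qed

end
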